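(* Let $E$ be a Banach space, $H$ a separable Hilbert space, and $A:D(A)\subset E\to E$ the generator of a $C_0$-semigroup $S(t)$ on $E$ with $\|S(t)\|_{\mathcal L(E)}\le Me^{-\omega t}$ for all $t\ge 0$, for some $M\ge 1$, $\omega>0$. Let $Q$ be a linear operator with domain $H$ such that $S(t)Q\in\mathcal L(H,E)$ for every $t>0$ and such that for every $t>0$ the stochastic convolution $Z(t)=\int_0^t S(t-s)Q\,dw(s)$ is an $E$-valued Gaussian random variable. Then for every $r>0$ the set $$\mathcal K(r)=\left\{\varphi\in C((-\infty,0];E):\lim_{t\to-\infty}|\varphi(t)|_E=0,\ I_{-\infty,0}(\varphi)\le r\right\}$$ is compact in the topology of uniform convergence on compact subsets of $(-\infty,0]$.
   Context: $w(t)=\sum_{k\ge1}\beta_k(t)e_k$ (formal sum) is a cylindrical Wiener process on $H$: $\{e_k\}$ is a complete orthonormal system of $H$ and $\{\beta_k\}$ are independent one-dimensional Brownian motions. $Q$ need not be bounded into $E$; only the operators $S(t)Q\in\mathcal L(H,E)$, $t>0$, are used, with $S(s)(S(t)Q)=S(s+t)Q$. $Z(t)$ is characterized by $\langle Z(t),x^\star\rangle_{E,E^\star}=\sum_k\int_0^t\langle S(t-s)Qe_k,x^\star\rangle_{E,E^\star}d\beta_k(s)$ for $x^\star\in E^\star$. For $x\in E$ and $\psi\in L^2([0,T];H)$ put $X^\psi_x(t)=S(t)x+\int_0^tS(t-s)Q\psi(s)ds$. For $\varphi\in C([0,T];E)$, $I_{0,T}(\varphi)=\inf\{\frac12|\psi|^2_{L^2([0,T];H)}:\varphi=X^\psi_{\varphi(0)}\}$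 with $\inf\emptyset=+\infty$. For $\varphi\in C((-\infty,0];E)$ and $T>0$, $I_{-T,0}(\varphi)=I_{0,T}(\varphi(\cdot-T))$ and $I_{-\infty,0}(\varphi)=\sup_{T>0}I_{-T,0}(\varphi)$. *)

theory Defs
  imports "HOL-Probability.Probability"
begin

section \<open>Semigroups, generators, and the operators S(t)Q\<close>

text \<open>Only the restriction of S to the half-line of nonnegative reals is meaningful.\<close>

definition C0_semigroup :: "(real \<Rightarrow> 'e::banach \<Rightarrow>\<^sub>L 'e) \<Rightarrow> bool" where
  "C0_semigroup S \<longleftrightarrow>
     S 0 = id_blinfun \<and>
     (\<forall>s\<ge>0. \<forall>t\<ge>0. S (s + t) = S s o\<^sub>L S t) \<and>
     (\<forall>x. ((\<lambda>t. S t x) \<longlongrightarrow> x) (at_right 0))"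

definition is_generator ::
    "(real \<Rightarrow> 'e::banach \<Rightarrow>\<^sub>L 'e) \<Rightarrow> 'e set \<Rightarrow> ('e \<Rightarrow> 'e) \<Rightarrow> bool" where
  "is_generator S D A \<longleftrightarrow>
     D = {x. \<exists>y. ((\<lambda>h. (S h x - x) /\<^sub>R h) \<longlongrightarrow> y) (at_right 0)} \<and>
     (\<forall>x\<in>D. ((\<lambda>h. (S h x - x) /\<^sub>R h) \<longlongrightarrow> A x) (at_right 0))"

text \<open>
  The operator Q need not take values in E: it maps H into a vector space F that contains E
  (through the embedding j) and on which every S(t) with t > 0 is still defined, with values in E.
  SF t is this extension of S(t). No topology on F is needed. If Q does map into E,
  take F = E, j the identity and SF = S. The smallest F that can occur is E + Q(H).
\<close>

definition semigroup_extension ::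
    "(real \<Rightarrow> 'e::banach \<Rightarrow>\<^sub>L 'e) \<Rightarrow> ('e \<Rightarrow> 'f::real_vector) \<Rightarrow> (real \<Rightarrow> 'f \<Rightarrow> 'e) \<Rightarrow> bool" where
  "semigroup_extension S j SF \<longleftrightarrow>
     linear j \<and> inj j \<and>
     (\<forall>t>0. linear (SF t) \<and> (\<forall>x. SF t (j x) = S t x)) \<and>
     (\<forall>s\<ge>0. \<forall>t>0. \<forall>y. S s (SF t y) = SF (s + t) y)"


section \<open>Brownian motions and cylindrical Wiener processes\<close>

definition brownian_motion :: "'p measure \<Rightarrow> (real \<Rightarrow> 'p \<Rightarrow> real) \<Rightarrow> bool" where
  "brownian_motion P \<beta> \<longleftrightarrow>
     (\<forall>t\<ge>0. \<beta> t \<in> borel_measurable P) \<and>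
     (AE \<omega> in P. \<beta> 0 \<omega> = 0) \<and>
     (AE \<omega> in P. continuous_on {0..} (\<lambda>t. \<beta> t \<omega>)) \<and>
     (\<forall>s\<ge>0. \<forall>t>s. distributed P lborel (\<lambda>\<omega>. \<beta> t \<omega> - \<beta> s \<omega>) (normal_density 0 (sqrt (t - s)))) \<and>
     (\<forall>n \<tau>. 0 \<le> \<tau> 0 \<and> strict_mono_on {..n::nat} \<tau> \<longrightarrow>
        prob_space.indep_vars P (\<lambda>_. borel) (\<lambda>i \<omega>. \<beta> (\<tau> (Suc i)) \<omega> - \<beta> (\<tau> i) \<omega>) {..<n})"

text \<open>
  The index set K is a set of natural numbers, so that finite-dimensional H are covered as well.
\<close>

definition complete_orthonormal :: "nat set \<Rightarrow> (nat \<Rightarrow> 'h::real_inner) \<Rightarrow> bool" where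
  "complete_orthonormal K e \<longleftrightarrow>
     (\<forall>k\<in>K. \<forall>l\<in>K. e k \<bullet> e l = (if k = l then 1 else 0)) \<and>
     closure (span (e ` K)) = UNIV"

text \<open>
  The processes are independent as random variables with values in the space of functions
  on the half-line, equipped with the product sigma-algebra.
\<close>

definition cylindrical_wiener ::
    "'p measure \<Rightarrow> nat set \<Rightarrow> (nat \<Rightarrow> 'h::real_inner) \<Rightarrow> (nat \<Rightarrow> real \<Rightarrow> 'p \<Rightarrow> real) \<Rightarrow> bool" where
  "cylindrical_wiener P K e \<beta> \<longleftrightarrow>
     complete_orthonormal K e \<and>
     (\<forall>k\<in>K. brownian_motion P (\<beta> k)) \<and>
     prob_space.indep_vars P (\<lambda>_. PiM {0..} (\<lambda>_. borel))
       (\<lambda>k \<omega>. \<lambda>t\<in>{0..}. \<beta> k t \<omega>) K"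


section \<open>The Wiener integral\<close>

text \<open>
  Functions on [0,T] with finite squared L2-norm; functions are not identified almost everywhere.
\<close>

definition L2norm_sq :: "real \<Rightarrow> (real \<Rightarrow> 'b::real_normed_vector) \<Rightarrow> ennreal" where
  "L2norm_sq T f = (\<integral>\<^sup>+ s\<in>{0..T}. ennreal ((norm (f s))\<^sup>2) \<partial>lborel)"

definition L2_fun :: "real \<Rightarrow> (real \<Rightarrow> 'b::real_normed_vector) \<Rightarrow> bool" where
  "L2_fun T f \<longleftrightarrow> set_borel_measurable lborel {0..T} f \<and> L2norm_sq T f < \<infinity>"

text \<open>
  A list of triples (a, b, c) encodes the step function that is the sum of the functions
  c 1_(a,b].
\<close>

definition step_valid :: "real \<Rightarrow> (real \<times> real \<times> real) list \<Rightarrow> bool" where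
  "step_valid t xs \<longleftrightarrow> (\<forall>(a, b, c)\<in>set xs. 0 \<le> a \<and> a \<le> b \<and> b \<le> t)"

definition step_fun :: "(real \<times> real \<times> real) list \<Rightarrow> real \<Rightarrow> real" where
  "step_fun xs s = (\<Sum>(a, b, c)\<leftarrow>xs. c * indicator {a<..b} s)"

definition step_integral ::
    "(real \<Rightarrow> 'p \<Rightarrow> real) \<Rightarrow> (real \<times> real \<times> real) list \<Rightarrow> 'p \<Rightarrow> real" where
  "step_integral \<beta> xs \<omega> = (\<Sum>(a, b, c)\<leftarrow>xs. c * (\<beta> b \<omega> - \<beta> a \<omega>))"

text \<open>
  X is (a version of) the integral over [0,t] of f against the Brownian motion \<beta>, i.e. the
  L2(P)-limit of the integrals of step functions that converge to f in L2(0,t).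
\<close>

definition has_wiener_integral ::
    "'p measure \<Rightarrow> (real \<Rightarrow> 'p \<Rightarrow> real) \<Rightarrow> real \<Rightarrow> (real \<Rightarrow> real) \<Rightarrow> ('p \<Rightarrow> real) \<Rightarrow> bool" where
  "has_wiener_integral P \<beta> t f X \<longleftrightarrow>
     L2_fun t f \<and> X \<in> borel_measurable P \<and>
     (\<exists>xs. (\<forall>n::nat. step_valid t (xs n)) \<and>
           (\<lambda>n. L2norm_sq t (\<lambda>s. step_fun (xs n) s - f s)) \<longlonglongrightarrow> 0 \<and>
           (\<lambda>n. \<integral>\<^sup>+\<omega>. ennreal ((step_integral \<beta> (xs n) \<omega> - X \<omega>)\<^sup>2) \<partial>P) \<longlonglongrightarrow> 0)"


section \<open>Gaussian random variables and the stochastic convolution\<close>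

text \<open>Point masses count as (degenerate) Gaussian laws.\<close>

definition real_gaussian :: "'p measure \<Rightarrow> ('p \<Rightarrow> real) \<Rightarrow> bool" where
  "real_gaussian P X \<longleftrightarrow>
     X \<in> borel_measurable P \<and>
     (\<exists>m. (AE \<omega> in P. X \<omega> = m) \<or> (\<exists>\<sigma>>0. distributed P lborel X (normal_density m \<sigma>)))"

text \<open>
  As usual in a Banach space that need not be separable, a random variable is Borel measurable
  and almost surely takes values in a separable subset (automatic if E is separable).
  The dual of E is the type of bounded linear functions from E to the reals.
\<close>

definition gaussian_rv :: "'p measure \<Rightarrow> ('p \<Rightarrow> 'e::banach) \<Rightarrow> bool" where
  "gaussian_rv P X \<longleftrightarrow>
     X \<in> borel_measurable P \<and>
     (\<exists>C. countable C \<and> (AE \<omega> in P. X \<omega> \<in> closure C)) \<and>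
     (\<forall>x'::'e \<Rightarrow>\<^sub>L real. real_gaussian P (\<lambda>\<omega>. x' (X \<omega>)))"

text \<open>
  In the definitions below, U t h stands for S(t)Q h; the value U 0 is irrelevant.
  X is the stochastic convolution Z(t): its pairing with every x' in the dual is the
  L2(P)-convergent sum over k of the Wiener integrals of s \<mapsto> x' (S(t-s)Q e_k) against \<beta>_k.
  The summands are independent centred Gaussians, so L2-convergence of the series is
  equivalent to its convergence almost surely or in probability.
\<close>

definition is_stochastic_convolution ::
    "'p measure \<Rightarrow> nat set \<Rightarrow> (nat \<Rightarrow> 'h) \<Rightarrow> (nat \<Rightarrow> real \<Rightarrow> 'p \<Rightarrow> real) \<Rightarrow>
     (real \<Rightarrow> 'h::real_inner \<Rightarrow> 'e::banach) \<Rightarrow> real \<Rightarrow> ('p \<Rightarrow> 'e) \<Rightarrow> bool" where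
  "is_stochastic_convolution P K e \<beta> U t X \<longleftrightarrow>
     (\<forall>x'::'e \<Rightarrow>\<^sub>L real. \<exists>I.
        (\<forall>k\<in>K. has_wiener_integral P (\<beta> k) t (\<lambda>s. x' (U (t - s) (e k))) (I k)) \<and>
        (\<lambda>n. \<integral>\<^sup>+\<omega>. ennreal (((\<Sum>k\<in>K \<inter> {..<n}. I k \<omega>) - x' (X \<omega>))\<^sup>2) \<partial>P) \<longlonglongrightarrow> 0)"


section \<open>The controlled paths and the rate functionals\<close>

text \<open>
  The weak (Pettis) integral of f over [0,t] is y. It agrees with the Bochner integral whenever
  the latter exists. The weak form is needed for the integral of S(t-s)Q\<psi>(s): the assumption
  on Z(t) makes its pairings with the dual integrable, but not necessarily its norm.
\<close>

definition has_pettis_integral :: "(real \<Rightarrow> 'e::banach) \<Rightarrow> 'e \<Rightarrow> real \<Rightarrow> bool" where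
  "has_pettis_integral f y t \<longleftrightarrow>
     (\<forall>x'::'e \<Rightarrow>\<^sub>L real. set_integrable lborel {0..t} (\<lambda>s. x' (f s)) \<and>
        x' y = (LINT s:{0..t}|lborel. x' (f s)))"

text \<open>y = S(t)x + integral over [0,t] of S(t-s)Q\<psi>(s) ds\<close>

definition is_mild_solution_at ::
    "(real \<Rightarrow> 'e::banach \<Rightarrow>\<^sub>L 'e) \<Rightarrow> (real \<Rightarrow> 'h::real_inner \<Rightarrow> 'e) \<Rightarrow>
     'e \<Rightarrow> (real \<Rightarrow> 'h) \<Rightarrow> real \<Rightarrow> 'e \<Rightarrow> bool" where
  "is_mild_solution_at S U x \<psi> t y \<longleftrightarrow>
     (\<exists>z. has_pettis_integral (\<lambda>s. U (t - s) (\<psi> s)) z t \<and> y = S t x + z)"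

definition rate ::
    "(real \<Rightarrow> 'e::banach \<Rightarrow>\<^sub>L 'e) \<Rightarrow> (real \<Rightarrow> 'h::real_inner \<Rightarrow> 'e) \<Rightarrow>
     real \<Rightarrow> (real \<Rightarrow> 'e) \<Rightarrow> ennreal" where
  "rate S U T \<phi> =
     (INF \<psi>\<in>{\<psi>. L2_fun T \<psi> \<and> (\<forall>t\<in>{0..T}. is_mild_solution_at S U (\<phi> 0) \<psi> t (\<phi> t))}.
        ennreal (1/2) * L2norm_sq T \<psi>)"

definition rate_past ::
    "(real \<Rightarrow> 'e::banach \<Rightarrow>\<^sub>L 'e) \<Rightarrow> (real \<Rightarrow> 'h::real_inner \<Rightarrow> 'e) \<Rightarrow>
     (real \<Rightarrow> 'e) \<Rightarrow> ennreal" where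
  "rate_past S U \<phi> = (SUP T\<in>{0<..}. rate S U T (\<lambda>t. \<phi> (t - T)))"


section \<open>Uniform convergence on compact sets\<close>

text \<open>
  Continuous functions on D are represented by functions that are undefined outside D,
  so that equality of representatives is equality on D.
\<close>

definition cont_funs :: "real set \<Rightarrow> (real \<Rightarrow> 'e::real_normed_vector) set" where
  "cont_funs D = {\<phi> \<in> extensional D. continuous_on D \<phi>}"

definition open_ucc :: "real set \<Rightarrow> (real \<Rightarrow> 'e::real_normed_vector) set \<Rightarrow> bool" where
  "open_ucc D V \<longleftrightarrow>
     V \<subseteq> cont_funs D \<and>
     (\<forall>\<phi>\<in>V. \<exists>J \<epsilon>. compact J \<and> J \<subseteq> D \<and> 0 < \<epsilon> \<and>
        (\<forall>\<phi>'\<in>cont_funs D. (\<forall>t\<in>J. dist (\<phi>' t) (\<phi> t) < \<epsilon>) \<longrightarrow> \<phi>' \<in> V))"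

definition ucc_topology :: "real set \<Rightarrow> (real \<Rightarrow> 'e::real_normed_vector) topology" where
  "ucc_topology D = topology (open_ucc D)"

lemma istopology_open_ucc: "istopology (open_ucc D)"
  unfolding istopology_def
proof (intro conjI allI impI)
  fix V W :: "(real \<Rightarrow> 'e::real_normed_vector) set"
  assume V: "open_ucc D V" and W: "open_ucc D W"
  show "open_ucc D (V \<inter> W)"
    unfolding open_ucc_def
  proof (intro conjI ballI)
    show "V \<inter> W \<subseteq> cont_funs D"
      using V by (auto simp: open_ucc_def)
  next
    fix \<phi> assume \<phi>: "\<phi> \<in> V \<inter> W"
    obtain J \<epsilon> where J: "compact J" "J \<subseteq> D" "0 < \<epsilon>"
      "\<forall>\<phi>'\<in>cont_funs D. (\<forall>t\<in>J. dist (\<phi>' t) (\<phi> t) < \<epsilon>) \<longrightarrow> \<phi>' \<in> V"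
      using V \<phi> by (auto simp: open_ucc_def)
    obtain J' \<delta> where J': "compact J'" "J' \<subseteq> D" "0 < \<delta>"
      "\<forall>\<phi>'\<in>cont_funs D. (\<forall>t\<in>J'. dist (\<phi>' t) (\<phi> t) < \<delta>) \<longrightarrow> \<phi>' \<in> W"
      using W \<phi> by (auto simp: open_ucc_def)
    show "\<exists>J \<epsilon>. compact J \<and> J \<subseteq> D \<and> 0 < \<epsilon> \<and>
        (\<forall>\<phi>'\<in>cont_funs D. (\<forall>t\<in>J. dist (\<phi>' t) (\<phi> t) < \<epsilon>) \<longrightarrow> \<phi>' \<in> V \<inter> W)"
      using J J' by (intro exI[of _ "J \<union> J'"] exI[of _ "min \<epsilon> \<delta>"]) (simp add: compact_Un)
  qed
next
  fix \<V> :: "(real \<Rightarrow> 'e::real_normed_vector) set set"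
  assume *: "\<forall>V\<in>\<V>. open_ucc D V"
  show "open_ucc D (\<Union>\<V>)"
    unfolding open_ucc_def
  proof (intro conjI ballI)
    show "\<Union>\<V> \<subseteq> cont_funs D"
      using * by (auto simp: open_ucc_def)
  next
    fix \<phi> assume "\<phi> \<in> \<Union>\<V>"
    then obtain V where V: "V \<in> \<V>" "\<phi> \<in> V" by blast
    with * obtain J \<epsilon> where "compact J" "J \<subseteq> D" "0 < \<epsilon>"
      "\<forall>\<phi>'\<in>cont_funs D. (\<forall>t\<in>J. dist (\<phi>' t) (\<phi> t) < \<epsilon>) \<longrightarrow> \<phi>' \<in> V"
      unfolding open_ucc_def by meson
    with V show "\<exists>J \<epsilon>. compact J \<and> J \<subseteq> D \<and> 0 < \<epsilon> \<and>
        (\<forall>\<phi>'\<in>cont_funs D. (\<forall>t\<in>J. dist (\<phi>' t) (\<phi> t) < \<epsilon>) \<longrightarrow> \<phi>' \<in> \<Union>\<V>)"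
      by (meson UnionI)
  qed
qed

lemma openin_ucc_topology: "openin (ucc_topology D) V \<longleftrightarrow> open_ucc D V"
  by (simp add: ucc_topology_def istopology_open_ucc)

lemma topspace_ucc_topology: "topspace (ucc_topology D) = cont_funs D"
proof -
  have "open_ucc D (cont_funs D :: (real \<Rightarrow> 'e::real_normed_vector) set)"
    unfolding open_ucc_def by (auto intro!: exI[of _ "{}"] exI[of _ "1::real"])
  then show ?thesis
    unfolding topspace_def openin_ucc_topology by (auto simp: open_ucc_def)
qed


section \<open>The level sets\<close>

definition level_set ::
    "(real \<Rightarrow> 'e::banach \<Rightarrow>\<^sub>L 'e) \<Rightarrow> (real \<Rightarrow> 'h::real_inner \<Rightarrow> 'e) \<Rightarrow>
     real \<Rightarrow> (real \<Rightarrow> 'e) set" where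
  "level_set S U r =
     {\<phi> \<in> cont_funs {..0}. ((\<lambda>t. norm (\<phi> t)) \<longlongrightarrow> 0) at_bot \<and> rate_past S U \<phi> \<le> ennreal r}"

end

theory Submission
  imports Defs
begin

text \<open>
  Write N(t,x') for the integral over [0,t] of |(S(s)Q)* x'|^2. Up to a constant it is bounded by the
  second moment of \<langle>Z(t), x'\<rangle>. By tightness, Z(t) lies with probability at least 3/4 in a
  compact set C; if |x'| \<le> 1 on C, the Gaussian variable \<langle>Z(t), x'\<rangle> has a second moment
  bounded by a universal constant. The points z with \<langle>z, x'\<rangle>^2 \<le> R N(t,x') for all x', among them
  everything that controls of energy R reach from 0 in time t, therefore lie in a multiple of the
  bipolar of C and form a totally bounded set, which shrinks to 0 as t tends to 0.

  For a path in the level set, \<phi>(t) - S(h) \<phi>(t-h) is such a point. Letting h be large (S(h) is small)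
  gives a common compact set of values, letting h tend to 0 gives equicontinuity; Arzela--Ascoli
  applies. The level set is closed because the rate functional is lower semicontinuous and because a
  bounded path of finite rate must decay at minus infinity.
\<close>

section \<open>Hahn--Banach and polar sets\<close>


text \<open>The link between Z(t) and Q is given only through scalar pairings, and so is the effect
  of a control: the norm of S(t-s)Q\<psi>(s) need not be integrable in s. Reachable points therefore
  admit no direct norm estimate, and total boundedness has to be extracted from inequalities between
  functionals; this is what the geometric form of Hahn--Banach is for. The function |(S(s)Q)* x'|^2
  enters as the series over k of the squares of \<langle>S(s)Q e_k, x'\<rangle>: in this form it is
  measurable in s, it bounds the pairing with every h by Cauchy--Schwarz, and it is what the Wiener
  integrals of the coordinates add up to. N(t,x') tends to 0 with t only for each fixed x';
  compactness of the reachable set at one positive time turns this into smallness in norm. Uniform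
  convergence on compact sets does not see minus infinity, so a limit path cannot inherit decay from
  its approximations; its decay has to come from its energy.\<close>

definition sublinear :: "('a::real_vector \<Rightarrow> real) \<Rightarrow> bool" where
  "sublinear p \<longleftrightarrow> (\<forall>x y. p (x + y) \<le> p x + p y) \<and> (\<forall>c\<ge>0. \<forall>x. p (c *\<^sub>R x) = c * p x)"

text \<open>The scaling bound used with \<open>inverse c\<close> gives its own converse, so later
  proofs check positive homogeneity in one direction only.\<close>

lemma sublinearI:
  assumes add: "\<And>x y. p (x + y) \<le> p x + p y" and zero: "p 0 = 0"
    and scale: "\<And>c x. c > 0 \<Longrightarrow> p (c *\<^sub>R x) \<le> c * p x"
  shows "sublinear p"
  unfolding sublinear_def
proof (intro conjI allI impI)
  fix c :: real and x assume "c \<ge> 0"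
  show "p (c *\<^sub>R x) = c * p x"
  proof (cases "c = 0")
    case False
    with \<open>c \<ge> 0\<close> have c: "c > 0" by simp
    have "p x \<le> inverse c * p (c *\<^sub>R x)"
      using scale[of "inverse c" "c *\<^sub>R x"] c by simp
    then have "c * p x \<le> p (c *\<^sub>R x)"
      using c by (simp add: field_simps)
    with scale[OF c] show ?thesis by (simp add: antisym)
  qed (simp add: zero)
qed (rule add)

lemma sublinear_add: "sublinear p \<Longrightarrow> p (x + y) \<le> p x + p y"
  and sublinear_scale: "sublinear p \<Longrightarrow> c \<ge> 0 \<Longrightarrow> p (c *\<^sub>R x) = c * p x"
  by (auto simp: sublinear_def)

lemma sublinear_zero: "sublinear p \<Longrightarrow> p 0 = 0"
  using sublinear_scale[of p 0 0] by simp

lemma sublinear_minus: "sublinear p \<Longrightarrow> - p (- x) \<le> p x"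
  using sublinear_add[of p x "- x"] sublinear_zero[of p] by simp

text \<open>The infimum over t \<ge> 0 of \<open>q (x + t *\<^sub>R z) - t * q z\<close> has these
  properties; t = 1 gives the value at \<open>- z\<close>. It has two uses: it prescribes the value
  at z of the functional to be built, and it shows that a minimal sublinear functional is
  odd.\<close>

lemma sublinear_lower:
  fixes q :: "'a::real_vector \<Rightarrow> real"
  assumes q: "sublinear q"
  obtains q' where "sublinear q'" "q' \<le> q" "q' (- z) \<le> - q z"
proof
  define d where "d x t = q (x + t *\<^sub>R z) - t * q z" for x t
  define q' where "q' x = (INF t\<in>{0..}. d x t)" for x
  \<comment> \<open>From t q(z) = q(tz) \<le> q(x + tz) + q(-x): a lower bound independent of t, so
    the infimum is finite.\<close>
  have low: "- q (- x) \<le> d x t" if "t \<ge> 0" for x t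
    using sublinear_add[OF q, of "x + t *\<^sub>R z" "- x"] sublinear_scale[OF q that, of z]
    by (simp add: d_def)
  then have bdd: "bdd_below (d x ` {0..})" for x
    by (auto intro!: bdd_belowI2)
  have q'_le: "q' x \<le> d x t" if "t \<ge> 0" for x t
    unfolding q'_def using that by (intro cINF_lower bdd) auto
  have q'_ge: "a \<le> q' x" if "\<And>t. t \<ge> 0 \<Longrightarrow> a \<le> d x t" for a x
    unfolding q'_def using that by (intro cINF_greatest) auto
  show "q' \<le> q"
    using q'_le[of 0] by (auto simp: le_fun_def d_def)
  show "q' (- z) \<le> - q z"
    using q'_le[of 1 "- z"] sublinear_zero[OF q] by (simp add: d_def)
  show "sublinear q'"
  proof (rule sublinearI)
    fix x y
    \<comment> \<open>The parameters add up to s + t at the point x + y; the two infima are then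
      taken one after the other.\<close>
    have *: "q' (x + y) - d x s \<le> d y t" if "s \<ge> 0" "t \<ge> 0" for s t
    proof -
      have "q' (x + y) \<le> d (x + y) (s + t)"
        using that by (intro q'_le) auto
      also have "\<dots> \<le> d x s + d y t"
        using sublinear_add[OF q, of "x + s *\<^sub>R z" "y + t *\<^sub>R z"]
        by (simp add: d_def algebra_simps)
      finally show ?thesis by simp
    qed
    then have "q' (x + y) - d x s \<le> q' y" if "s \<ge> 0" for s
      using that by (intro q'_ge) auto
    then have "q' (x + y) - q' y \<le> q' x"
      by (intro q'_ge) (smt (verit))
    then show "q' (x + y) \<le> q' x + q' y" by simp
  next
    have "d 0 t = 0" if "t \<ge> 0" for t
      using sublinear_scale[OF q that] by (simp add: d_def)
    then show "q' 0 = 0"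
      using q'_le[of 0 0] q'_ge[of 0 0] by simp
  next
    fix c :: real and x assume c: "c > 0"
    have "inverse c * q' (c *\<^sub>R x) \<le> d x t" if t: "t \<ge> 0" for t
    proof -
      have "q' (c *\<^sub>R x) \<le> d (c *\<^sub>R x) (c * t)"
        using c t by (intro q'_le) auto
      also have "\<dots> = c * d x t"
        using sublinear_scale[OF q, of c "x + t *\<^sub>R z"] c by (simp add: d_def algebra_simps)
      finally show ?thesis using c by (simp add: field_simps)
    qed
    then have "inverse c * q' (c *\<^sub>R x) \<le> q' x" by (rule q'_ge)
    then show "q' (c *\<^sub>R x) \<le> c * q' x" using c by (simp add: field_simps)
  qed
qed

text \<open>The pointwise infimum is finite because every member is at least -p(-x) at x.
  Subadditivity is where the chain matters: of two members, one chosen for x and one for y, the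
  smaller serves both.\<close>

lemma sublinear_chain_inf:
  fixes C :: "('a::real_vector \<Rightarrow> real) set"
  assumes "C \<noteq> {}" and sub: "\<And>q. q \<in> C \<Longrightarrow> sublinear q \<and> q \<le> p"
    and chain: "\<And>a b. a \<in> C \<Longrightarrow> b \<in> C \<Longrightarrow> a \<le> b \<or> b \<le> a"
  obtains u where "sublinear u" "u \<le> p" "\<And>q. q \<in> C \<Longrightarrow> u \<le> q"
proof
  define u where "u x = (INF q\<in>C. q x)" for x
  have bdd: "bdd_below ((\<lambda>q. q x) ` C)" for x
  proof (rule bdd_belowI2)
    fix q assume "q \<in> C"
    then have "- q (- x) \<le> q x" "q (- x) \<le> p (- x)"
      using sub sublinear_minus by (auto simp: le_fun_def)
    then show "- p (- x) \<le> q x" by linarith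
  qed
  have u_le: "u x \<le> q x" if "q \<in> C" for x q
    unfolding u_def using that by (intro cINF_lower bdd) auto
  have u_ge: "a \<le> u x" if "\<And>q. q \<in> C \<Longrightarrow> a \<le> q x" for a x
    unfolding u_def using that \<open>C \<noteq> {}\<close> by (intro cINF_greatest) auto
  show "u \<le> q" if "q \<in> C" for q
    using u_le[OF that] by (simp add: le_fun_def)
  with \<open>C \<noteq> {}\<close> sub show "u \<le> p" by (meson equals0I order_trans)
  show "sublinear u"
  proof (rule sublinearI)
    fix x y
    have *: "u (x + y) - a x \<le> b y" if ab: "a \<in> C" "b \<in> C" for a b
    proof -
      obtain m where m: "m \<in> C" "m \<le> a" "m \<le> b"
        using chain[OF ab] ab by (metis order_refl)
      have "u (x + y) \<le> m x + m y"
        using u_le[OF m(1)] sublinear_add sub[OF m(1)] by (meson order_trans)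
      also have "\<dots> \<le> a x + b y"
        using m by (intro add_mono) (auto simp: le_fun_def)
      finally show ?thesis by simp
    qed
    then have "u (x + y) - a x \<le> u y" if "a \<in> C" for a
      using that by (intro u_ge) auto
    then have "u (x + y) - u y \<le> u x"
      by (intro u_ge) (smt (verit))
    then show "u (x + y) \<le> u x + u y" by simp
  next
    obtain q where "q \<in> C" using \<open>C \<noteq> {}\<close> by auto
    have "q 0 = 0" if "q \<in> C" for q
      using sub[OF that] sublinear_zero by blast
    then show "u 0 = 0"
      using u_ge[of 0 0] u_le[OF \<open>q \<in> C\<close>, of 0] \<open>q \<in> C\<close> by fastforce
  next
    fix c :: real and x assume c: "c > 0"
    have "inverse c * u (c *\<^sub>R x) \<le> q x" if "q \<in> C" for q
      using u_le[OF that, of "c *\<^sub>R x"] sublinear_scale[of q c x] sub[OF that] c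
      by (simp add: field_simps)
    then have "inverse c * u (c *\<^sub>R x) \<le> u x" by (rule u_ge)
    then show "u (c *\<^sub>R x) \<le> c * u x" using c by (simp add: field_simps)
  qed
qed

text \<open>
  Hahn--Banach without extending from subspaces: a minimal sublinear functional is linear.
\<close>

theorem sublinear_dominates_linear:
  fixes p :: "'a::real_vector \<Rightarrow> real"
  assumes p: "sublinear p"
  obtains f where "linear f" "\<And>x. f x \<le> p x" "f z = p z"
proof -
  \<comment> \<open>Minimizing below p' instead of p fixes the value at z: every m below p' has
    m(-z) \<le> -p(z), and a minimal m is odd.\<close>
  obtain p' where p': "sublinear p'" "p' \<le> p" "p' (- z) \<le> - p z"
    using sublinear_lower[OF p, of z] .
  define A where "A = {q. sublinear q \<and> q \<le> p'}"
  have "\<exists>m\<in>A. \<forall>a\<in>A. m \<ge> a \<longrightarrow> a = m"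
  proof (rule predicate_Zorn)
    show "partial_order_on A (relation_of (\<ge>) A)"
      by (auto simp: partial_order_on_def preorder_on_def relation_of_def refl_on_def trans_def
          antisym_def)
    fix C assume "C \<in> Chains (relation_of (\<ge>) A)"
    then have C: "C \<subseteq> A" "\<And>a b. a \<in> C \<Longrightarrow> b \<in> C \<Longrightarrow> a \<le> b \<or> b \<le> a"
      by (auto simp: Chains_def relation_of_def)
    show "\<exists>u\<in>A. \<forall>a\<in>C. a \<ge> u"
    proof (cases "C = {}")
      case True
      with p' show ?thesis by (auto simp: A_def)
    next
      case False
      obtain u where "sublinear u" "u \<le> p'" "\<And>q. q \<in> C \<Longrightarrow> u \<le> q"
        by (rule sublinear_chain_inf[of C p']) (use False C in \<open>auto simp: A_def\<close>)
      then show ?thesis by (auto simp: A_def)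
    qed
  qed
  then obtain m where m: "sublinear m" "m \<le> p'"
    and min: "\<And>q. sublinear q \<Longrightarrow> q \<le> m \<Longrightarrow> q = m"
    unfolding A_def by (auto intro: order_trans)
  have minus: "m (- y) = - m y" for y
  proof -
    obtain q where "sublinear q" "q \<le> m" "q (- y) \<le> - m y"
      using sublinear_lower[OF m(1), of y] .
    with min have "m (- y) \<le> - m y" by blast
    with sublinear_minus[OF m(1), of y] show ?thesis by simp
  qed
  have "linear m"
  proof (rule linearI)
    fix x y
    show "m (x + y) = m x + m y"
      using sublinear_add[OF m(1), of x y] sublinear_add[OF m(1), of "x + y" "- y"] minus[of y]
      by simp
  next
    fix c :: real and x
    show "m (c *\<^sub>R x) = c *\<^sub>R m x"
    proof (cases "c \<ge> 0")
      case False
      then have "m (- ((- c) *\<^sub>R x)) = c * m x"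
        using sublinear_scale[OF m(1), of "- c" x] minus by simp
      then show ?thesis by simp
    qed (simp add: sublinear_scale[OF m(1)])
  qed
  moreover have le: "m x \<le> p x" for x
    using m(2) p'(2) by (auto simp: le_fun_def intro: order_trans)
  moreover have "m z = p z"
  proof (rule antisym[OF le])
    have "m (- z) \<le> - p z" using m(2) p'(3) by (auto simp: le_fun_def intro: order_trans)
    then show "p z \<le> m z" by (simp add: minus)
  qed
  ultimately show thesis by (rule that)
qed

text \<open>Hahn--Banach is applied at z to the Minkowski functional p of G. The ball inside G makes
  f continuous, the symmetry of G bounds |f| and not only f. Equality f(z) = 1 can occur, as z may
  lie on the boundary of G.\<close>

theorem separate_point_convex:
  fixes G :: "'e::real_normed_vector set"
  assumes conv: "convex G" and sym: "\<And>g. g \<in> G \<Longrightarrow> - g \<in> G"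
    and \<epsilon>: "\<epsilon> > 0" "ball 0 \<epsilon> \<subseteq> G" and z: "z \<notin> G"
  obtains f :: "'e \<Rightarrow>\<^sub>L real" where "\<And>g. g \<in> G \<Longrightarrow> \<bar>f g\<bar> \<le> 1" "f z \<ge> 1"
proof -
  define T where "T x = {t::real. t > 0 \<and> inverse t *\<^sub>R x \<in> G}" for x
  define p where "p x = Inf (T x)" for x
  have bdd: "bdd_below (T x)" for x by (auto simp: T_def intro!: bdd_belowI[of _ 0])
  have big: "t \<in> T x" if "t > 0" "norm x < t * \<epsilon>" for t x
  proof -
    have "norm (inverse t *\<^sub>R x) < \<epsilon>" using that by (simp add: field_simps)
    then show ?thesis using that \<epsilon> by (auto simp: T_def)
  qed
  have ne: "T x \<noteq> {}" for x
    using big[of "(norm x + 1) / \<epsilon>" x] \<epsilon>(1) by (auto simp: add_nonneg_pos)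
  have p_le: "p x \<le> t" if "t \<in> T x" for t x
    unfolding p_def using that bdd by (rule cInf_lower)
  have p_ge: "a \<le> p x" if "\<And>t. t \<in> T x \<Longrightarrow> a \<le> t" for a x
    unfolding p_def using that ne by (intro cInf_greatest)
  have p_nonneg: "p x \<ge> 0" for x by (rule p_ge) (auto simp: T_def)
  have Tadd: "s + t \<in> T (x + y)" if "s \<in> T x" "t \<in> T y" for s t x y
  proof -
    from that have st: "s > 0" "t > 0" "inverse s *\<^sub>R x \<in> G" "inverse t *\<^sub>R y \<in> G"
      by (auto simp: T_def)
    have "(s / (s + t)) *\<^sub>R (inverse s *\<^sub>R x) + (t / (s + t)) *\<^sub>R (inverse t *\<^sub>R y) \<in> G"
      using st by (intro convexD[OF conv]) (auto simp: add_divide_distrib[symmetric])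
    moreover have "(s / (s + t)) *\<^sub>R (inverse s *\<^sub>R x) + (t / (s + t)) *\<^sub>R (inverse t *\<^sub>R y) =
        inverse (s + t) *\<^sub>R (x + y)"
      using st by (simp add: scaleR_add_right inverse_eq_divide)
    ultimately show ?thesis using st by (simp add: T_def)
  qed
  have sub: "sublinear p"
  proof (rule sublinearI)
    fix x y
    have "p (x + y) - s \<le> p y" if "s \<in> T x" for s
    proof (rule p_ge)
      fix t assume "t \<in> T y"
      from p_le[OF Tadd[OF that this]] show "p (x + y) - s \<le> t" by simp
    qed
    then have "p (x + y) - p y \<le> p x" by (intro p_ge) (smt (verit))
    then show "p (x + y) \<le> p x + p y" by simp
  next
    have "p 0 \<le> t" if "t > 0" for t using that \<epsilon>(1) by (intro p_le big) auto
    then have "p 0 \<le> 0" by (rule field_le_epsilon[of "p 0" 0, simplified])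
    with p_nonneg[of 0] show "p 0 = 0" by simp
  next
    fix c :: real and x assume c: "c > 0"
    have "inverse c * p (c *\<^sub>R x) \<le> t" if "t \<in> T x" for t
    proof -
      have eq: "inverse (c * t) *\<^sub>R c *\<^sub>R x = inverse t *\<^sub>R x" using c by simp
      have "c * t \<in> T (c *\<^sub>R x)" using that c unfolding T_def mem_Collect_eq eq by simp
      from p_le[OF this] c show ?thesis by (simp add: field_simps)
    qed
    then have "inverse c * p (c *\<^sub>R x) \<le> p x" by (rule p_ge)
    then show "p (c *\<^sub>R x) \<le> c * p x" using c by (simp add: field_simps)
  qed
  obtain f where f: "linear f" "\<And>x. f x \<le> p x" "f z = p z"
    using sublinear_dominates_linear[OF sub, of z] by blast
  have pG: "p g \<le> 1" if "g \<in> G" for g using that by (intro p_le) (simp add: T_def)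
  have fG: "\<bar>f g\<bar> \<le> 1" if "g \<in> G" for g
    using f(2)[of g] f(2)[of "- g"] pG[OF that] pG[OF sym[OF that]] linear_neg[OF f(1), of g]
    by linarith
  have "\<bar>f x\<bar> \<le> norm x * (2 / \<epsilon>)" for x
  proof (cases "x = 0")
    case True
    then show ?thesis using linear_0[OF f(1)] by simp
  next
    case False
    \<comment> \<open>The factor 2 puts c x strictly inside the open ball of radius
      \<epsilon>.\<close>
    define c where "c = \<epsilon> / (2 * norm x)"
    have c: "c > 0" using False \<epsilon>(1) by (simp add: c_def)
    have "c *\<^sub>R x \<in> G" using False \<epsilon> by (auto simp: c_def subset_iff)
    then have "\<bar>c * f x\<bar> \<le> 1" using fG linear_scale[OF f(1), of c x] by fastforce
    then have "\<bar>f x\<bar> \<le> 1 / c" using c by (simp add: abs_mult field_simps)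
    then show ?thesis by (simp add: c_def mult.commute)
  qed
  then have bl: "bounded_linear f"
    using f(1) by (intro bounded_linear_intro[where K = "2 / \<epsilon>"]) (auto simp: linear_add linear_scale)
  have "1 \<le> p z"
  proof (rule p_ge, rule ccontr)
    fix t assume t: "t \<in> T z" "\<not> 1 \<le> t"
    then have "t > 0" "inverse t *\<^sub>R z \<in> G" "0 \<in> G" using \<epsilon> by (auto simp: T_def)
    then have "t *\<^sub>R (inverse t *\<^sub>R z) + (1 - t) *\<^sub>R 0 \<in> G"
      using t by (intro convexD[OF conv]) auto
    with \<open>t > 0\<close> z show False by simp
  qed
  then show thesis
    using that[of "Blinfun f"] fG f(3) by (simp add: bounded_linear_Blinfun_apply[OF bl])
qed

text \<open>The norm is itself a sublinear functional. This serves to show that a limit of points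
  reached in vanishing time is 0.\<close>

lemma ex_functional_norm_le_1:
  fixes z :: "'e::real_normed_vector"
  obtains f :: "'e \<Rightarrow>\<^sub>L real" where "norm f \<le> 1" "f z = norm z"
proof -
  obtain f where f: "linear f" "\<And>x. f x \<le> norm x" "f z = norm z"
    using sublinear_dominates_linear[of "norm :: 'e \<Rightarrow> real" z]
    by (auto simp: sublinear_def norm_triangle_ineq)
  have ab: "\<bar>f x\<bar> \<le> norm x" for x
    using f(2)[of x] f(2)[of "- x"] linear_neg[OF f(1), of x] by (auto simp: abs_le_iff)
  then have bl: "bounded_linear f"
    using f(1) by (intro bounded_linear_intro[where K = 1]) (auto simp: linear_add linear_scale)
  show thesis
  proof (rule that)
    show "norm (Blinfun f) \<le> 1"
      using ab by (intro norm_blinfun_bound) (auto simp: bounded_linear_Blinfun_apply[OF bl])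
  qed (simp add: bounded_linear_Blinfun_apply[OF bl] f(3))
qed

text \<open>
  The polar inequality puts B into the bipolar of C, hence close to a multiple of the hull of a
  finite net of C.
\<close>

lemma polar_bound_totally_bounded:
  fixes C B :: "'e::banach set" and \<kappa> \<epsilon> :: real
  assumes C: "compact C" and \<kappa>: "\<kappa> > 0"
    and B: "\<And>z f. z \<in> B \<Longrightarrow> (\<And>c. c \<in> C \<Longrightarrow> \<bar>blinfun_apply f c\<bar> \<le> 1) \<Longrightarrow> \<bar>blinfun_apply f z\<bar> \<le> \<kappa>"
    and \<epsilon>: "\<epsilon> > 0"
  shows "\<exists>F. finite F \<and> B \<subseteq> (\<Union>x\<in>F. ball x \<epsilon>)"
proof -
  \<comment> \<open>The final error is 2 \<kappa> (\<delta> + \<delta>) = \<epsilon>: one \<delta>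
    from enlarging H to G, one from the net of H.\<close>
  define \<delta> where "\<delta> = \<epsilon> / (4 * \<kappa>)"
  have \<delta>: "\<delta> > 0" using \<epsilon> \<kappa> by (simp add: \<delta>_def)
  obtain F where F: "finite F" "C \<subseteq> (\<Union>x\<in>F. ball x \<delta>)"
    using C \<delta> unfolding compact_eq_totally_bounded by blast
  \<comment> \<open>Negatives and 0 are added to the net so that H is symmetric and G contains a
    ball around 0, as the separation theorem requires.\<close>
  define H where "H = convex hull (insert 0 (F \<union> uminus ` F))"
  define G where "G = (\<Union>x\<in>H. \<Union>y\<in>ball 0 \<delta>. {x + y})"
  have H0: "0 \<in> H" by (simp add: H_def hull_inc)
  have Hsym: "- x \<in> H" if "x \<in> H" for x
  proof -
    have "uminus ` H = convex hull (uminus ` insert 0 (F \<union> uminus ` F))"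
      unfolding H_def by (rule convex_hull_linear_image) (simp add: module_hom_uminus linear_uminus)
    also have "uminus ` insert 0 (F \<union> uminus ` F) = insert 0 (F \<union> uminus ` F)"
      by (auto simp: image_Un image_image)
    finally show ?thesis using that by (auto simp: H_def)
  qed
  have "convex G" unfolding G_def by (intro convex_sums) (auto simp: H_def)
  moreover have "- g \<in> G" if g: "g \<in> G" for g
  proof -
    obtain x y where "x \<in> H" "norm y < \<delta>" "g = x + y" using g by (auto simp: G_def)
    then have "- x \<in> H" "norm (- y) < \<delta>" "- g = - x + - y" using Hsym by auto
    then show ?thesis unfolding G_def by (metis UN_iff mem_ball_0 singletonI)
  qed
  moreover have "ball 0 \<delta> \<subseteq> G" using H0 by (force simp: G_def)
  moreover have CG: "C \<subseteq> G"
  proof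
    fix c assume "c \<in> C"
    then obtain x where "x \<in> F" "dist x c < \<delta>" using F by auto
    then have "x \<in> H" "norm (c - x) < \<delta>" "c = x + (c - x)"
      by (auto simp: H_def hull_inc dist_norm norm_minus_commute)
    then show "c \<in> G" unfolding G_def by (metis UN_iff mem_ball_0 singletonI)
  qed
  ultimately have sep: "x \<in> G" if "\<And>f::'e \<Rightarrow>\<^sub>L real. (\<And>g. g \<in> G \<Longrightarrow> \<bar>f g\<bar> \<le> 1) \<Longrightarrow> f x < 1" for x
    using separate_point_convex[of G \<delta> x] \<delta> that by (metis linorder_not_le)
  \<comment> \<open>The factor 2 makes f at most 1/2 at the scaled point, whereas a separating
    functional would be at least 1 there.\<close>
  have BG: "inverse (2 * \<kappa>) *\<^sub>R z \<in> G" if z: "z \<in> B" for z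
  proof (rule sep)
    fix f :: "'e \<Rightarrow>\<^sub>L real" assume "\<And>g. g \<in> G \<Longrightarrow> \<bar>f g\<bar> \<le> 1"
    then have "\<bar>f z\<bar> \<le> \<kappa>" using B[OF z] CG by blast
    then show "f (inverse (2 * \<kappa>) *\<^sub>R z) < 1"
      using \<kappa> by (simp add: blinfun.scaleR_right field_simps)
  qed
  \<comment> \<open>The hull of finitely many points is compact and so has a finite net of its own,
    which the hull of C itself would not give directly.\<close>
  have "compact H" unfolding H_def using F by (intro finite_imp_compact_convex_hull) auto
  then obtain F' where F': "finite F'" "H \<subseteq> (\<Union>x\<in>F'. ball x \<delta>)"
    using \<delta> unfolding compact_eq_totally_bounded by blast
  show ?thesis
  proof (intro exI conjI)
    show "finite ((\<lambda>x. (2 * \<kappa>) *\<^sub>R x) ` F')" using F' by simp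
    show "B \<subseteq> (\<Union>x\<in>(\<lambda>x. (2 * \<kappa>) *\<^sub>R x) ` F'. ball x \<epsilon>)"
    proof
      fix z assume "z \<in> B"
      then obtain x y where xy: "x \<in> H" "norm y < \<delta>" "inverse (2 * \<kappa>) *\<^sub>R z = x + y"
        using BG by (force simp: G_def)
      then obtain x' where x': "x' \<in> F'" "dist x' x < \<delta>" using F' by auto
      have "z = (2 * \<kappa>) *\<^sub>R (inverse (2 * \<kappa>) *\<^sub>R z)" using \<kappa> by simp
      then have "z - (2 * \<kappa>) *\<^sub>R x' = (2 * \<kappa>) *\<^sub>R ((x - x') + y)"
        unfolding xy(3) by (simp add: algebra_simps)
      then have "norm (z - (2 * \<kappa>) *\<^sub>R x') = 2 * \<kappa> * norm ((x - x') + y)" using \<kappa> by simp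
      also have "norm ((x - x') + y) < \<delta> + \<delta>"
        using x' xy norm_triangle_ineq[of "x - x'" y] by (simp add: dist_norm norm_minus_commute)
      finally have "norm (z - (2 * \<kappa>) *\<^sub>R x') < \<epsilon>"
        using \<kappa> by (simp add: \<delta>_def field_simps)
      then show "z \<in> (\<Union>x\<in>(\<lambda>x. (2 * \<kappa>) *\<^sub>R x) ` F'. ball x \<epsilon>)"
        using x' by (auto simp: dist_norm norm_minus_commute)
    qed
  qed
qed

lemma compact_closure_totally_bounded:
  fixes B :: "'e::complete_space set"
  assumes B: "\<And>\<epsilon>. \<epsilon> > 0 \<Longrightarrow> \<exists>F. finite F \<and> B \<subseteq> (\<Union>x\<in>F. ball x \<epsilon>)"
  shows "compact (closure B)"
  unfolding compact_eq_totally_bounded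
proof (intro conjI allI impI)
  fix \<epsilon> :: real assume "\<epsilon> > 0"
  then obtain F where F: "finite F" "B \<subseteq> (\<Union>x\<in>F. ball x (\<epsilon> / 2))" using B[of "\<epsilon> / 2"] by auto
  then have "B \<subseteq> (\<Union>x\<in>F. cball x (\<epsilon> / 2))" by force
  then have "closure B \<subseteq> (\<Union>x\<in>F. cball x (\<epsilon> / 2))"
    using F by (intro closure_minimal closed_UN) auto
  also have "\<dots> \<subseteq> (\<Union>x\<in>F. ball x \<epsilon>)" using \<open>\<epsilon> > 0\<close> by force
  finally show "\<exists>F. finite F \<and> closure B \<subseteq> (\<Union>x\<in>F. ball x \<epsilon>)" using F by blast
qed (simp add: complete_eq_closed)

section \<open>Arzela--Ascoli and the space L2\<close>


text \<open>Arzela--Ascoli by way of Tychonoff: the family is closed in a product of copies of C,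
  hence compact for pointwise convergence, and equicontinuity makes the identity continuous from
  there to uniform convergence on compact sets.\<close>

lemma compactin_ucc_equicontinuous:
  fixes C :: "'e::real_normed_vector set"
  assumes C: "compact C" and \<delta>: "\<And>\<epsilon>. \<epsilon> > 0 \<Longrightarrow> \<delta> \<epsilon> > 0"
  shows "compactin (ucc_topology D)
    {\<phi> \<in> PiE D (\<lambda>_. C). \<forall>\<epsilon>>0. \<forall>s\<in>D. \<forall>t\<in>D. dist s t < \<delta> \<epsilon> \<longrightarrow> dist (\<phi> s) (\<phi> t) \<le> \<epsilon>}"
    (is "compactin _ ?F")
proof -
  define X where "X = product_topology (\<lambda>_::real. euclidean :: 'e topology) D"
  \<comment> \<open>The non-strict bound makes each of these sets closed under pointwise
    convergence.\<close>
  define E where "E \<epsilon> s t = {\<phi> \<in> topspace X. dist (\<phi> s) (\<phi> t) \<in> {..\<epsilon>}}" for \<epsilon> s t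
  have top: "topspace X = extensional D" by (simp add: X_def PiE_def)
  have proj: "continuous_map X euclidean (\<lambda>\<phi>. \<phi> s)" if "s \<in> D" for s
    unfolding X_def using that by (rule continuous_map_product_projection)
  have "closedin X (E \<epsilon> s t)" if "s \<in> D" "t \<in> D" for \<epsilon> s t
    unfolding E_def dist_norm
    by (rule closedin_continuous_map_preimage[where Y = euclideanreal])
       (use that in \<open>auto intro!: continuous_map_norm continuous_map_diff proj\<close>)
  then have "closedin X (\<Inter>(insert (topspace X)
      ((\<lambda>(\<epsilon>, s, t). E \<epsilon> s t) ` {(\<epsilon>, s, t). \<epsilon> > 0 \<and> s \<in> D \<and> t \<in> D \<and> dist s t < \<delta> \<epsilon>})))"
    by (intro closedin_Inter) auto
  from _ this have "compactin X (PiE D (\<lambda>_. C) \<inter> (\<Inter>(insert (topspace X)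
      ((\<lambda>(\<epsilon>, s, t). E \<epsilon> s t) ` {(\<epsilon>, s, t). \<epsilon> > 0 \<and> s \<in> D \<and> t \<in> D \<and> dist s t < \<delta> \<epsilon>}))))"
    by (rule compact_Int_closedin) (use C in \<open>simp add: X_def compactin_PiE\<close>)
  also have "\<dots> = ?F" by (auto simp: E_def top PiE_def)
  finally have "compactin (subtopology X ?F) ?F" by (simp add: compactin_subtopology)
  moreover have "continuous_map (subtopology X ?F) (ucc_topology D) id"
    unfolding continuous_map_def
  proof (intro conjI allI impI)
    have cont: "\<phi> \<in> cont_funs D" if \<phi>: "\<phi> \<in> ?F" for \<phi>
    proof -
      have "continuous_on D \<phi>"
        unfolding continuous_on_iff
      proof (intro ballI allI impI)
        fix x \<epsilon> :: real assume x: "x \<in> D" "\<epsilon> > 0"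
        then have "\<forall>y\<in>D. dist y x < \<delta> (\<epsilon> / 2) \<longrightarrow> dist (\<phi> y) (\<phi> x) < \<epsilon>"
          using \<phi> by (force simp: dist_commute dest!: spec[of _ "\<epsilon> / 2"])
        then show "\<exists>d>0. \<forall>y\<in>D. dist y x < d \<longrightarrow> dist (\<phi> y) (\<phi> x) < \<epsilon>"
          using \<delta>[of "\<epsilon> / 2"] x by auto
      qed
      with \<phi> show ?thesis by (auto simp: cont_funs_def PiE_def)
    qed
    show "id \<in> topspace (subtopology X ?F) \<rightarrow> topspace (ucc_topology D)"
      using cont by (auto simp: topspace_ucc_topology)
    fix V :: "(real \<Rightarrow> 'e) set" assume "openin (ucc_topology D) V"
    then have V: "open_ucc D V" by (simp add: openin_ucc_topology)
    show "openin (subtopology X ?F) {x \<in> topspace (subtopology X ?F). id x \<in> V}"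
    proof (subst openin_subopen, intro ballI)
      fix \<phi> assume "\<phi> \<in> {x \<in> topspace (subtopology X ?F). id x \<in> V}"
      then have \<phi>: "\<phi> \<in> ?F" "\<phi> \<in> V" by auto
      obtain J \<epsilon> where J: "compact J" "J \<subseteq> D" "0 < \<epsilon>"
        "\<forall>\<phi>'\<in>cont_funs D. (\<forall>t\<in>J. dist (\<phi>' t) (\<phi> t) < \<epsilon>) \<longrightarrow> \<phi>' \<in> V"
        using V \<phi> by (auto simp: open_ucc_def)
      \<comment> \<open>A quarter of \<epsilon> for each of the three steps from \<phi>'(t) through
        \<phi>'(s) and \<phi>(s) to \<phi>(t), where s is a point of the finite net G.\<close>
      define d where "d = \<delta> (\<epsilon> / 4)"
      have d: "d > 0" using J \<delta> by (simp add: d_def)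
      obtain G where G: "G \<subseteq> J" "finite G" "J \<subseteq> (\<Union>x\<in>G. ball x d)"
        using compactE_image[OF J(1), of J "\<lambda>x. ball x d"] d by force
      define W where "W = PiE D (\<lambda>i. if i \<in> G then ball (\<phi> i) (\<epsilon> / 4) else UNIV)"
      have "openin X W"
        unfolding X_def W_def
        by (rule openin_PiE_gen[THEN iffD2, OF disjI2])
           (auto intro: finite_subset[OF _ G(2)])
      then have "openin (subtopology X ?F) (W \<inter> ?F)" by (auto simp: openin_subtopology)
      moreover have "\<phi> \<in> W \<inter> ?F" using \<phi> J by (auto simp: W_def PiE_iff)
      moreover have "W \<inter> ?F \<subseteq> {x \<in> topspace (subtopology X ?F). id x \<in> V}"
      proof
        fix \<phi>' assume \<phi>': "\<phi>' \<in> W \<inter> ?F"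
        have "dist (\<phi>' t) (\<phi> t) < \<epsilon>" if tJ: "t \<in> J" for t
        proof -
          obtain s where s: "s \<in> G" "dist s t < d" using subsetD[OF G(3) tJ] by auto
          then have D: "s \<in> D" "t \<in> D" using tJ G J by auto
          have F: "dist (\<psi> s) (\<psi> t) \<le> \<epsilon> / 4" if "\<psi> \<in> ?F" for \<psi>
            using that J(3) D s(2) by (auto simp: d_def dest!: spec[of _ "\<epsilon> / 4"])
          have "dist (\<phi>' s) (\<phi>' t) \<le> \<epsilon> / 4" "dist (\<phi> s) (\<phi> t) \<le> \<epsilon> / 4"
            using F[of \<phi>'] F[of \<phi>] \<phi>' \<phi> by blast+
          moreover have "dist (\<phi> s) (\<phi>' s) < \<epsilon> / 4"
            using \<phi>' D s by (auto simp: W_def PiE_iff split: if_splits)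
          ultimately show ?thesis
            using dist_triangle[of "\<phi>' t" "\<phi> t" "\<phi>' s"] dist_triangle[of "\<phi>' s" "\<phi> t" "\<phi> s"] J(3)
            by (simp add: dist_commute)
        qed
        then have "\<phi>' \<in> V" using J(4) cont \<phi>' by blast
        moreover have "\<phi>' \<in> topspace X" using \<phi>' by (auto simp: top PiE_def)
        ultimately show "\<phi>' \<in> {x \<in> topspace (subtopology X ?F). id x \<in> V}" using \<phi>' by simp
      qed
      ultimately show "\<exists>T. openin (subtopology X ?F) T \<and> \<phi> \<in> T \<and>
          T \<subseteq> {x \<in> topspace (subtopology X ?F). id x \<in> V}" by blast
    qed
  qed
  ultimately show ?thesis
    using image_compactin[of "subtopology X ?F" ?F "ucc_topology D" id] by simp
qed

section \<open>Square-integrable functions on [0,T]: norm inequalities and completeness\<close>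

lemma L2norm_sq_eq:
  "L2norm_sq T f = (\<integral>\<^sup>+s. ennreal ((norm (indicator {0..T} s *\<^sub>R f s))\<^sup>2) \<partial>lborel)"
  unfolding L2norm_sq_def by (intro nn_integral_cong) (auto simp: indicator_def)

lemma L2_fun_iff:
  "L2_fun T f \<longleftrightarrow> (\<lambda>s. indicator {0..T} s *\<^sub>R f s) \<in> borel_measurable lborel \<and> L2norm_sq T f < \<infinity>"
  by (simp add: L2_fun_def set_borel_measurable_def)

lemma L2_measurable[measurable_dest]:
  "L2_fun T f \<Longrightarrow> (\<lambda>s. indicator {0..T} s *\<^sub>R f s) \<in> borel_measurable lborel"
  by (simp add: L2_fun_iff)

text \<open>Expanding the square of \<open>sqrt \<eta> * norm a - norm b / sqrt \<eta>\<close>,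
  which is nonnegative. The value \<eta> = 1 gives crude bounds; small \<eta> keeps the factor of a
  close to 1, as the lower semicontinuity of the rate demands.\<close>

lemma norm_add_sq_le:
  fixes a b :: "'a::real_normed_vector"
  assumes "\<eta> > 0"
  shows "(norm (a + b))\<^sup>2 \<le> (1 + \<eta>) * (norm a)\<^sup>2 + (1 + 1 / \<eta>) * (norm b)\<^sup>2"
proof -
  have "(norm (a + b))\<^sup>2 \<le> (norm a + norm b)\<^sup>2"
    by (intro power_mono norm_triangle_ineq) auto
  moreover have "0 \<le> (sqrt \<eta> * norm a - norm b / sqrt \<eta>)\<^sup>2" by simp
  moreover have "(sqrt \<eta> * norm a - norm b / sqrt \<eta>)\<^sup>2 =
      \<eta> * (norm a)\<^sup>2 + 1 / \<eta> * (norm b)\<^sup>2 - 2 * norm a * norm b"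
    unfolding power2_diff power_mult_distrib power_divide using assms by simp
  moreover have "(norm a + norm b)\<^sup>2 = (norm a)\<^sup>2 + (norm b)\<^sup>2 + 2 * norm a * norm b"
    by (rule power2_sum)
  ultimately show ?thesis unfolding distrib_right by linarith
qed

lemma nn_integral_norm_add_sq_le:
  fixes f g :: "'x \<Rightarrow> 'a::{real_normed_vector, second_countable_topology}"
  assumes [measurable]: "f \<in> borel_measurable M" "g \<in> borel_measurable M" and "\<eta> > 0"
  shows "(\<integral>\<^sup>+s. ennreal ((norm (f s + g s))\<^sup>2) \<partial>M) \<le>
    ennreal (1 + \<eta>) * (\<integral>\<^sup>+s. ennreal ((norm (f s))\<^sup>2) \<partial>M) +
    ennreal (1 + 1 / \<eta>) * (\<integral>\<^sup>+s. ennreal ((norm (g s))\<^sup>2) \<partial>M)"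
proof -
  have "(\<integral>\<^sup>+s. ennreal ((norm (f s + g s))\<^sup>2) \<partial>M) \<le>
    (\<integral>\<^sup>+s. ennreal (1 + \<eta>) * ennreal ((norm (f s))\<^sup>2) +
      ennreal (1 + 1 / \<eta>) * ennreal ((norm (g s))\<^sup>2) \<partial>M)"
    using assms norm_add_sq_le[of \<eta>]
    by (intro nn_integral_mono) (simp flip: ennreal_mult ennreal_plus)
  also have "\<dots> = ennreal (1 + \<eta>) * (\<integral>\<^sup>+s. ennreal ((norm (f s))\<^sup>2) \<partial>M) +
    ennreal (1 + 1 / \<eta>) * (\<integral>\<^sup>+s. ennreal ((norm (g s))\<^sup>2) \<partial>M)"
    by (simp add: nn_integral_add nn_integral_cmult)
  finally show ?thesis .
qed

lemma set_borel_measurable_add: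
  fixes f g :: "real \<Rightarrow> 'a::{real_normed_vector, second_countable_topology}"
  assumes "(\<lambda>s. indicator A s *\<^sub>R f s) \<in> borel_measurable M"
    "(\<lambda>s. indicator A s *\<^sub>R g s) \<in> borel_measurable M"
  shows "(\<lambda>s. indicator A s *\<^sub>R (f s + g s)) \<in> borel_measurable M"
  using borel_measurable_add[OF assms] by (simp add: scaleR_add_right)

lemma L2norm_sq_add_le:
  fixes f g :: "real \<Rightarrow> 'a::{real_normed_vector, second_countable_topology}"
  assumes "L2_fun T f" "L2_fun T g" "\<eta> > 0"
  shows "L2norm_sq T (\<lambda>s. f s + g s) \<le>
    ennreal (1 + \<eta>) * L2norm_sq T f + ennreal (1 + 1 / \<eta>) * L2norm_sq T g"
  using nn_integral_norm_add_sq_le[OF L2_measurable[OF assms(1)] L2_measurable[OF assms(2)] assms(3)]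
  by (simp add: L2norm_sq_eq scaleR_add_right)

lemma L2_fun_add:
  fixes f g :: "real \<Rightarrow> 'a::{real_normed_vector, second_countable_topology}"
  assumes "L2_fun T f" "L2_fun T g"
  shows "L2_fun T (\<lambda>s. f s + g s)"
proof -
  have "L2norm_sq T (\<lambda>s. f s + g s) < \<infinity>"
    using assms
    by (intro le_less_trans[OF L2norm_sq_add_le[OF assms zero_less_one]])
       (auto simp: L2_fun_iff ennreal_mult_less_top)
  then show ?thesis using assms
    by (auto simp: L2_fun_iff intro: set_borel_measurable_add)
qed

lemma L2norm_sq_scaleR: 
  fixes f :: "real \<Rightarrow> 'a::{real_normed_vector, second_countable_topology}"
  assumes "L2_fun T f"
  shows "L2norm_sq T (\<lambda>s. c *\<^sub>R f s) = ennreal (c\<^sup>2) * L2norm_sq T f"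
proof -
  note [measurable] = L2_measurable[OF assms]
  have "L2norm_sq T (\<lambda>s. c *\<^sub>R f s) =
      (\<integral>\<^sup>+s. ennreal (c\<^sup>2) * ennreal ((norm (indicator {0..T} s *\<^sub>R f s))\<^sup>2) \<partial>lborel)"
    unfolding L2norm_sq_eq by (intro nn_integral_cong) (simp add: power_mult_distrib flip: ennreal_mult)
  also have "\<dots> = ennreal (c\<^sup>2) * L2norm_sq T f"
    unfolding L2norm_sq_eq by (intro nn_integral_cmult) measurable
  finally show ?thesis .
qed

lemma L2_fun_scaleR:
  fixes f :: "real \<Rightarrow> 'a::{real_normed_vector, second_countable_topology}"
  assumes "L2_fun T f"
  shows "L2_fun T (\<lambda>s. c *\<^sub>R f s)"
proof -
  have "(\<lambda>s. c *\<^sub>R (indicator {0..T} s *\<^sub>R f s)) \<in> borel_measurable lborel"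
    using L2_measurable[OF assms] by measurable
  then show ?thesis
    using assms by (auto simp: L2_fun_iff L2norm_sq_scaleR ennreal_mult_less_top mult.commute)
qed

lemma L2_fun_diff:
  fixes f g :: "real \<Rightarrow> 'a::{real_normed_vector, second_countable_topology}"
  assumes "L2_fun T f" "L2_fun T g"
  shows "L2_fun T (\<lambda>s. f s - g s)"
  using L2_fun_add[OF assms(1) L2_fun_scaleR[OF assms(2), of "-1"]] by simp

lemma parallelogram_law:
  fixes a b :: "'a::real_inner"
  shows "(norm (a + b))\<^sup>2 + (norm (a - b))\<^sup>2 = 2 * (norm a)\<^sup>2 + 2 * (norm b)\<^sup>2"
  by (simp add: power2_norm_eq_inner inner_simps inner_commute)

text \<open>In terms of the midpoint this shows that two nearly minimal controls in a convex set are
  close to each other.\<close>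

lemma L2norm_sq_parallelogram:
  fixes f g :: "real \<Rightarrow> 'a::{real_inner, second_countable_topology}"
  assumes "L2_fun T f" "L2_fun T g"
  shows "L2norm_sq T (\<lambda>s. (1/2) *\<^sub>R (f s + g s)) + ennreal (1/4) * L2norm_sq T (\<lambda>s. f s - g s) =
    ennreal (1/2) * (L2norm_sq T f + L2norm_sq T g)"
proof -
  define I where "I f s = ennreal ((norm (indicator {0..T} s *\<^sub>R (f s :: 'a)))\<^sup>2)" for f s
  have I[measurable]: "I f \<in> borel_measurable lborel" if "L2_fun T f" for f
    unfolding I_def[abs_def] using L2_measurable[OF that] by measurable
  have L2I: "L2norm_sq T f = (\<integral>\<^sup>+s. I f s \<partial>lborel)" for f
    unfolding I_def by (rule L2norm_sq_eq)
  note [measurable] = I[OF assms(1)] I[OF assms(2)] I[OF L2_fun_add[OF assms]] I[OF L2_fun_diff[OF assms]]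
  have "L2norm_sq T (\<lambda>s. (1/2) *\<^sub>R (f s + g s)) + ennreal (1/4) * L2norm_sq T (\<lambda>s. f s - g s) =
    (\<integral>\<^sup>+s. ennreal (1/4) * I (\<lambda>s. f s + g s) s + ennreal (1/4) * I (\<lambda>s. f s - g s) s \<partial>lborel)"
    using L2norm_sq_scaleR[OF L2_fun_add[OF assms], of "1/2"]
    by (simp add: L2I nn_integral_add nn_integral_cmult power2_eq_square)
  also have "\<dots> = (\<integral>\<^sup>+s. ennreal (1/2) * I f s + ennreal (1/2) * I g s \<partial>lborel)"
  proof (intro nn_integral_cong)
    fix s
    show "ennreal (1/4) * I (\<lambda>s. f s + g s) s + ennreal (1/4) * I (\<lambda>s. f s - g s) s =
        ennreal (1/2) * I f s + ennreal (1/2) * I g s"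
    proof (cases "s \<in> {0..T}")
      case True
      have "1/4 * (norm (f s + g s))\<^sup>2 + 1/4 * (norm (f s - g s))\<^sup>2 =
          1/2 * (norm (f s))\<^sup>2 + 1/2 * (norm (g s))\<^sup>2"
        using parallelogram_law[of "f s" "g s"] by simp
      with True show ?thesis
        unfolding I_def by (simp only: indicator_simps scaleR_one flip: ennreal_mult') (simp flip: ennreal_plus)
    qed (simp add: I_def)
  qed
  also have "\<dots> = ennreal (1/2) * (L2norm_sq T f + L2norm_sq T g)"
    by (simp add: L2I nn_integral_add nn_integral_cmult distrib_left)
  finally show ?thesis .
qed

lemma Cauchy_geometric:
  fixes X :: "nat \<Rightarrow> 'a::metric_space"
  assumes X: "\<And>k. dist (X k) (X (Suc k)) \<le> c / 2 ^ k"
  shows "Cauchy X"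
proof (rule metric_CauchyI)
  fix \<epsilon> :: real assume "\<epsilon> > 0"
  have c: "c \<ge> 0" using order_trans[OF zero_le_dist X[of 0]] by simp
  \<comment> \<open>The geometric tail is kept as a difference so that the induction on p
    telescopes.\<close>
  have *: "dist (X n) (X (n + p)) \<le> 2 * c / 2 ^ n - 2 * c / 2 ^ (n + p)" for n p
  proof (induction p)
    case (Suc p)
    have "dist (X n) (X (n + Suc p)) \<le> dist (X n) (X (n + p)) + dist (X (n + p)) (X (Suc (n + p)))"
      using dist_triangle[of "X n" "X (n + Suc p)" "X (n + p)"] by simp
    also have "\<dots> \<le> (2 * c / 2 ^ n - 2 * c / 2 ^ (n + p)) + c / 2 ^ (n + p)"
      using Suc X by (intro add_mono) auto
    also have "\<dots> = 2 * c / 2 ^ n - 2 * c / 2 ^ (n + Suc p)" by (simp add: field_simps)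
    finally show ?case .
  qed simp
  have "(\<lambda>n. 4 * c * (1/2) ^ n) \<longlonglongrightarrow> 4 * c * 0"
    by (intro tendsto_mult_left LIMSEQ_power_zero) auto
  then have "eventually (\<lambda>n. 4 * c * (1/2) ^ n < \<epsilon>) sequentially"
    using \<open>\<epsilon> > 0\<close> by (intro order_tendstoD) auto
  then obtain N where "4 * c * (1/2) ^ N < \<epsilon>" by (auto simp: eventually_sequentially)
  then have N: "2 * c / 2 ^ N + 2 * c / 2 ^ N < \<epsilon>" by (simp add: power_one_over field_simps)
  have "dist (X N) (X m) \<le> 2 * c / 2 ^ N" if "m \<ge> N" for m
  proof -
    have "2 * c / 2 ^ (N + (m - N)) \<ge> 0" using c by simp
    moreover have "dist (X N) (X m) \<le> 2 * c / 2 ^ N - 2 * c / 2 ^ (N + (m - N))"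
      using *[of N "m - N"] that by (simp only: le_add_diff_inverse)
    ultimately show ?thesis by linarith
  qed
  then have "dist (X m) (X n) < \<epsilon>" if "m \<ge> N" "n \<ge> N" for m n
    using N that dist_triangle3[of "X m" "X n" "X N"] by (meson add_mono le_less_trans)
  then show "\<exists>M. \<forall>m\<ge>M. \<forall>n\<ge>M. dist (X m) (X n) < \<epsilon>" by blast
qed

text \<open>Riesz--Fischer: a rapidly converging subsequence is Cauchy at almost every point, and
  Fatou's lemma carries the L2 bounds over to the pointwise limit.\<close>

lemma L2_complete:
  fixes f :: "nat \<Rightarrow> real \<Rightarrow> 'h::{real_normed_vector, polish_space}"
  assumes f: "\<And>n. L2_fun T (f n)"
    and cauchy: "\<And>\<epsilon>. \<epsilon> > 0 \<Longrightarrow> \<exists>N. \<forall>m\<ge>N. \<forall>n\<ge>N. L2norm_sq T (\<lambda>s. f m s - f n s) < ennreal \<epsilon>"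
  obtains g where "L2_fun T g" "(\<lambda>n. L2norm_sq T (\<lambda>s. f n s - g s)) \<longlonglongrightarrow> 0"
proof -
  define F where "F n s = indicator {0..T} s *\<^sub>R f n s" for n s
  have F[measurable]: "F n \<in> borel_measurable lborel" for n
    using L2_measurable[OF f[of n]] by (simp add: F_def[abs_def])
  have L2F: "L2norm_sq T (\<lambda>s. f m s - f n s) = (\<integral>\<^sup>+s. ennreal ((norm (F m s - F n s))\<^sup>2) \<partial>lborel)" for m n
    by (simp add: L2norm_sq_eq F_def scaleR_diff_right)
  \<comment> \<open>With 8^(-k) the squared differences stay summable after multiplication by 4^k,
    and the weight 4^k yields pointwise distances of order 2^(-k).\<close>
  have "\<forall>k. \<exists>N. \<forall>m\<ge>N. \<forall>n\<ge>N. L2norm_sq T (\<lambda>s. f m s - f n s) < ennreal ((1/8)^k)"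
    by (intro allI cauchy) simp
  from choice[OF this] obtain N where N: "\<And>k m n. m \<ge> N k \<Longrightarrow> n \<ge> N k \<Longrightarrow>
      L2norm_sq T (\<lambda>s. f m s - f n s) < ennreal ((1/8)^k)" by blast
  \<comment> \<open>The sum puts both \<open>r k\<close> and \<open>r (Suc k)\<close> beyond
    \<open>N k\<close>; the summand k makes the subsequence tend to infinity.\<close>
  define r where "r k = (\<Sum>i\<le>k. N i) + k" for k
  have r_N: "N k \<le> r k" for k
    unfolding r_def by (rule trans_le_add1) (rule member_le_sum, auto)
  have r_ge: "k \<le> r k" for k by (simp add: r_def)
  have r_Suc: "N k \<le> r (Suc k)" for k using r_N[of k] by (simp add: r_def)
  define D where "D k s = ennreal ((norm (F (r (Suc k)) s - F (r k) s))\<^sup>2)" for k s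
  have [measurable]: "D k \<in> borel_measurable lborel" for k unfolding D_def by measurable
  have "(\<integral>\<^sup>+s. (\<Sum>k. ennreal (4 ^ k) * D k s) \<partial>lborel) = (\<Sum>k. \<integral>\<^sup>+s. ennreal (4 ^ k) * D k s \<partial>lborel)"
    by (rule nn_integral_suminf) simp
  also have "\<dots> \<le> (\<Sum>k. ennreal ((1/2) ^ k))"
  proof (rule suminf_le)
    fix k
    have "(\<integral>\<^sup>+s. ennreal (4 ^ k) * D k s \<partial>lborel) = ennreal (4 ^ k) * L2norm_sq T (\<lambda>s. f (r (Suc k)) s - f (r k) s)"
      by (simp add: nn_integral_cmult L2F D_def)
    also have "\<dots> \<le> ennreal (4 ^ k) * ennreal ((1/8)^k)"
      using N[of k, OF r_Suc r_N] by (intro mult_left_mono) auto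
    also have "\<dots> = ennreal ((1/2) ^ k)"
    proof -
      have "(4::real) ^ k * (1/8) ^ k = (4 * (1/8)) ^ k" by (rule power_mult_distrib[symmetric])
      then show ?thesis by (simp flip: ennreal_mult)
    qed
    finally show "(\<integral>\<^sup>+s. ennreal (4 ^ k) * D k s \<partial>lborel) \<le> ennreal ((1/2) ^ k)" .
  qed auto
  also have "\<dots> = ennreal (\<Sum>k. (1/2) ^ k)"
    by (rule suminf_ennreal2) (auto intro: summable_geometric)
  also have "\<dots> < \<infinity>" by simp
  finally have "AE s in lborel. (\<Sum>k. ennreal (4 ^ k) * D k s) \<noteq> \<infinity>"
    by (intro nn_integral_PInf_AE) auto
  then have ae: "AE s in lborel. Cauchy (\<lambda>k. F (r k) s)"
  proof eventually_elim
    case (elim s)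
    define c where "c = sqrt (enn2real (\<Sum>k. ennreal (4 ^ k) * D k s))"
    show ?case
    proof (rule Cauchy_geometric)
      fix k
      let ?d = "norm (F (r (Suc k)) s - F (r k) s)"
      have "ennreal (4 ^ k * ?d\<^sup>2) = (\<Sum>i\<in>{k}. ennreal (4 ^ i) * D i s)"
        by (simp add: D_def flip: ennreal_mult)
      also have "\<dots> \<le> (\<Sum>k. ennreal (4 ^ k) * D k s)"
        by (rule sum_le_suminf) simp_all
      also have "\<dots> = ennreal (c\<^sup>2)"
        unfolding c_def using elim
        by (metis enn2real_nonneg ennreal_enn2real_if infinity_ennreal_def real_sqrt_pow2)
      finally have "4 ^ k * ?d\<^sup>2 \<le> c\<^sup>2" by (simp add: ennreal_le_iff)
      moreover have "4 ^ k * ?d\<^sup>2 = (2 ^ k * ?d)\<^sup>2"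
      proof -
        have "(4::real) ^ k = (2 ^ k)\<^sup>2"
          using power_mult_distrib[of "2::real" 2 k] by (simp add: power2_eq_square)
        then show ?thesis by (simp only: power_mult_distrib)
      qed
      ultimately have "2 ^ k * ?d \<le> c" by (intro power2_le_imp_le[of "2 ^ k * ?d" c]) (simp_all add: c_def)
      then show "dist (F (r k) s) (F (r (Suc k)) s) \<le> c / 2 ^ k"
        by (simp add: dist_norm norm_minus_commute pos_le_divide_eq mult.commute)
    qed
  qed
  define G where "G = {s \<in> space lborel. Cauchy (\<lambda>k. F (r k) s)}"
  have [measurable]: "G \<in> sets lborel" unfolding G_def by measurable
  \<comment> \<open>Cutting off outside the set G of convergence makes the limit exist everywhere,
    so g is measurable as a pointwise limit.\<close>
  define g where "g s = lim (\<lambda>k. indicator G s *\<^sub>R F (r k) s)" for s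
  have lim: "(\<lambda>k. indicator G s *\<^sub>R F (r k) s) \<longlonglongrightarrow> g s" for s
  proof -
    have "Cauchy (\<lambda>k. indicator G s *\<^sub>R F (r k) s)"
      by (cases "s \<in> G") (auto simp: G_def intro: LIMSEQ_imp_Cauchy)
    then show ?thesis
      unfolding g_def by (intro convergent_LIMSEQ_iff[THEN iffD1] Cauchy_convergent)
  qed
  have [measurable]: "g \<in> borel_measurable lborel"
    by (rule borel_measurable_LIMSEQ_metric[OF _ lim]) simp
  have g0: "indicator {0..T} s *\<^sub>R g s = g s" for s
    using lim[of s] by (cases "s \<in> {0..T}") (auto simp: F_def LIMSEQ_const_iff)
  have bound: "L2norm_sq T (\<lambda>s. f n s - g s) \<le> ennreal \<epsilon>"
    if "\<And>m. m \<ge> n \<Longrightarrow> L2norm_sq T (\<lambda>s. f n s - f m s) \<le> ennreal \<epsilon>" for n \<epsilon>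
  proof -
    have "L2norm_sq T (\<lambda>s. f n s - g s) = (\<integral>\<^sup>+s. ennreal ((norm (F n s - g s))\<^sup>2) \<partial>lborel)"
      by (simp add: L2norm_sq_eq F_def scaleR_diff_right g0)
    also have "\<dots> = (\<integral>\<^sup>+s. liminf (\<lambda>k. ennreal ((norm (F n s - F (r k) s))\<^sup>2)) \<partial>lborel)"
    proof (rule nn_integral_cong_AE)
      show "AE s in lborel. ennreal ((norm (F n s - g s))\<^sup>2) =
          liminf (\<lambda>k. ennreal ((norm (F n s - F (r k) s))\<^sup>2))"
        using ae
      proof eventually_elim
        case (elim s)
        then have "(\<lambda>k. F (r k) s) \<longlonglongrightarrow> g s" using lim[of s] by (simp add: G_def)
        then have "(\<lambda>k. ennreal ((norm (F n s - F (r k) s))\<^sup>2)) \<longlonglongrightarrow> ennreal ((norm (F n s - g s))\<^sup>2)"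
          by (intro tendsto_intros tendsto_ennrealI)
        from lim_imp_Liminf[OF sequentially_bot this] show ?case by simp
      qed
    qed
    also have "\<dots> \<le> liminf (\<lambda>k. \<integral>\<^sup>+s. ennreal ((norm (F n s - F (r k) s))\<^sup>2) \<partial>lborel)"
      by (rule nn_integral_liminf) simp
    also have "\<dots> \<le> ennreal \<epsilon>"
    proof (rule Liminf_le)
      show "\<forall>\<^sub>F k in sequentially. (\<integral>\<^sup>+s. ennreal ((norm (F n s - F (r k) s))\<^sup>2) \<partial>lborel) \<le> ennreal \<epsilon>"
        using eventually_ge_at_top[of n]
      proof eventually_elim
        case (elim k)
        then show ?case using that[of "r k"] r_ge[of k] by (simp add: L2F)
      qed
    qed simp
    finally show ?thesis .
  qed
  have tend: "(\<lambda>n. L2norm_sq T (\<lambda>s. f n s - g s)) \<longlonglongrightarrow> 0"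
  proof (rule order_tendstoI)
    fix a :: ennreal assume "0 < a"
    then obtain \<epsilon> where \<epsilon>: "\<epsilon> > 0" "ennreal \<epsilon> < a"
    proof (cases a)
      case (real x)
      with \<open>0 < a\<close> show ?thesis by (intro that[of "x / 2"]) (auto simp: ennreal_less_iff)
    next
      case top
      then show ?thesis by (intro that[of 1]) auto
    qed
    obtain N where N: "\<forall>m\<ge>N. \<forall>n\<ge>N. L2norm_sq T (\<lambda>s. f m s - f n s) < ennreal \<epsilon>"
      using cauchy \<epsilon> by blast
    have "L2norm_sq T (\<lambda>s. f n s - g s) < a" if "n \<ge> N" for n
      using that N by (intro le_less_trans[OF bound \<epsilon>(2)]) (meson order_trans less_imp_le)
    then show "\<forall>\<^sub>F n in sequentially. L2norm_sq T (\<lambda>s. f n s - g s) < a"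
      by (auto simp: eventually_sequentially)
  qed simp
  obtain n where n: "L2norm_sq T (\<lambda>s. f n s - g s) < 1"
    using order_tendstoD(2)[OF tend, of 1] by (auto simp: eventually_sequentially)
  then have "L2_fun T (\<lambda>s. f n s - g s)"
  proof -
    have "(\<lambda>s. F n s - g s) \<in> borel_measurable lborel" by measurable
    moreover have "(\<lambda>s. F n s - g s) = (\<lambda>s. indicator {0..T} s *\<^sub>R (f n s - g s))"
      by (simp add: F_def scaleR_diff_right g0)
    ultimately show ?thesis using n by (auto simp: L2_fun_iff intro: less_trans[of _ 1])
  qed
  from L2_fun_diff[OF f[of n] this] have "L2_fun T g" by simp
  then show thesis using tend by (rule that)
qed

section \<open>Reachable sets\<close>


text \<open>\<open>U t\<close> plays the role of S(t)Q. Nothing is assumed about \<open>U 0\<close>,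
  so identities for U(t-s) on [0,t] hold only off the null set {t}.\<close>

locale smoothing_semigroup =
  fixes S :: "real \<Rightarrow> 'e::banach \<Rightarrow>\<^sub>L 'e"
    and U :: "real \<Rightarrow> 'h::{real_inner, polish_space} \<Rightarrow> 'e"
    and M \<omega> :: real
  assumes C0: "C0_semigroup S"
    and M: "M \<ge> 1" and \<omega>: "\<omega> > 0"
    and S_bound: "\<And>t. t \<ge> 0 \<Longrightarrow> norm (S t) \<le> M * exp (- \<omega> * t)"
    and U_bl: "\<And>t. t > 0 \<Longrightarrow> bounded_linear (U t)"
    and S_U: "\<And>s t h. s \<ge> 0 \<Longrightarrow> t > 0 \<Longrightarrow> S s (U t h) = U (s + t) h"
begin

lemma S_0: "S 0 x = x"
  using C0 by (simp add: C0_semigroup_def)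

lemma S_add: "s \<ge> 0 \<Longrightarrow> t \<ge> 0 \<Longrightarrow> S s (S t x) = S (s + t) x"
  using C0 by (simp add: C0_semigroup_def)

lemma S_norm_exp: "t \<ge> 0 \<Longrightarrow> norm (S t x) \<le> M * exp (- \<omega> * t) * norm x"
  using norm_blinfun[of "S t" x] S_bound[of t] by (meson mult_right_mono norm_ge_zero order_trans)

lemma S_norm: "t \<ge> 0 \<Longrightarrow> norm (S t x) \<le> M * norm x"
proof -
  assume t: "t \<ge> 0"
  have "M * exp (- \<omega> * t) * norm x \<le> M * 1 * norm x"
    using M \<omega> t by (intro mult_right_mono mult_left_mono) auto
  with S_norm_exp[OF t, of x] show ?thesis by simp
qed

lemma S_small_time:
  assumes "\<epsilon> > 0"
  obtains \<delta> where "\<delta> > 0" "\<And>h. 0 \<le> h \<Longrightarrow> h < \<delta> \<Longrightarrow> norm (S h x - x) < \<epsilon>"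
proof -
  have "((\<lambda>t. S t x) \<longlongrightarrow> x) (at_right 0)"
    using C0 by (simp add: C0_semigroup_def)
  then have "eventually (\<lambda>t. dist (S t x) x < \<epsilon>) (at_right 0)"
    using assms by (rule tendstoD)
  then obtain \<delta> where \<delta>: "\<delta> > 0" "\<And>h. 0 < h \<Longrightarrow> h < \<delta> \<Longrightarrow> norm (S h x - x) < \<epsilon>"
    unfolding eventually_at_right_field by (auto simp: dist_norm)
  then have "norm (S h x - x) < \<epsilon>" if "0 \<le> h" "h < \<delta>" for h
    using that assms by (cases "h = 0") (auto simp: S_0)
  with \<delta>(1) show thesis by (rule that)
qed

text \<open>Strong continuity at finitely many net points spreads to all of C through the uniform
  bound M on the operators.\<close>

lemma S_small_time_compact:
  assumes C: "compact C" and \<epsilon>: "\<epsilon> > 0"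
  obtains \<delta> where "\<delta> > 0" "\<And>h x. 0 \<le> h \<Longrightarrow> h < \<delta> \<Longrightarrow> x \<in> C \<Longrightarrow> norm (S h x - x) < \<epsilon>"
proof -
  \<comment> \<open>Replacing x by a net point costs \<eta> in x and M \<eta> in S(h)x, together
    \<epsilon> / 2.\<close>
  define \<eta> where "\<eta> = \<epsilon> / (2 * (M + 1))"
  have \<eta>: "\<eta> > 0" "M * \<eta> + \<eta> = \<epsilon> / 2"
  proof -
    show "\<eta> > 0" using \<epsilon> M by (simp add: \<eta>_def)
    have "M * \<eta> + \<eta> = (M + 1) * \<eta>" by (simp add: algebra_simps)
    also have "\<dots> = \<epsilon> / 2" using M by (simp add: \<eta>_def nonzero_eq_divide_eq divide_eq_eq)
    finally show "M * \<eta> + \<eta> = \<epsilon> / 2" .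
  qed
  obtain F where F: "finite F" "C \<subseteq> (\<Union>x\<in>F. ball x \<eta>)"
    using C \<eta> unfolding compact_eq_totally_bounded by blast
  have "\<exists>\<delta>>0. \<forall>h. 0 \<le> h \<and> h < \<delta> \<longrightarrow> norm (S h y - y) < \<epsilon> / 2" for y
    using S_small_time[of "\<epsilon> / 2" y] \<epsilon> by (metis half_gt_zero)
  then obtain d where d: "\<And>y. d y > 0" "\<And>y h. 0 \<le> h \<Longrightarrow> h < d y \<Longrightarrow> norm (S h y - y) < \<epsilon> / 2"
    by metis
  define \<delta> where "\<delta> = Min (insert 1 (d ` F))"
  have "\<delta> > 0" unfolding \<delta>_def using F d by (subst Min_gr_iff) auto
  moreover have "norm (S h x - x) < \<epsilon>" if h: "0 \<le> h" "h < \<delta>" and x: "x \<in> C" for h x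
  proof -
    obtain y where y: "y \<in> F" "norm (x - y) < \<eta>"
      using F x by (auto simp: dist_norm norm_minus_commute)
    have "\<delta> \<le> d y" unfolding \<delta>_def using F y by (intro Min_le) auto
    then have 1: "norm (S h y - y) < \<epsilon> / 2" using h d(2)[of h y] by simp
    have 2: "norm (S h (x - y)) \<le> M * \<eta>"
      using S_norm[OF h(1), of "x - y"] y M by (smt (verit) mult_left_mono)
    have "S h x - x = S h (x - y) + (S h y - y) + (y - x)" by (simp add: blinfun.diff_right)
    then have "norm (S h x - x) \<le> norm (S h (x - y)) + norm (S h y - y) + norm (x - y)"
      by (metis norm_minus_commute norm_triangle_mono norm_triangle_ineq order_refl)
    with 1 2 y \<eta> show ?thesis by linarith
  qed
  ultimately show thesis by (rule that)
qed

text \<open>For a \<le> b the increment is S(a) applied to S(b-a)x - x. Right continuity at 0 and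
  the bound M thus give continuity from both sides.\<close>

lemma S_continuous: "continuous_on {0..} (\<lambda>t. S t x)"
  unfolding continuous_on_iff
proof (intro ballI allI impI)
  fix t \<epsilon> :: real assume t: "t \<in> {0..}" and \<epsilon>: "\<epsilon> > 0"
  have "\<epsilon> / M > 0" using \<epsilon> M by auto
  then obtain \<delta> where \<delta>: "\<delta> > 0" "\<And>h. 0 \<le> h \<Longrightarrow> h < \<delta> \<Longrightarrow> norm (S h x - x) < \<epsilon> / M"
    using S_small_time[of "\<epsilon> / M" x] by blast
  have *: "norm (S b x - S a x) < \<epsilon>" if "0 \<le> a" "a \<le> b" "b - a < \<delta>" for a b
  proof -
    have "S b x - S a x = S a (S (b - a) x - x)"
      using that by (simp add: blinfun.diff_right S_add)
    then have "norm (S b x - S a x) \<le> M * norm (S (b - a) x - x)"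
      using S_norm that by simp
    also have "\<dots> < M * (\<epsilon> / M)" using \<delta>(2)[of "b - a"] that M by (intro mult_strict_left_mono) auto
    finally show ?thesis using M by simp
  qed
  have "dist (S t' x) (S t x) < \<epsilon>" if "t' \<in> {0..}" "dist t' t < \<delta>" for t'
    using *[of t t'] *[of t' t] t that
    by (cases "t \<le> t'") (auto simp: dist_norm norm_minus_commute)
  with \<delta>(1) show "\<exists>d>0. \<forall>x'\<in>{0..}. dist x' t < d \<longrightarrow> dist (S x' x) (S t x) < \<epsilon>" by blast
qed

text \<open>After time t/2 the map is the orbit under S of the point \<open>U (t/2) h\<close> of
  E.\<close>

lemma U_continuous: "continuous_on {0<..} (\<lambda>t. U t h)"
proof (subst continuous_on_eq_continuous_at, simp, intro ballI)
  fix t :: real assume t: "t \<in> {0<..}"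
  have "continuous_on {t/2<..} (\<lambda>u. S (u - t/2) (U (t/2) h))"
    by (intro continuous_on_compose2[OF S_continuous, of _ "\<lambda>u. u - t/2"] continuous_intros) auto
  then have "continuous_on {t/2<..} (\<lambda>u. U u h)"
    by (rule continuous_on_eq) (use t S_U in auto)
  then show "isCont (\<lambda>u. U u h) t"
    using t by (subst (asm) continuous_on_eq_continuous_at) auto
qed

end

text \<open>The weight w x' t stands for the squared norm of the functional x' composed with U t.\<close>

locale controlled_semigroup = smoothing_semigroup S U M \<omega>
  for S :: "real \<Rightarrow> 'e::banach \<Rightarrow>\<^sub>L 'e"
    and U :: "real \<Rightarrow> 'h::{real_inner, polish_space} \<Rightarrow> 'e"
    and M \<omega> :: real +
  fixes w :: "('e \<Rightarrow>\<^sub>L real) \<Rightarrow> real \<Rightarrow> ennreal"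
  assumes w_meas[measurable]: "\<And>x'. w x' \<in> borel_measurable lborel"
    and w_bound: "\<And>t x' h. t > 0 \<Longrightarrow> ennreal ((blinfun_apply x' (U t h))\<^sup>2) \<le> w x' t * ennreal ((norm h)\<^sup>2)"
    and w_fin: "\<And>t x'. t > 0 \<Longrightarrow> (\<integral>\<^sup>+s\<in>{0..t}. w x' s \<partial>lborel) < \<infinity>"
    and w_compact: "\<And>t. t > 0 \<Longrightarrow> \<exists>C \<kappa>. compact C \<and>
      (\<forall>x'. (\<forall>c\<in>C. \<bar>blinfun_apply x' c\<bar> \<le> 1) \<longrightarrow> (\<integral>\<^sup>+s\<in>{0..t}. w x' s \<partial>lborel) \<le> ennreal \<kappa>)"
begin

definition energy :: "real \<Rightarrow> ('e \<Rightarrow>\<^sub>L real) \<Rightarrow> ennreal" where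
  "energy t x' = (\<integral>\<^sup>+s\<in>{0..t}. w x' s \<partial>lborel)"

text \<open>
  By the Cauchy--Schwarz inequality, every point that a control of squared norm at most R
  reaches from 0 within time t lies in this set.
\<close>

definition reach :: "real \<Rightarrow> real \<Rightarrow> 'e set" where
  "reach t R = {z. \<forall>x'::'e \<Rightarrow>\<^sub>L real. ennreal ((blinfun_apply x' z)\<^sup>2) \<le> ennreal R * energy t x'}"

section \<open>Energy of a functional and total boundedness of reachable sets\<close>

lemma energy_mono: "s \<le> t \<Longrightarrow> energy s x' \<le> energy t x'"
  unfolding energy_def by (intro nn_integral_mono) (auto simp: indicator_def)

lemma energy_finite: "energy t x' < \<infinity>"
  using le_less_trans[OF energy_mono[of t "max t 1" x']] w_fin[of "max t 1" x']
  by (simp add: energy_def)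

text \<open>Dominated convergence over intervals that shrink to the null set {0}, so even an
  infinite \<open>w x' 0\<close> does no harm. The limit is taken for one x' at a time.\<close>

lemma energy_tendsto_0: "(\<lambda>n. energy (inverse (real (Suc n))) x') \<longlonglongrightarrow> 0"
proof -
  have "(\<lambda>n. \<integral>\<^sup>+s. w x' s * indicator {0..inverse (real (Suc n))} s \<partial>lborel) \<longlonglongrightarrow>
      (\<integral>\<^sup>+s. w x' s * indicator {0} s \<partial>lborel)"
  proof (rule nn_integral_dominated_convergence[where w = "\<lambda>s. w x' s * indicator {0..1} s"])
    show "(\<integral>\<^sup>+s. w x' s * indicator {0..1} s \<partial>lborel) < \<infinity>" using w_fin[of 1 x'] by simp
    have le1: "inverse (real (Suc n)) \<le> 1" for n by (simp add: field_simps)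
    show "AE s in lborel. w x' s * indicator {0..inverse (real (Suc n))} s \<le> w x' s * indicator {0..1} s" for n
      using le1[of n] by (intro AE_I2 mult_left_mono) (auto simp: indicator_def)
    show "AE s in lborel. (\<lambda>n. w x' s * indicator {0..inverse (real (Suc n))} s) \<longlonglongrightarrow> w x' s * indicator {0} s"
    proof (intro AE_I2)
      fix s :: real
      have "\<forall>\<^sub>F n in sequentially. w x' s * indicator {0} s = w x' s * indicator {0..inverse (real (Suc n))} s"
      proof (cases "s > 0")
        case True
        then have "\<forall>\<^sub>F n in sequentially. inverse (real (Suc n)) < s"
          by (intro order_tendstoD(2)[OF LIMSEQ_inverse_real_of_nat]) auto
        then show ?thesis by eventually_elim (use True in \<open>auto simp: indicator_def\<close>)
      qed (auto simp: indicator_def)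
      then show "(\<lambda>n. w x' s * indicator {0..inverse (real (Suc n))} s) \<longlonglongrightarrow> w x' s * indicator {0} s"
        by (rule tendsto_eventually[OF eventually_mono]) simp
    qed
  qed auto
  also have "(\<integral>\<^sup>+s. w x' s * indicator {0} s \<partial>lborel) = (\<integral>\<^sup>+s. 0 \<partial>(lborel::real measure))"
    by (intro nn_integral_cong_AE) (use AE_lborel_singleton[of "0::real"] in eventually_elim, simp)
  finally show ?thesis by (simp add: energy_def)
qed

lemma reach_mono: "s \<le> t \<Longrightarrow> reach s R \<subseteq> reach t R"
proof
  fix z assume st: "s \<le> t" and z: "z \<in> reach s R"
  have "ennreal ((blinfun_apply x' z)\<^sup>2) \<le> ennreal R * energy t x'" for x' :: "'e \<Rightarrow>\<^sub>L real"
  proof -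
    have "ennreal ((blinfun_apply x' z)\<^sup>2) \<le> ennreal R * energy s x'" using z by (simp add: reach_def)
    also have "\<dots> \<le> ennreal R * energy t x'" by (intro mult_left_mono energy_mono st) simp
    finally show ?thesis .
  qed
  then show "z \<in> reach t R" by (simp add: reach_def)
qed

text \<open>On the polar of the compact set C provided for time t the energy is bounded, hence so
  are the pairings with all points of \<open>reach t R\<close>; this is the polar inequality
  required above.\<close>

lemma reach_totally_bounded:
  assumes "t > 0" "R \<ge> 0" "\<epsilon> > 0"
  shows "\<exists>F. finite F \<and> reach t R \<subseteq> (\<Union>x\<in>F. ball x \<epsilon>)"
proof -
  obtain C \<kappa> where C: "compact C"
    and \<kappa>: "\<And>x'::'e \<Rightarrow>\<^sub>L real. (\<And>c. c \<in> C \<Longrightarrow> \<bar>blinfun_apply x' c\<bar> \<le> 1) \<Longrightarrow> energy t x' \<le> ennreal \<kappa>"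
    using w_compact[OF assms(1)] unfolding energy_def by metis
  \<comment> \<open>\<open>ennreal\<close> sends negative numbers to 0, hence
    \<open>max \<kappa> 0\<close>; adding 1 makes the constant strictly positive.\<close>
  define \<kappa>' where "\<kappa>' = sqrt (R * max \<kappa> 0) + 1"
  have "\<kappa>' > 0" using assms by (auto simp: \<kappa>'_def intro: add_nonneg_pos)
  from C this _ assms(3) show ?thesis
  proof (rule polar_bound_totally_bounded)
    fix z and x' :: "'e \<Rightarrow>\<^sub>L real"
    assume z: "z \<in> reach t R" and "\<And>c. c \<in> C \<Longrightarrow> \<bar>blinfun_apply x' c\<bar> \<le> 1"
    then have "energy t x' \<le> ennreal (max \<kappa> 0)" using \<kappa>[of x'] by (simp add: ennreal_max_0 max.commute)
    then have "ennreal R * energy t x' \<le> ennreal R * ennreal (max \<kappa> 0)"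
      by (intro mult_left_mono) auto
    with z have "ennreal ((blinfun_apply x' z)\<^sup>2) \<le> ennreal R * ennreal (max \<kappa> 0)"
      unfolding reach_def mem_Collect_eq by (meson order_trans)
    also have "\<dots> = ennreal (R * max \<kappa> 0)"
      by (rule ennreal_mult[symmetric]) (use assms in auto)
    finally have "(blinfun_apply x' z)\<^sup>2 \<le> R * max \<kappa> 0"
      using assms by (subst (asm) ennreal_le_iff) auto
    then have "\<bar>blinfun_apply x' z\<bar> \<le> sqrt (R * max \<kappa> 0)" by (metis real_sqrt_abs real_sqrt_le_iff)
    then show "\<bar>blinfun_apply x' z\<bar> \<le> \<kappa>'" by (simp add: \<kappa>'_def)
  qed
qed

lemma reach_bounded:
  assumes "t > 0" "R \<ge> 0"
  obtains c where "c > 0" "\<And>z. z \<in> reach t R \<Longrightarrow> norm z \<le> c"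
proof -
  have "compact (closure (reach t R))"
    using reach_totally_bounded assms by (intro compact_closure_totally_bounded)
  then have "bounded (reach t R)"
    by (rule bounded_subset[OF compact_imp_bounded closure_subset])
  then show thesis using that by (auto simp: bounded_pos)
qed

text \<open>Each functional is small on \<open>reach h R\<close> for small h, but at a speed
  depending on the functional. If norms stayed above \<epsilon>, compactness of the closure of
  \<open>reach 1 R\<close> would yield a limit point of norm at least \<epsilon> on which its own
  norming functional vanishes.\<close>

lemma reach_shrinks:
  assumes R: "R \<ge> 0" and \<epsilon>: "\<epsilon> > 0"
  obtains \<delta> where "\<delta> > 0" "\<And>h z. h < \<delta> \<Longrightarrow> z \<in> reach h R \<Longrightarrow> norm z < \<epsilon>"
proof -
  have "\<exists>n. \<forall>z\<in>reach (inverse (real (Suc n))) R. norm z < \<epsilon>"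
  proof (rule ccontr)
    assume "\<not> ?thesis"
    then obtain z where z: "\<And>n. z n \<in> reach (inverse (real (Suc n))) R" "\<And>n. norm (z n) \<ge> \<epsilon>"
      by (metis linorder_not_le)
    have "compact (closure (reach 1 R))"
      using reach_totally_bounded R by (intro compact_closure_totally_bounded) auto
    moreover have "z n \<in> closure (reach 1 R)" for n
      using z(1)[of n] reach_mono[of "inverse (real (Suc n))" 1 R] closure_subset[of "reach 1 R"]
      by (auto simp: field_simps)
    ultimately obtain l r where l: "strict_mono (r :: nat \<Rightarrow> nat)" "(z \<circ> r) \<longlonglongrightarrow> l"
      unfolding compact_def by blast
    have "(\<lambda>n. norm ((z \<circ> r) n)) \<longlonglongrightarrow> norm l" using l(2) by (rule tendsto_norm)
    then have "\<epsilon> \<le> norm l" by (rule LIMSEQ_le_const) (use z(2) in auto)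
    obtain f :: "'e \<Rightarrow>\<^sub>L real" where f: "f l = norm l" using ex_functional_norm_le_1 by blast
    have "(\<lambda>n. ennreal ((f ((z \<circ> r) n))\<^sup>2)) \<longlonglongrightarrow> ennreal ((f l)\<^sup>2)"
      by (intro tendsto_ennrealI tendsto_intros l(2))
    moreover have "(\<lambda>n. ennreal R * energy (inverse (real (Suc (r n)))) f) \<longlonglongrightarrow> ennreal R * 0"
      using LIMSEQ_subseq_LIMSEQ[OF energy_tendsto_0 l(1), of f]
      by (intro ennreal_tendsto_cmult) (auto simp: comp_def)
    ultimately have "ennreal ((f l)\<^sup>2) \<le> ennreal R * 0"
      by (rule LIMSEQ_le) (use z(1) in \<open>auto simp: reach_def\<close>)
    then show False using \<open>\<epsilon> \<le> norm l\<close> \<epsilon> f by simp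
  qed
  then obtain n where n: "\<And>z. z \<in> reach (inverse (real (Suc n))) R \<Longrightarrow> norm z < \<epsilon>" by blast
  show thesis
  proof (rule that)
    show "inverse (real (Suc n)) > 0" by simp
    show "norm z < \<epsilon>" if "h < inverse (real (Suc n))" "z \<in> reach h R" for h z
      using n reach_mono[of h "inverse (real (Suc n))" R] that by auto
  qed
qed

text \<open>The pairing is continuous in s for fixed h and continuous in h for fixed s < t.
  Pointwise approximation of \<psi> by simple functions reduces the claim to the first of these
  facts by means of the second.\<close>

lemma pairing_measurable:
  fixes x' :: "'e \<Rightarrow>\<^sub>L real"
  assumes [measurable]: "(\<lambda>s. indicator {0..t} s *\<^sub>R \<psi> s) \<in> borel_measurable lborel"
  shows "(\<lambda>s. indicator {0..t} s *\<^sub>R blinfun_apply x' (U (t - s) (\<psi> s))) \<in> borel_measurable lborel"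
proof -
  let ?\<Psi> = "\<lambda>s. indicator {0..t} s *\<^sub>R \<psi> s"
  have x'U: "continuous_on UNIV (\<lambda>h. x' (U s h))" if "s > 0" for s
    using bounded_linear.linear[OF U_bl[OF that]] U_bl[OF that]
    by (intro linear_continuous_on bounded_linear_compose[OF blinfun.bounded_linear_right]) 
  define g where "g s h = indicat_real {0..<t} s * blinfun_apply x' (U (t - s) h)" for s h
  have gm[measurable]: "(\<lambda>s. g s h) \<in> borel_measurable lborel" for h
  proof -
    have "continuous_on {0..<t} (\<lambda>s. x' (U (t - s) h))"
      by (intro continuous_intros continuous_on_compose2[OF U_continuous, of _ "\<lambda>s. t - s"]) auto
    then show ?thesis
      unfolding g_def using borel_measurable_continuous_on_indicator[of "{0..<t}"] by fastforce
  qed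
  obtain F where F: "\<And>i. simple_function lborel (F i)" "\<And>s. (\<lambda>i. F i s) \<longlonglongrightarrow> ?\<Psi> s"
    using borel_measurable_implies_sequence_metric[OF assms, of 0] by auto
  have "(\<lambda>s. g s (?\<Psi> s)) \<in> borel_measurable lborel"
  proof (rule borel_measurable_LIMSEQ_metric)
    fix i
    have fin: "finite (range (F i))" using simple_functionD(1)[OF F(1)[of i]] by simp
    have [measurable]: "F i -` {y} \<in> sets borel" for y
      using simple_functionD(2)[OF F(1)[of i], of "{y}"] by simp
    have "(\<lambda>s. g s (F i s)) = (\<lambda>s. \<Sum>y\<in>range (F i). indicator (F i -` {y}) s * g s y)"
    proof
      fix s
      have "(\<Sum>y\<in>range (F i). indicator (F i -` {y}) s * g s y) =
          (\<Sum>y\<in>range (F i). if y = F i s then g s (F i s) else 0)"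
        by (intro sum.cong) (auto simp: indicator_def)
      then show "g s (F i s) = (\<Sum>y\<in>range (F i). indicator (F i -` {y}) s * g s y)"
        using fin by simp
    qed
    also have "\<dots> \<in> borel_measurable lborel"
      by (intro borel_measurable_sum borel_measurable_times gm borel_measurable_indicator) simp
    finally show "(\<lambda>s. g s (F i s)) \<in> borel_measurable lborel" .
  next
    fix s
    show "(\<lambda>i. g s (F i s)) \<longlonglongrightarrow> g s (?\<Psi> s)"
    proof (cases "s \<in> {0..<t}")
      case True
      then show ?thesis
        unfolding g_def using x'U[of "t - s"]
        by (intro tendsto_intros continuous_on_tendsto_compose[OF x'U F(2)]) auto
    qed (simp add: g_def)
  qed
  \<comment> \<open>The time s = t, where \<open>U 0\<close> is arbitrary, was cut out of g and
    returns as a function carried by one point; the intersection is empty when t < 0.\<close>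
  then have "(\<lambda>s. g s (?\<Psi> s) + indicator ({0..t} \<inter> {t}) s *\<^sub>R blinfun_apply x' (U 0 (\<psi> t))) \<in> borel_measurable lborel"
    by measurable
  also have "(\<lambda>s. g s (?\<Psi> s) + indicator ({0..t} \<inter> {t}) s *\<^sub>R blinfun_apply x' (U 0 (\<psi> t))) =
      (\<lambda>s. indicator {0..t} s *\<^sub>R blinfun_apply x' (U (t - s) (\<psi> s)))"
    by (rule ext) (auto simp: g_def indicator_def)
  finally show ?thesis .
qed

lemma energy_reflect:
  "(\<integral>\<^sup>+s. w x' (t - s) * indicator {0..t} s \<partial>lborel) = energy t x'"
proof -
  have "energy t x' = (\<integral>\<^sup>+s. w x' (t + - 1 * s) * indicator {0..t} (t + - 1 * s) \<partial>lborel)"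
    unfolding energy_def
    using nn_integral_real_affine[of "\<lambda>s. w x' s * indicator {0..t} s" "- 1" t] w_meas[of x'] by simp
  also have "\<dots> = (\<integral>\<^sup>+s. w x' (t - s) * indicator {0..t} s \<partial>lborel)"
    by (intro nn_integral_cong) (auto simp: indicator_def)
  finally show ?thesis ..
qed

text \<open>Cauchy--Schwarz for the integrand written as q times p, where p is the norm of \<psi>
  and the square of q is at most \<open>w x' (t - s)\<close>. Finite energy then makes the scalar
  pairing integrable without any bound on the norm of the E-valued integrand.\<close>

lemma pairing_bound:
  fixes x' :: "'e \<Rightarrow>\<^sub>L real"
  assumes \<psi>: "L2_fun t \<psi>"
  shows "set_integrable lborel {0..t} (\<lambda>s. blinfun_apply x' (U (t - s) (\<psi> s)))" (is ?int)
    and "ennreal ((LINT s:{0..t}|lborel. blinfun_apply x' (U (t - s) (\<psi> s)))\<^sup>2) \<le> L2norm_sq t \<psi> * energy t x'"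
proof -
  let ?f = "\<lambda>s. indicator {0..t} s *\<^sub>R blinfun_apply x' (U (t - s) (\<psi> s))"
  define p where "p s = norm (indicator {0..t} s *\<^sub>R \<psi> s)" for s
  \<comment> \<open>Where \<psi> vanishes, division by 0 gives q = 0, and the integrand is 0 as well
    by linearity of U(t-s). The indicator drops s = t on account of \<open>U 0\<close>.\<close>
  define q where "q s = indicator {0..<t} s * (norm (?f s) / p s)" for s
  note [measurable] = L2_measurable[OF \<psi>] pairing_measurable[OF L2_measurable[OF \<psi>], of x']
  have [measurable]: "p \<in> borel_measurable lborel" unfolding p_def by measurable
  have [measurable]: "q \<in> borel_measurable lborel" unfolding q_def by measurable
  have "(\<integral>\<^sup>+s. ennreal (norm (?f s)) \<partial>lborel) = (\<integral>\<^sup>+s. ennreal (q s) * ennreal (p s) \<partial>lborel)"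
  proof (rule nn_integral_cong_AE)
    show "AE s in lborel. ennreal (norm (?f s)) = ennreal (q s) * ennreal (p s)"
      using AE_lborel_singleton[of t]
    proof eventually_elim
      case (elim s)
      show ?case
      proof (cases "s \<in> {0..<t}")
        case True
        then have "U (t - s) 0 = 0" using U_bl[of "t - s"] by (simp add: linear_simps)
        with True show ?thesis by (auto simp: q_def p_def simp flip: ennreal_mult)
      qed (use elim in \<open>auto simp: p_def\<close>)
    qed
  qed
  then have "(\<integral>\<^sup>+s. ennreal (norm (?f s)) \<partial>lborel)\<^sup>2 \<le>
      (\<integral>\<^sup>+s. (ennreal (q s))\<^sup>2 \<partial>lborel) * (\<integral>\<^sup>+s. (ennreal (p s))\<^sup>2 \<partial>lborel)"
    using Cauchy_Schwarz_nn_integral[of "\<lambda>s. ennreal (q s)" lborel "\<lambda>s. ennreal (p s)"] by simp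
  also have "\<dots> \<le> energy t x' * L2norm_sq t \<psi>"
  proof (rule mult_mono)
    have "(ennreal (q s))\<^sup>2 \<le> w x' (t - s) * indicator {0..t} s" for s
    proof (cases "s \<in> {0..<t} \<and> \<psi> s \<noteq> 0")
      case True
      then have "ennreal ((blinfun_apply x' (U (t - s) (\<psi> s)))\<^sup>2) \<le> w x' (t - s) * ennreal ((norm (\<psi> s))\<^sup>2)"
        by (intro w_bound) auto
      then have "ennreal ((blinfun_apply x' (U (t - s) (\<psi> s)))\<^sup>2) / ennreal ((norm (\<psi> s))\<^sup>2) \<le> w x' (t - s)"
        using True by (subst divide_le_posI_ennreal) (auto simp: mult.commute)
      then show ?thesis using True
        by (auto simp: q_def p_def power_divide divide_ennreal ennreal_power)
    qed (auto simp: q_def p_def)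
    then show "(\<integral>\<^sup>+s. (ennreal (q s))\<^sup>2 \<partial>lborel) \<le> energy t x'"
      unfolding energy_reflect[symmetric] by (intro nn_integral_mono)
    show "(\<integral>\<^sup>+s. (ennreal (p s))\<^sup>2 \<partial>lborel) \<le> L2norm_sq t \<psi>"
      by (simp add: L2norm_sq_eq p_def ennreal_power del: norm_scaleR)
  qed auto
  finally have *: "(\<integral>\<^sup>+s. ennreal (norm (?f s)) \<partial>lborel)\<^sup>2 \<le> L2norm_sq t \<psi> * energy t x'"
    by (simp add: mult.commute)
  also have "\<dots> < \<infinity>" using \<psi> energy_finite by (simp add: L2_fun_iff ennreal_mult_less_top)
  finally have "(\<integral>\<^sup>+s. ennreal (norm (?f s)) \<partial>lborel) < \<infinity>" by (simp add: power_less_top_ennreal)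
  then have int: "integrable lborel ?f"
    by (intro integrableI_bounded pairing_measurable L2_measurable \<psi>)
  then show ?int by (simp add: set_integrable_def)
  have "ennreal ((LINT s:{0..t}|lborel. x' (U (t - s) (\<psi> s)))\<^sup>2) = (ennreal (norm (integral\<^sup>L lborel ?f)))\<^sup>2"
    by (simp add: set_lebesgue_integral_def ennreal_power)
  also have "\<dots> \<le> (\<integral>\<^sup>+s. ennreal (norm (?f s)) \<partial>lborel)\<^sup>2"
    using integral_norm_bound_ennreal[OF int] by (intro power_mono) auto
  finally show "ennreal ((LINT s:{0..t}|lborel. x' (U (t - s) (\<psi> s)))\<^sup>2) \<le> L2norm_sq t \<psi> * energy t x'"
    using * by (rule order_trans)
qed

end

section \<open>Controlled paths\<close>


context controlled_semigroup begin

definition steers :: "real \<Rightarrow> (real \<Rightarrow> 'e) \<Rightarrow> (real \<Rightarrow> 'h) \<Rightarrow> bool" where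
  "steers T \<phi> \<psi> \<longleftrightarrow> L2_fun T \<psi> \<and> (\<forall>t\<in>{0..T}. is_mild_solution_at S U (\<phi> 0) \<psi> t (\<phi> t))"

lemma L2_segment:
  fixes \<psi> :: "real \<Rightarrow> 'h"
  assumes \<psi>: "L2_fun T \<psi>" and ab: "0 \<le> a" "b \<le> T"
  shows "L2norm_sq (b - a) (\<lambda>s. \<psi> (a + s)) = (\<integral>\<^sup>+s\<in>{a..b}. ennreal ((norm (\<psi> s))\<^sup>2) \<partial>lborel)"
    and "L2_fun (b - a) (\<lambda>s. \<psi> (a + s))"
proof -
  define g where "g s = indicator {a..b} s *\<^sub>R (indicator {0..T} s *\<^sub>R \<psi> s)" for s
  have [measurable]: "g \<in> borel_measurable lborel"
    using L2_measurable[OF \<psi>] unfolding g_def by measurable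
  have g: "g s = indicator {a..b} s *\<^sub>R \<psi> s" for s
    using ab by (auto simp: g_def indicator_def)
  have shift: "indicator {0..b - a} s *\<^sub>R \<psi> (a + s) = g (a + s)" for s
    by (auto simp: g indicator_def)
  have "L2norm_sq (b - a) (\<lambda>s. \<psi> (a + s)) = (\<integral>\<^sup>+s. ennreal ((norm (g (a + 1 * s)))\<^sup>2) \<partial>lborel)"
    by (simp add: L2norm_sq_eq shift)
  also have "\<dots> = (\<integral>\<^sup>+s. ennreal ((norm (g s))\<^sup>2) \<partial>lborel)"
    using nn_integral_real_affine[of "\<lambda>s. ennreal ((norm (g s))\<^sup>2)" 1 a] by simp
  also have "\<dots> = (\<integral>\<^sup>+s\<in>{a..b}. ennreal ((norm (\<psi> s))\<^sup>2) \<partial>lborel)"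
    by (intro nn_integral_cong) (auto simp: g indicator_def)
  finally show eq: "L2norm_sq (b - a) (\<lambda>s. \<psi> (a + s)) = (\<integral>\<^sup>+s\<in>{a..b}. ennreal ((norm (\<psi> s))\<^sup>2) \<partial>lborel)" .
  also have "\<dots> \<le> L2norm_sq T \<psi>"
    unfolding L2norm_sq_def using ab by (intro nn_integral_mono) (auto simp: indicator_def)
  also have "\<dots> < \<infinity>" using \<psi> by (simp add: L2_fun_iff)
  finally show "L2_fun (b - a) (\<lambda>s. \<psi> (a + s))"
    by (simp add: L2_fun_iff shift)
qed

text \<open>The flow property: the control before time a acts on \<phi>(a+t) only through
  S(t)\<phi>(a). As the integrals are weak, S(t) is moved inside by testing with
  \<open>x' o\<^sub>L S t\<close>.\<close>

lemma steers_segment: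
  assumes "steers T \<phi> \<psi>" and ab: "0 \<le> a" "b \<le> T"
  shows "steers (b - a) (\<lambda>s. \<phi> (a + s)) (\<lambda>s. \<psi> (a + s))"
  unfolding steers_def
proof (intro conjI ballI)
  have \<psi>: "L2_fun T \<psi>"
    and mild: "\<And>t. t \<in> {0..T} \<Longrightarrow> is_mild_solution_at S U (\<phi> 0) \<psi> t (\<phi> t)"
    using assms(1) by (auto simp: steers_def)
  show "L2_fun (b - a) (\<lambda>s. \<psi> (a + s))" by (rule L2_segment[OF \<psi> ab])
  fix t assume t: "t \<in> {0..b - a}"
  obtain z0 where z0: "has_pettis_integral (\<lambda>s. U (a - s) (\<psi> s)) z0 a" "\<phi> a = S a (\<phi> 0) + z0"
    using mild[of a] t ab by (auto simp: is_mild_solution_at_def)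
  obtain z1 where z1: "has_pettis_integral (\<lambda>s. U (a + t - s) (\<psi> s)) z1 (a + t)"
      "\<phi> (a + t) = S (a + t) (\<phi> 0) + z1"
    using mild[of "a + t"] t ab by (auto simp: is_mild_solution_at_def)
  \<comment> \<open>The part due to [a, a+t] is the whole integral minus S(t) applied to the
    integral over [0,a].\<close>
  have "has_pettis_integral (\<lambda>s. U (t - s) (\<psi> (a + s))) (z1 - S t z0) t"
    unfolding has_pettis_integral_def
  proof (intro allI conjI)
    fix x' :: "'e \<Rightarrow>\<^sub>L real"
    let ?f = "\<lambda>s. blinfun_apply x' (U (a + t - s) (\<psi> s))"
    let ?g = "\<lambda>s. blinfun_apply x' (S t (U (a - s) (\<psi> s)))"
    have "L2_fun ((a + t) - a) (\<lambda>s. \<psi> (a + s))"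
      using t ab by (intro L2_segment(2)[OF \<psi>]) auto
    then show "set_integrable lborel {0..t} (\<lambda>s. blinfun_apply x' (U (t - s) (\<psi> (a + s))))"
      by (intro pairing_bound(1)) simp
    have f: "set_integrable lborel {0..a + t} ?f" "x' z1 = (LINT s:{0..a + t}|lborel. ?f s)"
      using z1(1) by (auto simp: has_pettis_integral_def)
    have g: "set_integrable lborel {0..a} ?g" "x' (S t z0) = (LINT s:{0..a}|lborel. ?g s)"
      using z0(1)[unfolded has_pettis_integral_def, rule_format, of "x' o\<^sub>L S t"] by auto
    have fsub: "set_integrable lborel {0..<a} ?f" "set_integrable lborel {a..a + t} ?f"
      using f(1) t ab by (auto elim!: set_integrable_subset)
    \<comment> \<open>The end point a is dropped because S(t)U(0) need not equal U(t).\<close>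
    have "(LINT s:{0..a}|lborel. ?g s) = (LINT s:{0..<a}|lborel. ?f s)"
      unfolding set_lebesgue_integral_def
    proof (rule integral_cong_AE)
      show "AE s in lborel. indicat_real {0..a} s *\<^sub>R ?g s = indicat_real {0..<a} s *\<^sub>R ?f s"
        using AE_lborel_singleton[of a]
        by eventually_elim (use t in \<open>auto simp: indicator_def S_U algebra_simps\<close>)
    qed (use g(1) fsub(1) in \<open>auto simp: set_integrable_def\<close>)
    moreover have "(LINT s:{0..a + t}|lborel. ?f s) =
        (LINT s:{0..<a}|lborel. ?f s) + (LINT s:{a..a + t}|lborel. ?f s)"
    proof -
      have "{0..a + t} = {0..<a} \<union> {a..a + t}" using t ab by auto
      moreover have "{0..<a} \<inter> {a..a + t} = {}" by auto
      ultimately show ?thesis using set_integral_Un[OF _ fsub] by simp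
    qed
    moreover have "(LINT s:{a..a + t}|lborel. ?f s) =
        (LINT s:{0..t}|lborel. x' (U (t - s) (\<psi> (a + s))))"
    proof -
      have "(LINT s:{a..a + t}|lborel. ?f s) = (LINT s|lborel. indicator {a..a + t} (a + 1 * s) *\<^sub>R ?f (a + 1 * s))"
        unfolding set_lebesgue_integral_def
        by (subst lborel_integral_real_affine[where c = 1 and t = a]) auto
      also have "\<dots> = (LINT s:{0..t}|lborel. x' (U (t - s) (\<psi> (a + s))))"
        unfolding set_lebesgue_integral_def
        by (intro Bochner_Integration.integral_cong) (auto simp: indicator_def)
      finally show ?thesis .
    qed
    ultimately show "x' (z1 - S t z0) = (LINT s:{0..t}|lborel. x' (U (t - s) (\<psi> (a + s))))"
      by (simp add: blinfun.diff_right f(2) g(2))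
  qed
  moreover have "\<phi> (a + t) = S t (\<phi> (a + 0)) + (z1 - S t z0)"
    using z0(2) z1(2) t ab by (simp add: blinfun.add_right S_add add.commute)
  ultimately show "is_mild_solution_at S U (\<phi> (a + 0)) (\<lambda>s. \<psi> (a + s)) t (\<phi> (a + t))"
    unfolding is_mild_solution_at_def by blast
qed

lemma steers_reach:
  assumes "steers t \<phi> \<psi>" "t \<ge> 0" "L2norm_sq t \<psi> \<le> ennreal R"
  shows "\<phi> t - S t (\<phi> 0) \<in> reach t R"
proof -
  obtain z where z: "has_pettis_integral (\<lambda>s. U (t - s) (\<psi> s)) z t" "\<phi> t = S t (\<phi> 0) + z"
    using assms(1,2) by (fastforce simp: steers_def is_mild_solution_at_def)
  have "ennreal ((blinfun_apply x' z)\<^sup>2) \<le> ennreal R * energy t x'" for x' :: "'e \<Rightarrow>\<^sub>L real"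
  proof -
    have "x' z = (LINT s:{0..t}|lborel. x' (U (t - s) (\<psi> s)))"
      using z(1) by (simp add: has_pettis_integral_def)
    then have "ennreal ((blinfun_apply x' z)\<^sup>2) \<le> L2norm_sq t \<psi> * energy t x'"
      using pairing_bound(2)[of t \<psi> x'] assms(1) by (simp add: steers_def)
    also have "\<dots> \<le> ennreal R * energy t x'" by (intro mult_right_mono assms) simp
    finally show ?thesis .
  qed
  then show ?thesis by (simp add: reach_def z(2))
qed

text \<open>The slack \<epsilon> makes up for an infimum not yet known to be attained; the factor 2
  undoes the 1/2 in the rate.\<close>

lemma rate_le_steers:
  assumes "rate S U T \<phi> \<le> ennreal r" "r \<ge> 0" "\<epsilon> > 0"
  obtains \<psi> where "steers T \<phi> \<psi>" "L2norm_sq T \<psi> \<le> ennreal (2 * r + \<epsilon>)"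
proof -
  have "rate S U T \<phi> < ennreal (r + \<epsilon> / 2)"
    using assms by (intro le_less_trans[OF assms(1)]) (simp add: ennreal_less_iff)
  then obtain \<psi> where \<psi>: "steers T \<phi> \<psi>" "ennreal (1/2) * L2norm_sq T \<psi> < ennreal (r + \<epsilon> / 2)"
    unfolding rate_def INF_less_iff steers_def by auto
  have "L2norm_sq T \<psi> < \<infinity>" using \<psi>(1) by (simp add: steers_def L2_fun_iff)
  then obtain x where x: "L2norm_sq T \<psi> = ennreal x" "x \<ge> 0"
    by (cases "L2norm_sq T \<psi>") auto
  then have "ennreal (1/2 * x) < ennreal (r + \<epsilon> / 2)"
    using \<psi>(2) by (subst ennreal_mult) auto
  then have "x \<le> 2 * r + \<epsilon>" using x by (simp add: ennreal_less_iff)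
  then have "L2norm_sq T \<psi> \<le> ennreal (2 * r + \<epsilon>)" using x by (simp add: ennreal_leI)
  with \<psi>(1) show thesis by (rule that)
qed

lemma rate_past_le_steers:
  assumes "rate_past S U \<phi> \<le> ennreal r" "r \<ge> 0" "\<epsilon> > 0" "T > 0"
  obtains \<psi> where "steers T (\<lambda>s. \<phi> (s - T)) \<psi>" "L2norm_sq T \<psi> \<le> ennreal (2 * r + \<epsilon>)"
proof -
  have "rate S U T (\<lambda>s. \<phi> (s - T)) \<le> rate_past S U \<phi>"
    unfolding rate_past_def using assms(4) by (intro SUP_upper) auto
  also note assms(1)
  finally show thesis using rate_le_steers[OF _ assms(2,3)] that by blast
qed

text \<open>The horizon \<tau> - t places t - \<tau> at control time 0 and t at control time \<tau>,
  so an initial segment of one control does the step. The 1 in 2 r + 1 is the slack for a nearly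
  optimal control.\<close>

lemma rate_past_step:
  assumes \<phi>: "rate_past S U \<phi> \<le> ennreal r" "r \<ge> 0" and t: "t \<le> 0" "\<tau> > 0"
  shows "\<phi> t - S \<tau> (\<phi> (t - \<tau>)) \<in> reach \<tau> (2 * r + 1)"
proof -
  obtain \<psi> where \<psi>: "steers (\<tau> - t) (\<lambda>s. \<phi> (s - (\<tau> - t))) \<psi>"
      "L2norm_sq (\<tau> - t) \<psi> \<le> ennreal (2 * r + 1)"
    using rate_past_le_steers[OF \<phi>, of 1 "\<tau> - t"] t by auto
  have "L2norm_sq \<tau> \<psi> \<le> L2norm_sq (\<tau> - t) \<psi>"
    unfolding L2norm_sq_def using t by (intro nn_integral_mono) (auto simp: indicator_def)
  then have "L2norm_sq \<tau> \<psi> \<le> ennreal (2 * r + 1)" using \<psi>(2) by (rule order_trans)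
  moreover have "steers \<tau> (\<lambda>s. \<phi> (s - (\<tau> - t))) \<psi>"
    using steers_segment[OF \<psi>(1), of 0 \<tau>] t by simp
  ultimately show ?thesis
    using steers_reach[of \<tau> "\<lambda>s. \<phi> (s - (\<tau> - t))" \<psi>] t by simp
qed

section \<open>Uniform estimates for the paths of the level set\<close>

lemma ex_contraction_time:
  assumes "\<epsilon> > 0"
  obtains \<tau> where "\<tau> > 0" "\<And>x. norm (S \<tau> x) \<le> \<epsilon> * norm x"
proof -
  \<comment> \<open>The second entry solves M exp(-\<omega> \<tau>) = \<epsilon>; the maximum with 1
    keeps \<tau> positive even if M \<le> \<epsilon>.\<close>
  define \<tau> where "\<tau> = max 1 (ln (M / \<epsilon>) / \<omega>)"
  have \<tau>: "\<tau> > 0" by (simp add: \<tau>_def)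
  have "ln (M / \<epsilon>) \<le> \<omega> * \<tau>" using \<omega> by (simp add: \<tau>_def max_def field_simps)
  then have "exp (ln (M / \<epsilon>)) \<le> exp (\<omega> * \<tau>)" by simp
  then have "M / \<epsilon> \<le> exp (\<omega> * \<tau>)" using M assms by (simp add: exp_ln)
  then have "M * exp (- \<omega> * \<tau>) \<le> \<epsilon>" using assms by (simp add: exp_minus field_simps)
  then have "norm (S \<tau> x) \<le> \<epsilon> * norm x" for x
    using S_norm_exp[of \<tau> x] \<tau> by (meson less_imp_le mult_right_mono norm_ge_zero order_trans)
  with \<tau> show thesis by (rule that)
qed

text \<open>The supremum s of the norm along a path satisfies s \<le> c + s/2, hence s \<le> 2 c
  with c independent of the path. Decay at minus infinity guarantees beforehand that s is
  finite.\<close>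

lemma level_set_bounded:
  assumes r: "r \<ge> 0"
  obtains B where "B > 0" "\<And>\<phi> t. \<phi> \<in> level_set S U r \<Longrightarrow> t \<le> 0 \<Longrightarrow> norm (\<phi> t) \<le> B"
proof -
  obtain \<tau> where \<tau>: "\<tau> > 0" "\<And>x. norm (S \<tau> x) \<le> 1/2 * norm x"
    using ex_contraction_time[of "1/2"] by auto
  obtain c where c: "c > 0" "\<And>z. z \<in> reach \<tau> (2 * r + 1) \<Longrightarrow> norm z \<le> c"
    using reach_bounded[of \<tau> "2 * r + 1"] \<tau> r by auto
  have "norm (\<phi> t) \<le> 2 * c" if \<phi>: "\<phi> \<in> level_set S U r" and t: "t \<le> 0" for \<phi> t
  proof -
    have cont: "continuous_on {..0} \<phi>" and lim: "((\<lambda>t. norm (\<phi> t)) \<longlongrightarrow> 0) at_bot"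
      and rate: "rate_past S U \<phi> \<le> ennreal r"
      using \<phi> by (auto simp: level_set_def cont_funs_def)
    have "eventually (\<lambda>t. norm (\<phi> t) < 1) at_bot" using lim by (rule order_tendstoD) simp
    then obtain a where a: "\<And>t. t \<le> a \<Longrightarrow> norm (\<phi> t) < 1" by (auto simp: eventually_at_bot_linorder)
    have "bounded (\<phi> ` {a..0})"
      by (intro compact_imp_bounded compact_continuous_image continuous_on_subset[OF cont]) auto
    then obtain b where b: "\<forall>t\<in>{a..0}. norm (\<phi> t) \<le> b" by (auto simp: bounded_iff)
    define s where "s = (SUP t\<in>{..0}. norm (\<phi> t))"
    have "bdd_above ((\<lambda>t. norm (\<phi> t)) ` {..0})"
    proof (rule bdd_aboveI2)
      fix t :: real assume "t \<in> {..0}"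
      then show "norm (\<phi> t) \<le> max 1 b"
        using a[of t] b by (cases "t \<le> a") (auto simp: le_max_iff_disj intro: less_imp_le)
    qed
    then have s: "norm (\<phi> t) \<le> s" if "t \<le> 0" for t
      unfolding s_def using that by (intro cSUP_upper) auto
    have "norm (\<phi> t) \<le> c + s / 2" if "t \<le> 0" for t
    proof -
      have "\<phi> t - S \<tau> (\<phi> (t - \<tau>)) \<in> reach \<tau> (2 * r + 1)"
        using rate_past_step[OF rate r that \<tau>(1)] .
      then have "norm (\<phi> t - S \<tau> (\<phi> (t - \<tau>))) \<le> c" by (rule c)
      moreover have "norm (S \<tau> (\<phi> (t - \<tau>))) \<le> s / 2"
        using \<tau>(2)[of "\<phi> (t - \<tau>)"] s[of "t - \<tau>"] that \<tau>(1) by simp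
      ultimately show ?thesis using norm_triangle_sub[of "\<phi> t" "S \<tau> (\<phi> (t - \<tau>))"] by linarith
    qed
    then have "s \<le> c + s / 2" unfolding s_def by (intro cSUP_least) (auto simp: s_def)
    with s[OF t] show ?thesis by simp
  qed
  with c(1) show thesis by (intro that[of "2 * c"]) auto
qed

lemma level_set_values_compact:
  assumes r: "r \<ge> 0"
  obtains C where "compact C" "\<And>\<phi> t. \<phi> \<in> level_set S U r \<Longrightarrow> t \<le> 0 \<Longrightarrow> \<phi> t \<in> C"
proof -
  obtain B where B: "B > 0" "\<And>\<phi> t. \<phi> \<in> level_set S U r \<Longrightarrow> t \<le> 0 \<Longrightarrow> norm (\<phi> t) \<le> B"
    using level_set_bounded[OF r] by blast
  define V where "V = {\<phi> t | \<phi> t. \<phi> \<in> level_set S U r \<and> t \<le> 0}"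
  have "compact (closure V)"
  proof (rule compact_closure_totally_bounded)
    fix \<epsilon> :: real assume \<epsilon>: "\<epsilon> > 0"
    \<comment> \<open>This time depends only on \<epsilon> and the common bound B, so a net of one
      reachable set serves all paths and all times.\<close>
    obtain \<tau> where \<tau>: "\<tau> > 0" "\<And>x. norm (S \<tau> x) \<le> \<epsilon> / (2 * B) * norm x"
      using ex_contraction_time[of "\<epsilon> / (2 * B)"] \<epsilon> B by auto
    obtain F where F: "finite F" "reach \<tau> (2 * r + 1) \<subseteq> (\<Union>x\<in>F. ball x (\<epsilon> / 2))"
      using reach_totally_bounded[of \<tau> "2 * r + 1" "\<epsilon> / 2"] \<tau> r \<epsilon> by auto
    have "V \<subseteq> (\<Union>x\<in>F. ball x \<epsilon>)"
    proof
      fix v assume "v \<in> V"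
      then obtain \<phi> t where v: "v = \<phi> t" "\<phi> \<in> level_set S U r" "t \<le> 0" by (auto simp: V_def)
      then have "\<phi> t - S \<tau> (\<phi> (t - \<tau>)) \<in> reach \<tau> (2 * r + 1)"
        using rate_past_step[OF _ r v(3) \<tau>(1)] by (simp add: level_set_def)
      then obtain x where x: "x \<in> F" "norm (x - (\<phi> t - S \<tau> (\<phi> (t - \<tau>)))) < \<epsilon> / 2"
        using F by (auto simp: dist_norm)
      have "norm (S \<tau> (\<phi> (t - \<tau>))) \<le> \<epsilon> / (2 * B) * B"
        using \<tau>(2)[of "\<phi> (t - \<tau>)"] B(2)[OF v(2), of "t - \<tau>"] B(1) v(3) \<tau>(1) \<epsilon>
        by (meson diff_le_0_iff_le divide_nonneg_nonneg less_imp_le mult_left_mono order_trans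
            mult_nonneg_nonneg zero_le_numeral)
      then have "norm (S \<tau> (\<phi> (t - \<tau>))) \<le> \<epsilon> / 2" using B(1) by simp
      then have "norm (x - v) < \<epsilon>"
        using x(2) norm_triangle_ineq4[of "x - (\<phi> t - S \<tau> (\<phi> (t - \<tau>)))" "S \<tau> (\<phi> (t - \<tau>))"]
        by (simp add: v(1))
      with x(1) show "v \<in> (\<Union>x\<in>F. ball x \<epsilon>)" by (auto simp: dist_norm)
    qed
    with F(1) show "\<exists>F. finite F \<and> V \<subseteq> (\<Union>x\<in>F. ball x \<epsilon>)" by blast
  qed
  moreover have "\<phi> t \<in> closure V" if "\<phi> \<in> level_set S U r" "t \<le> 0" for \<phi> t
    using that closure_subset[of V] by (auto simp: V_def)
  ultimately show thesis by (rule that)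
qed

text \<open>The increment splits into \<phi>(t) - S(t-s)\<phi>(s), reached in a short time, and
  S(t-s)\<phi>(s) - \<phi>(s). The second is controlled uniformly only on compact sets, so the
  compact set of values has to be available already.\<close>

lemma level_set_equicontinuous:
  assumes r: "r \<ge> 0" and \<epsilon>: "\<epsilon> > 0"
  obtains \<delta> where "\<delta> > 0" "\<And>\<phi> s t. \<phi> \<in> level_set S U r \<Longrightarrow> s \<le> 0 \<Longrightarrow> t \<le> 0 \<Longrightarrow>
    dist s t < \<delta> \<Longrightarrow> dist (\<phi> s) (\<phi> t) \<le> \<epsilon>"
proof -
  obtain C where C: "compact C" "\<And>\<phi> t. \<phi> \<in> level_set S U r \<Longrightarrow> t \<le> 0 \<Longrightarrow> \<phi> t \<in> C"
    using level_set_values_compact[OF r] by blast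
  obtain \<delta>1 where \<delta>1: "\<delta>1 > 0" "\<And>h x. 0 \<le> h \<Longrightarrow> h < \<delta>1 \<Longrightarrow> x \<in> C \<Longrightarrow> norm (S h x - x) < \<epsilon> / 2"
    using S_small_time_compact[OF C(1), of "\<epsilon> / 2"] \<epsilon> by auto
  obtain \<delta>2 where \<delta>2: "\<delta>2 > 0" "\<And>h z. h < \<delta>2 \<Longrightarrow> z \<in> reach h (2 * r + 1) \<Longrightarrow> norm z < \<epsilon> / 2"
    using reach_shrinks[of "2 * r + 1" "\<epsilon> / 2"] r \<epsilon> by auto
  have *: "dist (\<phi> s) (\<phi> t) \<le> \<epsilon>"
    if \<phi>: "\<phi> \<in> level_set S U r" and st: "s < t" "t \<le> 0" "t - s < min \<delta>1 \<delta>2" for \<phi> s t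
  proof -
    have "\<phi> t - S (t - s) (\<phi> (t - (t - s))) \<in> reach (t - s) (2 * r + 1)"
      using \<phi> st by (intro rate_past_step r) (auto simp: level_set_def)
    then have "norm (\<phi> t - S (t - s) (\<phi> s)) < \<epsilon> / 2" using \<delta>2(2)[of "t - s"] st by simp
    moreover have "norm (S (t - s) (\<phi> s) - \<phi> s) < \<epsilon> / 2"
      using st by (intro \<delta>1(2) C(2)[OF \<phi>]) auto
    ultimately show ?thesis
      using norm_triangle_ineq[of "\<phi> t - S (t - s) (\<phi> s)" "S (t - s) (\<phi> s) - \<phi> s"]
      by (simp add: dist_norm norm_minus_commute)
  qed
  show thesis
  proof (rule that)
    show "min \<delta>1 \<delta>2 > 0" using \<delta>1 \<delta>2 by simp
    show "dist (\<phi> s) (\<phi> t) \<le> \<epsilon>"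
      if "\<phi> \<in> level_set S U r" "s \<le> 0" "t \<le> 0" "dist s t < min \<delta>1 \<delta>2" for \<phi> s t
    proof (cases s t rule: linorder_cases)
      case less
      with *[OF that(1), of s t] that show ?thesis by (simp add: dist_real_def)
    next
      case greater
      with *[OF that(1), of t s] that show ?thesis by (simp add: dist_real_def dist_commute)
    qed (use \<epsilon> in auto)
  qed
qed

end

section \<open>Lower semicontinuity, decay and compactness\<close>


context controlled_semigroup begin

definition pairing :: "real \<Rightarrow> ('e \<Rightarrow>\<^sub>L real) \<Rightarrow> (real \<Rightarrow> 'h) \<Rightarrow> real" where
  "pairing t x' \<psi> = (LINT s:{0..t}|lborel. blinfun_apply x' (U (t - s) (\<psi> s)))"

lemma has_pettis_integral_iff_pairing:
  "L2_fun t \<psi> \<Longrightarrow> has_pettis_integral (\<lambda>s. U (t - s) (\<psi> s)) z t \<longleftrightarrow>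
    (\<forall>x'. blinfun_apply x' z = pairing t x' \<psi>)"
  by (auto simp: has_pettis_integral_def pairing_def pairing_bound(1))

text \<open>The value of U at 0 is arbitrary, so linearity holds only after integration.\<close>

lemma pairing_linear:
  assumes "L2_fun t \<psi>" "L2_fun t \<xi>"
  shows "pairing t x' (\<lambda>s. a *\<^sub>R \<psi> s + b *\<^sub>R \<xi> s) = a * pairing t x' \<psi> + b * pairing t x' \<xi>"
proof -
  let ?f = "\<lambda>\<psi> s. indicat_real {0..t} s *\<^sub>R blinfun_apply x' (U (t - s) (\<psi> s))"
  have int: "integrable lborel (?f \<psi>)" "integrable lborel (?f \<xi>)"
    using assms[THEN pairing_bound(1), of x'] by (auto simp: set_integrable_def)
  have int': "integrable lborel (?f (\<lambda>s. a *\<^sub>R \<psi> s + b *\<^sub>R \<xi> s))"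
    using pairing_bound(1)[OF L2_fun_add[OF assms[THEN L2_fun_scaleR]], of x']
    by (simp add: set_integrable_def)
  have "pairing t x' (\<lambda>s. a *\<^sub>R \<psi> s + b *\<^sub>R \<xi> s) = (LINT s|lborel. a * ?f \<psi> s + b * ?f \<xi> s)"
    unfolding pairing_def set_lebesgue_integral_def
  proof (rule integral_cong_AE)
    show "AE s in lborel. ?f (\<lambda>s. a *\<^sub>R \<psi> s + b *\<^sub>R \<xi> s) s = a * ?f \<psi> s + b * ?f \<xi> s"
      using AE_lborel_singleton[of t]
    proof eventually_elim
      case (elim s)
      show ?case
      proof (cases "s \<in> {0..t}")
        case True
        with elim have "t - s > 0" by auto
        with True show ?thesis
          using linear_simps[OF U_bl[of "t - s"]]
          by (simp add: blinfun.add_right blinfun.scaleR_right)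
      qed simp
    qed
  qed (use int int' in auto)
  also have "\<dots> = a * pairing t x' \<psi> + b * pairing t x' \<xi>"
    using int unfolding pairing_def set_lebesgue_integral_def by simp
  finally show ?thesis .
qed

lemma L2_fun_restrict: "L2_fun T \<psi> \<Longrightarrow> t \<le> T \<Longrightarrow> L2_fun t (\<psi> :: real \<Rightarrow> 'h)"
  using L2_segment(2)[of T \<psi> 0 t] by simp

lemma L2norm_sq_mono: "t \<le> T \<Longrightarrow> L2norm_sq t f \<le> L2norm_sq T f"
  unfolding L2norm_sq_def by (intro nn_integral_mono) (auto simp: indicator_def)

text \<open>Linearity and the Cauchy--Schwarz bound, applied to the difference of controls; the
  energy of x' is the finite constant.\<close>

lemma pairing_tendsto:
  assumes f: "\<And>n. L2_fun t (f n)" and g: "L2_fun t g"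
    and lim: "(\<lambda>n. L2norm_sq t (\<lambda>s. f n s - g s)) \<longlonglongrightarrow> 0"
  shows "(\<lambda>n. pairing t x' (f n)) \<longlonglongrightarrow> pairing t x' g"
proof -
  have *: "ennreal ((pairing t x' (f n) - pairing t x' g)\<^sup>2) \<le>
      energy t x' * L2norm_sq t (\<lambda>s. f n s - g s)" for n
    using pairing_bound(2)[OF L2_fun_diff[OF f g], of x' n]
      pairing_linear[OF f g, of x' 1 n "- 1"] unfolding pairing_def by (simp add: mult.commute)
  have "(\<lambda>n. energy t x' * L2norm_sq t (\<lambda>s. f n s - g s)) \<longlonglongrightarrow> energy t x' * 0"
    using energy_finite[of t x'] by (intro ennreal_tendsto_cmult lim) simp
  then have lim0: "(\<lambda>n. energy t x' * L2norm_sq t (\<lambda>s. f n s - g s)) \<longlonglongrightarrow> 0" by simp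
  have "(\<lambda>n. ennreal ((pairing t x' (f n) - pairing t x' g)\<^sup>2)) \<longlonglongrightarrow> ennreal 0"
    unfolding ennreal_0
    by (rule tendsto_sandwich[OF _ _ tendsto_const lim0]) (use * in \<open>auto intro: always_eventually\<close>)
  then have "(\<lambda>n. (pairing t x' (f n) - pairing t x' g)\<^sup>2) \<longlonglongrightarrow> 0"
    by (subst (asm) tendsto_ennreal_iff) auto
  then have "(\<lambda>n. sqrt ((pairing t x' (f n) - pairing t x' g)\<^sup>2)) \<longlonglongrightarrow> sqrt 0"
    by (rule tendsto_real_sqrt)
  then have "(\<lambda>n. pairing t x' (f n) - pairing t x' g) \<longlonglongrightarrow> 0"
    by (simp add: tendsto_rabs_zero_iff)
  then show ?thesis by (simp add: LIM_zero_iff)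
qed

text \<open>
  No weak compactness is needed: near-minimal elements of the nested convex sets of approximate
  controls form a Cauchy sequence by the parallelogram law.
\<close>

lemma rate_lower_semicontinuous:
  assumes T: "T > 0" and r: "r \<ge> 0"
    and approx: "\<And>\<epsilon>. \<epsilon> > 0 \<Longrightarrow>
      \<exists>\<phi>'. (\<forall>t\<in>{0..T}. norm (\<phi>' t - \<phi> t) < \<epsilon>) \<and> rate S U T \<phi>' \<le> ennreal r"
  shows "rate S U T \<phi> \<le> ennreal r"
proof -
  \<comment> \<open>The part of the path that has to be produced by a control.\<close>
  define y where "y t = \<phi> t - S t (\<phi> 0)" for t
  \<comment> \<open>Existence of the weak integral in E at every time is made part of membership,
    since the pairings alone do not ensure it.\<close>
  define W where "W \<eta> = {\<psi>. L2_fun T \<psi> \<and> L2norm_sq T \<psi> \<le> ennreal (2 * r + \<eta>) \<and>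
    (\<forall>t\<in>{0..T}. \<exists>z. (\<forall>x'. blinfun_apply x' z = pairing t x' \<psi>) \<and> norm (z - y t) \<le> \<eta>)}" for \<eta>
  define E where "E \<psi> = enn2real (L2norm_sq T \<psi>)" for \<psi> :: "real \<Rightarrow> 'h"
  have E: "L2norm_sq T \<psi> = ennreal (E \<psi>)" if "L2_fun T \<psi>" for \<psi>
    using that by (simp add: E_def L2_fun_iff)
  have E0: "E \<psi> \<ge> 0" for \<psi> by (simp add: E_def)
  have W_L2: "L2_fun T \<psi>" if "\<psi> \<in> W \<eta>" for \<psi> \<eta> using that by (simp add: W_def)
  have W_E: "E \<psi> \<le> 2 * r + \<eta>" if "\<psi> \<in> W \<eta>" "\<eta> > 0" for \<psi> \<eta>
  proof -
    have "ennreal (E \<psi>) \<le> ennreal (2 * r + \<eta>)"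
      using that(1) E[OF W_L2[OF that(1)]] by (simp add: W_def del: ennreal_plus)
    then show ?thesis using that r by (subst (asm) ennreal_le_iff) auto
  qed
  have W_mono: "W \<eta> \<subseteq> W \<eta>'" if "\<eta> \<le> \<eta>'" for \<eta> \<eta>'
  proof -
    have "ennreal (2 * r + \<eta>) \<le> ennreal (2 * r + \<eta>')" using that by (intro ennreal_leI) simp
    then show ?thesis unfolding W_def using that by (auto intro: order_trans) (meson atLeastAtMost_iff order_trans)
  qed
  have W_ne: "W \<eta> \<noteq> {}" if \<eta>: "\<eta> > 0" for \<eta>
  proof -
    \<comment> \<open>An error \<theta> in the path counts once at time t and at most M times
      through the initial value, hence the divisor 1 + M.\<close>
    have "\<eta> / (1 + M) > 0" using \<eta> M by simp
    from approx[OF this] obtain \<phi>' where \<phi>': "\<And>t. t \<in> {0..T} \<Longrightarrow> norm (\<phi>' t - \<phi> t) < \<eta> / (1 + M)" "rate S U T \<phi>' \<le> ennreal r"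
      by blast
    obtain \<psi> where \<psi>: "steers T \<phi>' \<psi>" "L2norm_sq T \<psi> \<le> ennreal (2 * r + \<eta>)"
      using rate_le_steers[OF \<phi>'(2) r \<eta>] .
    have "\<exists>z. (\<forall>x'. blinfun_apply x' z = pairing t x' \<psi>) \<and> norm (z - y t) \<le> \<eta>" if t: "t \<in> {0..T}" for t
    proof -
      have L2: "L2_fun t \<psi>" using \<psi>(1) t by (auto simp: steers_def intro: L2_fun_restrict)
      obtain z where z: "has_pettis_integral (\<lambda>s. U (t - s) (\<psi> s)) z t" "\<phi>' t = S t (\<phi>' 0) + z"
        using \<psi>(1) t unfolding steers_def is_mild_solution_at_def by blast
      have "z - y t = (\<phi>' t - \<phi> t) - S t (\<phi>' 0 - \<phi> 0)"
        using z(2) by (simp add: y_def blinfun.diff_right)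
      then have "norm (z - y t) \<le> norm (\<phi>' t - \<phi> t) + norm (S t (\<phi>' 0 - \<phi> 0))"
        using norm_triangle_ineq4[of "\<phi>' t - \<phi> t" "S t (\<phi>' 0 - \<phi> 0)"] by simp
      also have "\<dots> \<le> \<eta> / (1 + M) + M * (\<eta> / (1 + M))"
      proof (rule add_mono)
        have "norm (S t (\<phi>' 0 - \<phi> 0)) \<le> M * norm (\<phi>' 0 - \<phi> 0)" using t by (intro S_norm) auto
        also have "\<dots> \<le> M * (\<eta> / (1 + M))"
          using \<phi>'(1)[of 0] T M by (intro mult_left_mono) auto
        finally show "norm (S t (\<phi>' 0 - \<phi> 0)) \<le> M * (\<eta> / (1 + M))" .
      qed (use \<phi>'(1)[OF t] in simp)
      also have "\<dots> = (1 + M) * (\<eta> / (1 + M))" by (simp add: distrib_right add_divide_distrib)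
      also have "\<dots> = \<eta>" using M by simp
      finally show ?thesis using z(1) has_pettis_integral_iff_pairing[OF L2] by blast
    qed
    then have "\<psi> \<in> W \<eta>" using \<psi> by (simp add: W_def steers_def)
    then show ?thesis by auto
  qed
  have parallelogram: "E (\<lambda>s. (1/2) *\<^sub>R (f s + g s)) + 1/4 * E (\<lambda>s. f s - g s) = 1/2 * (E f + E g)"
    if "L2_fun T f" "L2_fun T g" for f g
  proof -
    have "L2_fun T (\<lambda>s. (1/2) *\<^sub>R (f s + g s))" "L2_fun T (\<lambda>s. f s - g s)"
      using that by (auto intro: L2_fun_add L2_fun_diff L2_fun_scaleR)
    then have "ennreal (E (\<lambda>s. (1/2) *\<^sub>R (f s + g s)) + 1/4 * E (\<lambda>s. f s - g s)) =
        ennreal (1/2 * (E f + E g))"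
      using L2norm_sq_parallelogram[OF that] that E0
      by (simp only: E ennreal_plus ennreal_mult' add_nonneg_nonneg mult_nonneg_nonneg) 
    then show ?thesis using E0 by (subst (asm) ennreal_inj) auto
  qed
  have W_mid: "(\<lambda>s. (1/2) *\<^sub>R (f s + g s)) \<in> W \<eta>" if fg: "f \<in> W \<eta>" "g \<in> W \<eta>" and \<eta>: "\<eta> > 0" for f g \<eta>
  proof -
    let ?m = "\<lambda>s. (1/2) *\<^sub>R (f s + g s)"
    note L2 = W_L2[OF fg(1)] W_L2[OF fg(2)]
    have m: "L2_fun T ?m" using L2 by (intro L2_fun_add L2_fun_scaleR)
    have "E ?m \<le> 2 * r + \<eta>"
    proof -
      have "a \<le> k" if "a + 1/4 * b = 1/2 * (c + d)" "c \<le> k" "d \<le> k" "0 \<le> b" for a b c d k :: real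
        using that by argo
      from this[OF parallelogram[OF L2] W_E[OF fg(1) \<eta>] W_E[OF fg(2) \<eta>] E0] show ?thesis .
    qed
    then have "L2norm_sq T ?m \<le> ennreal (2 * r + \<eta>)" by (simp add: E[OF m] ennreal_leI)
    moreover have "\<exists>z. (\<forall>x'. blinfun_apply x' z = pairing t x' ?m) \<and> norm (z - y t) \<le> \<eta>"
      if t: "t \<in> {0..T}" for t
    proof -
      obtain z1 where z1: "\<forall>x'. blinfun_apply x' z1 = pairing t x' f" "norm (z1 - y t) \<le> \<eta>"
        using fg(1) t unfolding W_def by blast
      obtain z2 where z2: "\<forall>x'. blinfun_apply x' z2 = pairing t x' g" "norm (z2 - y t) \<le> \<eta>"
        using fg(2) t unfolding W_def by blast
      have t': "t \<le> T" using t by simp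
      have "blinfun_apply x' ((1/2) *\<^sub>R (z1 + z2)) = pairing t x' ?m" for x'
        using pairing_linear[OF L2_fun_restrict[OF L2(1) t'] L2_fun_restrict[OF L2(2) t'], of x' "1/2" "1/2"]
          z1(1) z2(1) by (simp add: blinfun.add_right blinfun.scaleR_right scaleR_add_right)
      moreover have "norm ((1/2) *\<^sub>R (z1 + z2) - y t) \<le> \<eta>"
      proof -
        have "(1/2) *\<^sub>R (z1 + z2) - y t = (1/2) *\<^sub>R ((z1 - y t) + (z2 - y t))"
          by (simp add: algebra_simps flip: scaleR_2)
        then show ?thesis using norm_triangle_ineq[of "z1 - y t" "z2 - y t"] z1(2) z2(2) by simp
      qed
      ultimately show ?thesis by blast
    qed
    ultimately show ?thesis using m by (simp add: W_def)
  qed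
  define \<eta> where "\<eta> n = inverse (real (Suc n))" for n
  have \<eta>0: "\<eta> n > 0" for n by (simp add: \<eta>_def)
  have \<eta>lim: "\<eta> \<longlonglongrightarrow> 0" unfolding \<eta>_def by (rule LIMSEQ_inverse_real_of_nat)
  have \<eta>mono: "\<eta> m \<le> \<eta> n" if "n \<le> m" for m n using that by (simp add: \<eta>_def)
  \<comment> \<open>These minimal energies increase as the sets shrink and stay below 2 r + 1, so
    they converge; this drives the Cauchy estimate.\<close>
  define d where "d n = Inf (E ` W (\<eta> n))" for n
  have bdd: "bdd_below (E ` X)" for X by (rule bdd_belowI2) (rule E0)
  have d_le: "d n \<le> E \<psi>" if "\<psi> \<in> W (\<eta> n)" for n \<psi>
    unfolding d_def using that by (intro cInf_lower bdd) auto
  have "incseq d"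
    unfolding d_def using W_ne[OF \<eta>0] W_mono[OF \<eta>mono]
    by (intro monoI cInf_superset_mono bdd image_mono) auto
  have "\<exists>\<psi>\<in>W (\<eta> n). E \<psi> < d n + \<eta> n" for n
    using cInf_lessD[of "E ` W (\<eta> n)" "d n + \<eta> n"] W_ne[OF \<eta>0] \<eta>0[of n] by (auto simp: d_def)
  then obtain \<psi> where \<psi>: "\<And>n. \<psi> n \<in> W (\<eta> n)" "\<And>n. E (\<psi> n) < d n + \<eta> n" by metis
  have L2\<psi>: "L2_fun T (\<psi> n)" for n using \<psi>(1) by (rule W_L2)
  have "d n \<le> 2 * r + 1" for n
    using d_le[OF \<psi>(1)[of n]] W_E[OF \<psi>(1)[of n] \<eta>0] \<eta>mono[of 0 n] by (simp add: \<eta>_def[of 0])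
  then obtain L where L: "d \<longlonglongrightarrow> L" "\<And>n. d n \<le> L"
    using incseq_convergent[OF \<open>incseq d\<close>] by blast
  \<comment> \<open>The midpoint lies in \<open>W (\<eta> n)\<close>, so its energy is at least d n,
    while the energies of \<psi> n and \<psi> m exceed d n and d m by at most \<eta> n. The
    parallelogram law leaves the stated bound for the difference.\<close>
  have diff: "E (\<lambda>s. \<psi> n s - \<psi> m s) \<le> 2 * (L - d n) + 4 * \<eta> n" if "n \<le> m" for m n
  proof -
    have "\<psi> m \<in> W (\<eta> n)" using \<psi>(1)[of m] W_mono[OF \<eta>mono[OF that]] by auto
    then have "d n \<le> E (\<lambda>s. (1/2) *\<^sub>R (\<psi> n s + \<psi> m s))" by (intro d_le W_mid \<psi>(1) \<eta>0)
    moreover have "b \<le> 2 * (l - p) + 4 * h"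
      if "p \<le> a" "a + 1/4 * b = 1/2 * (c + d)" "c < p + h" "d < q + k" "q \<le> l" "k \<le> h"
      for a b c d h k l p q :: real
      using that by argo
    ultimately show ?thesis
      using parallelogram[OF L2\<psi> L2\<psi>] \<psi>(2) L(2) \<eta>mono[OF that] by blast
  qed
  have sym: "L2norm_sq T (\<lambda>s. \<psi> n s - \<psi> m s) = L2norm_sq T (\<lambda>s. \<psi> m s - \<psi> n s)" for m n
    by (simp add: L2norm_sq_def norm_minus_commute)
  obtain g where g: "L2_fun T g" "(\<lambda>n. L2norm_sq T (\<lambda>s. \<psi> n s - g s)) \<longlonglongrightarrow> 0"
  proof (rule L2_complete[OF L2\<psi>])
    fix \<epsilon> :: real assume \<epsilon>: "\<epsilon> > 0"
    have "(\<lambda>n. 2 * (L - d n) + 4 * \<eta> n) \<longlonglongrightarrow> 2 * (L - L) + 4 * 0"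
      by (intro tendsto_intros L \<eta>lim)
    then have "eventually (\<lambda>n. 2 * (L - d n) + 4 * \<eta> n < \<epsilon>) sequentially"
      using \<epsilon> by (intro order_tendstoD(2)) auto
    then obtain N where N: "\<And>n. n \<ge> N \<Longrightarrow> 2 * (L - d n) + 4 * \<eta> n < \<epsilon>"
      by (auto simp: eventually_sequentially)
    have *: "L2norm_sq T (\<lambda>s. \<psi> n s - \<psi> m s) < ennreal \<epsilon>" if "N \<le> n" "n \<le> m" for m n
      using le_less_trans[OF diff[OF that(2)] N[OF that(1)]] E0
      by (subst E[OF L2_fun_diff[OF L2\<psi> L2\<psi>]]) (auto simp: ennreal_less_iff)
    have "L2norm_sq T (\<lambda>s. \<psi> m s - \<psi> n s) < ennreal \<epsilon>" if "m \<ge> N" "n \<ge> N" for m n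
      using *[of n m] *[of m n] that sym[of n m] by (cases "n \<le> m") auto
    then show "\<exists>N. \<forall>m\<ge>N. \<forall>n\<ge>N. L2norm_sq T (\<lambda>s. \<psi> m s - \<psi> n s) < ennreal \<epsilon>" by blast
  qed
  \<comment> \<open>The weighted inequality with factor 1 + \<delta> takes the place of the triangle
    inequality for the L2 norm; its error term vanishes as n grows with \<delta> fixed.\<close>
  have Eg: "E g \<le> (1 + \<delta>) * (2 * r)" if \<delta>: "\<delta> > 0" for \<delta>
  proof (rule LIMSEQ_le_const)
    have "(\<lambda>n. ennreal (E (\<lambda>s. \<psi> n s - g s))) \<longlonglongrightarrow> ennreal 0"
      using g(2) by (simp add: E[OF L2_fun_diff[OF L2\<psi> g(1)]])
    then have "(\<lambda>n. E (\<lambda>s. \<psi> n s - g s)) \<longlonglongrightarrow> 0"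
      using E0 by (subst (asm) tendsto_ennreal_iff) auto
    then have "(\<lambda>n. (1 + \<delta>) * (2 * r + \<eta> n) + (1 + 1 / \<delta>) * E (\<lambda>s. \<psi> n s - g s)) \<longlonglongrightarrow>
        (1 + \<delta>) * (2 * r + 0) + (1 + 1 / \<delta>) * 0"
      by (intro tendsto_intros \<eta>lim)
    then show "(\<lambda>n. (1 + \<delta>) * (2 * r + \<eta> n) + (1 + 1 / \<delta>) * E (\<lambda>s. \<psi> n s - g s)) \<longlonglongrightarrow> (1 + \<delta>) * (2 * r)"
      by simp
    have "E g \<le> (1 + \<delta>) * (2 * r + \<eta> n) + (1 + 1 / \<delta>) * E (\<lambda>s. \<psi> n s - g s)" for n
    proof -
      have D: "L2_fun T (\<lambda>s. (- 1) *\<^sub>R (\<psi> n s - g s))"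
        by (intro L2_fun_scaleR L2_fun_diff L2\<psi> g)
      have "L2norm_sq T (\<lambda>s. (- 1) *\<^sub>R (\<psi> n s - g s)) = L2norm_sq T (\<lambda>s. \<psi> n s - g s)"
        by (simp add: L2norm_sq_def norm_minus_commute)
      then have "L2norm_sq T g \<le> ennreal (1 + \<delta>) * L2norm_sq T (\<psi> n) +
          ennreal (1 + 1 / \<delta>) * L2norm_sq T (\<lambda>s. \<psi> n s - g s)"
        using L2norm_sq_add_le[OF L2\<psi> D \<delta>, of n] by simp
      then have "ennreal (E g) \<le> ennreal ((1 + \<delta>) * E (\<psi> n) + (1 + 1 / \<delta>) * E (\<lambda>s. \<psi> n s - g s))"
        using \<delta> E0 by (simp add: E g(1) L2\<psi> L2_fun_diff ennreal_mult ennreal_plus)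
      then have "E g \<le> (1 + \<delta>) * E (\<psi> n) + (1 + 1 / \<delta>) * E (\<lambda>s. \<psi> n s - g s)"
        using \<delta> E0 by (subst (asm) ennreal_le_iff) auto
      moreover have "(1 + \<delta>) * E (\<psi> n) \<le> (1 + \<delta>) * (2 * r + \<eta> n)"
        using W_E[OF \<psi>(1) \<eta>0] \<delta> by (intro mult_left_mono) auto
      ultimately show ?thesis by linarith
    qed
    then show "\<exists>N. \<forall>n\<ge>N. E g \<le> (1 + \<delta>) * (2 * r + \<eta> n) + (1 + 1 / \<delta>) * E (\<lambda>s. \<psi> n s - g s)"
      by blast
  qed
  have "E g \<le> 2 * r"
  proof (rule field_le_epsilon)
    fix \<epsilon> :: real assume \<epsilon>: "\<epsilon> > 0"
    \<comment> \<open>The excess 2 r \<epsilon> / (2 r + 1) is at most \<epsilon>, and the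
      denominator stays positive for r = 0.\<close>
    have "E g \<le> (1 + \<epsilon> / (2 * r + 1)) * (2 * r)" using \<epsilon> r by (intro Eg) auto
    also have "\<dots> = 2 * r + \<epsilon> * (2 * r / (2 * r + 1))" by (simp add: distrib_right)
    also have "\<dots> \<le> 2 * r + \<epsilon> * 1" using \<epsilon> r by (intro add_left_mono mult_left_mono) auto
    finally show "E g \<le> 2 * r + \<epsilon>" by simp
  qed
  have "is_mild_solution_at S U (\<phi> 0) g t (\<phi> t)" if t: "t \<in> {0..T}" for t
  proof -
    have t': "t \<le> T" using t by simp
    \<comment> \<open>The weak integrals z n tend to y t in norm while their pairings tend to those
      of g; hence y t is the weak integral belonging to g.\<close>
    have "\<exists>z. (\<forall>x'. blinfun_apply x' z = pairing t x' (\<psi> n)) \<and> norm (z - y t) \<le> \<eta> n" for n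
      using \<psi>(1)[of n] t unfolding W_def by blast
    then obtain z where z: "\<And>n x'. blinfun_apply x' (z n) = pairing t x' (\<psi> n)"
        "\<And>n. norm (z n - y t) \<le> \<eta> n" by metis
    have "(\<lambda>n. z n - y t) \<longlonglongrightarrow> 0"
      by (rule Lim_null_comparison[OF _ \<eta>lim]) (use z(2) in auto)
    then have zlim: "z \<longlonglongrightarrow> y t" by (simp add: LIM_zero_iff)
    have "(\<lambda>n. L2norm_sq t (\<lambda>s. \<psi> n s - g s)) \<longlonglongrightarrow> 0"
      by (rule tendsto_sandwich[OF _ _ tendsto_const g(2)]) (auto simp: L2norm_sq_mono[OF t'])
    then have "(\<lambda>n. pairing t x' (\<psi> n)) \<longlonglongrightarrow> pairing t x' g" for x'
      by (intro pairing_tendsto L2_fun_restrict[OF _ t'] L2\<psi> g(1))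
    moreover have "(\<lambda>n. x' (z n)) \<longlonglongrightarrow> x' (y t)" for x' :: "'e \<Rightarrow>\<^sub>L real"
      by (intro tendsto_intros zlim)
    ultimately have "blinfun_apply x' (y t) = pairing t x' g" for x'
      unfolding z(1) by (metis LIMSEQ_unique)
    then have "has_pettis_integral (\<lambda>s. U (t - s) (g s)) (y t) t"
      using has_pettis_integral_iff_pairing[OF L2_fun_restrict[OF g(1) t']] by blast
    then show ?thesis unfolding is_mild_solution_at_def by (intro exI[of _ "y t"]) (simp add: y_def)
  qed
  then have "rate S U T \<phi> \<le> ennreal (1/2) * L2norm_sq T g"
    unfolding rate_def using g(1) by (intro INF_lower) auto
  also have "\<dots> = ennreal (1/2 * E g)" unfolding E[OF g(1)] by (rule ennreal_mult[symmetric]) (auto simp: E0)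
  also have "\<dots> \<le> ennreal r" using \<open>E g \<le> 2 * r\<close> by (intro ennreal_leI) simp
  finally show ?thesis .
qed

text \<open>The condition defining \<open>reach\<close> is quadratic in z and linear in the energy
  bound, so z divided by sqrt \<eta> lies in \<open>reach t 1\<close>.\<close>

lemma reach_scale:
  assumes c: "\<And>z. z \<in> reach t 1 \<Longrightarrow> norm z \<le> c" and "\<eta> > 0" and z: "z \<in> reach t \<eta>"
  shows "norm z \<le> sqrt \<eta> * c"
proof -
  have "inverse (sqrt \<eta>) *\<^sub>R z \<in> reach t 1"
    unfolding reach_def mem_Collect_eq
  proof
    fix x' :: "'e \<Rightarrow>\<^sub>L real"
    have "ennreal ((x' (inverse (sqrt \<eta>) *\<^sub>R z))\<^sup>2) = ennreal (inverse \<eta>) * ennreal ((x' z)\<^sup>2)"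
      using assms(2) by (simp add: blinfun.scaleR_right power_mult_distrib power_inverse ennreal_mult)
    also have "\<dots> \<le> ennreal (inverse \<eta>) * (ennreal \<eta> * energy t x')"
      using z by (intro mult_left_mono) (auto simp: reach_def)
    also have "\<dots> = ennreal (inverse \<eta> * \<eta>) * energy t x'"
      using assms(2) by (subst ennreal_mult) (auto simp: mult.assoc)
    finally show "ennreal ((x' (inverse (sqrt \<eta>) *\<^sub>R z))\<^sup>2) \<le> ennreal 1 * energy t x'"
      using assms(2) by simp
  qed
  from c[OF this] show ?thesis using assms(2) by (simp add: field_simps)
qed

text \<open>
  If \<phi> did not decay, there would be arbitrarily many disjoint time intervals on each of which
  every control spends at least a fixed amount of energy.
\<close>

lemma rate_past_decay:
  assumes rate: "rate_past S U \<phi> \<le> ennreal r" and r: "r \<ge> 0"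
    and B: "\<And>t. t \<le> 0 \<Longrightarrow> norm (\<phi> t) \<le> B"
  shows "((\<lambda>t. norm (\<phi> t)) \<longlongrightarrow> 0) at_bot"
proof (rule ccontr)
  assume "\<not> ?thesis"
  then obtain \<epsilon> where \<epsilon>: "\<epsilon> > 0" "\<not> eventually (\<lambda>t. norm (\<phi> t) < \<epsilon>) at_bot"
    unfolding tendsto_iff by auto
  then have ex: "\<exists>t\<le>a. norm (\<phi> t) \<ge> \<epsilon>" for a
    by (auto simp: eventually_at_bot_linorder not_less)
  have B0: "B \<ge> 0" using B[of 0] norm_ge_zero[of "\<phi> 0"] by linarith
  \<comment> \<open>At most \<epsilon> / 2 is carried over from time t - \<tau> by S(\<tau>); B + 1
    replaces B because B may be 0.\<close>
  obtain \<tau> where \<tau>: "\<tau> > 0" "\<And>x. norm (S \<tau> x) \<le> \<epsilon> / (2 * (B + 1)) * norm x"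
    using ex_contraction_time[of "\<epsilon> / (2 * (B + 1))"] \<epsilon> B0 by auto
  obtain c where c: "c > 0" "\<And>z. z \<in> reach \<tau> 1 \<Longrightarrow> norm z \<le> c"
    using reach_bounded[of \<tau> 1] \<tau> by auto
  \<comment> \<open>With squared norm at most \<eta> a control moves the path by at most \<epsilon>
    / 4 within time \<tau>, and \<epsilon> / 4 + \<epsilon> / 2 < \<epsilon>.\<close>
  define \<eta> where "\<eta> = (\<epsilon> / (4 * c))\<^sup>2"
  have \<eta>: "\<eta> > 0" "sqrt \<eta> * c = \<epsilon> / 4" using \<epsilon> c by (auto simp: \<eta>_def)
  have cost: "ennreal \<eta> \<le> (\<integral>\<^sup>+s\<in>{T + t - \<tau>..T + t}. ennreal ((norm (\<psi> s))\<^sup>2) \<partial>lborel)"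
    if \<psi>: "steers T (\<lambda>s. \<phi> (s - T)) \<psi>" and t: "t \<le> 0" "norm (\<phi> t) \<ge> \<epsilon>" "0 \<le> T + t - \<tau>" for T t \<psi>
  proof (rule ccontr)
    have L2: "L2_fun T \<psi>" using \<psi> by (simp add: steers_def)
    assume "\<not> ?thesis"
    then have "L2norm_sq \<tau> (\<lambda>s. \<psi> (T + t - \<tau> + s)) \<le> ennreal \<eta>"
      using L2_segment(1)[OF L2 t(3), of "T + t"] t(1) by simp
    moreover have "steers \<tau> (\<lambda>s. \<phi> (T + t - \<tau> + s - T)) (\<lambda>s. \<psi> (T + t - \<tau> + s))"
      using steers_segment[OF \<psi> t(3), of "T + t"] t(1) by simp
    ultimately have "\<phi> (T + t - \<tau> + \<tau> - T) - S \<tau> (\<phi> (T + t - \<tau> + 0 - T)) \<in> reach \<tau> \<eta>"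
      using \<tau>(1) by (intro steers_reach) auto
    then have "\<phi> t - S \<tau> (\<phi> (t - \<tau>)) \<in> reach \<tau> \<eta>" by simp
    then have "norm (\<phi> t - S \<tau> (\<phi> (t - \<tau>))) \<le> \<epsilon> / 4"
      using reach_scale[of \<tau> c \<eta>] c(2) \<eta> by metis
    moreover have "norm (S \<tau> (\<phi> (t - \<tau>))) \<le> \<epsilon> / 2"
    proof -
      have "norm (S \<tau> (\<phi> (t - \<tau>))) \<le> \<epsilon> / (2 * (B + 1)) * norm (\<phi> (t - \<tau>))" by (rule \<tau>)
      also have "\<dots> \<le> \<epsilon> / (2 * (B + 1)) * (B + 1)"
        using B[of "t - \<tau>"] t(1) \<tau>(1) \<epsilon> B0 by (intro mult_left_mono) auto
      also have "\<dots> = \<epsilon> / 2" using B0 by (simp add: divide_eq_eq algebra_simps)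
      finally show ?thesis .
    qed
    ultimately show False
      using t(2) \<epsilon>(1) norm_triangle_sub[of "\<phi> t" "S \<tau> (\<phi> (t - \<tau>))"] by linarith
  qed
  \<comment> \<open>The window is measured back from T, which corresponds to time 0 of \<phi>, so T0
    does not depend on the horizon. It is open on the left so that the next interval, which may end
    exactly at T - T0, is disjoint from it.\<close>
  have "\<exists>T0>0. \<forall>T\<ge>T0. \<forall>\<psi>. steers T (\<lambda>s. \<phi> (s - T)) \<psi> \<longrightarrow>
      of_nat n * ennreal \<eta> \<le> (\<integral>\<^sup>+s\<in>{T - T0<..T}. ennreal ((norm (\<psi> s))\<^sup>2) \<partial>lborel)" for n
  proof (induction n)
    case 0
    show ?case by (auto intro: exI[of _ 1])
  next
    case (Suc n)
    then obtain T0 where T0: "T0 > 0" "\<And>T \<psi>. T \<ge> T0 \<Longrightarrow> steers T (\<lambda>s. \<phi> (s - T)) \<psi> \<Longrightarrow>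
      of_nat n * ennreal \<eta> \<le> (\<integral>\<^sup>+s\<in>{T - T0<..T}. ennreal ((norm (\<psi> s))\<^sup>2) \<partial>lborel)" by blast
    obtain t where t: "t \<le> - T0" "norm (\<phi> t) \<ge> \<epsilon>" using ex by blast
    show ?case
    proof (intro exI[of _ "\<tau> - t"] conjI allI impI)
      show "\<tau> - t > 0" using \<tau>(1) t(1) T0(1) by simp
      fix T \<psi> assume T: "\<tau> - t \<le> T" and \<psi>: "steers T (\<lambda>s. \<phi> (s - T)) \<psi>"
      let ?f = "\<lambda>s. ennreal ((norm (\<psi> s))\<^sup>2)"
      have meas: "(\<lambda>s. ?f s * indicator A s) \<in> borel_measurable lborel"
        if "A \<subseteq> {0..T}" "A \<in> sets borel" for A
      proof -
        have "(\<lambda>s. ennreal ((norm (indicator {0..T} s *\<^sub>R \<psi> s))\<^sup>2) * indicator A s) \<in> borel_measurable lborel"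
        proof -
          note [measurable] = that(2)
          have [measurable]: "(\<lambda>s. indicator {0..T} s *\<^sub>R \<psi> s) \<in> borel_measurable lborel"
            using \<psi> by (intro L2_measurable) (simp add: steers_def)
          show ?thesis by measurable
        qed
        also have "(\<lambda>s. ennreal ((norm (indicator {0..T} s *\<^sub>R \<psi> s))\<^sup>2) * indicator A s) =
            (\<lambda>s. ?f s * indicator A s)"
          using that(1) by (auto simp: indicator_def fun_eq_iff)
        finally show ?thesis .
      qed
      have "of_nat (Suc n) * ennreal \<eta> = ennreal \<eta> + of_nat n * ennreal \<eta>"
        by (simp add: distrib_right)
      also have "\<dots> \<le> (\<integral>\<^sup>+s\<in>{T + t - \<tau>..T + t}. ?f s \<partial>lborel) + (\<integral>\<^sup>+s\<in>{T - T0<..T}. ?f s \<partial>lborel)"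
        using T t T0 \<tau>(1) by (intro add_mono cost[OF \<psi>] T0(2) \<psi>) auto
      also have "\<dots> = (\<integral>\<^sup>+s. ?f s * indicator {T + t - \<tau>..T + t} s + ?f s * indicator {T - T0<..T} s \<partial>lborel)"
        using T t T0 \<tau>(1) by (intro nn_integral_add[symmetric] meas) auto
      also have "\<dots> \<le> (\<integral>\<^sup>+s\<in>{T - (\<tau> - t)<..T}. ?f s \<partial>lborel)"
      proof (rule nn_integral_mono_AE)
        show "AE s in lborel. ?f s * indicator {T + t - \<tau>..T + t} s + ?f s * indicator {T - T0<..T} s \<le>
            ?f s * indicator {T - (\<tau> - t)<..T} s"
          using AE_lborel_singleton[of "T + t - \<tau>"]
          by eventually_elim (use t T0 \<tau>(1) in \<open>auto simp: indicator_def\<close>)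
      qed
      finally show "of_nat (Suc n) * ennreal \<eta> \<le> (\<integral>\<^sup>+s\<in>{T - (\<tau> - t)<..T}. ?f s \<partial>lborel)" .
    qed
  qed
  moreover obtain n :: nat where n: "real n * \<eta> > 2 * r + 1"
    using reals_Archimedean3[OF \<eta>(1)] by blast
  ultimately obtain T where T: "T > 0" "\<And>\<psi>. steers T (\<lambda>s. \<phi> (s - T)) \<psi> \<Longrightarrow>
      of_nat n * ennreal \<eta> \<le> (\<integral>\<^sup>+s\<in>{T - T<..T}. ennreal ((norm (\<psi> s))\<^sup>2) \<partial>lborel)"
    by (meson order_refl)
  obtain \<psi> where \<psi>: "steers T (\<lambda>s. \<phi> (s - T)) \<psi>" "L2norm_sq T \<psi> \<le> ennreal (2 * r + 1)"
    using rate_past_le_steers[OF rate r, of 1 T] T(1) by auto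
  have "ennreal (real n * \<eta>) = of_nat n * ennreal \<eta>"
    using \<eta>(1) by (simp add: ennreal_mult ennreal_of_nat_eq_real_of_nat)
  also have "\<dots> \<le> (\<integral>\<^sup>+s\<in>{T - T<..T}. ennreal ((norm (\<psi> s))\<^sup>2) \<partial>lborel)" by (rule T(2)[OF \<psi>(1)])
  also have "\<dots> \<le> L2norm_sq T \<psi>"
    unfolding L2norm_sq_def by (intro nn_integral_mono) (auto simp: indicator_def)
  also have "\<dots> \<le> ennreal (2 * r + 1)" by (rule \<psi>)
  finally show False using n r by (subst (asm) ennreal_le_iff) auto
qed

text \<open>The rate passes to the limit on each [-T,0] by lower semicontinuity. Decay does not pass
  to the limit; it is deduced anew from the finite rate and the uniform bound on the level set,
  weakened by 1 through approximation at single points.\<close>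

lemma level_set_limit:
  assumes r: "r \<ge> 0" and \<phi>: "\<phi> \<in> cont_funs {..0}"
    and approx: "\<And>J \<epsilon>. compact J \<Longrightarrow> J \<subseteq> {..0} \<Longrightarrow> \<epsilon> > 0 \<Longrightarrow>
      \<exists>\<phi>'\<in>level_set S U r. \<forall>t\<in>J. dist (\<phi>' t) (\<phi> t) < \<epsilon>"
  shows "\<phi> \<in> level_set S U r"
proof -
  have "rate S U T (\<lambda>t. \<phi> (t - T)) \<le> ennreal r" if T: "T > 0" for T
  proof (rule rate_lower_semicontinuous[OF T r])
    fix \<epsilon> :: real assume "\<epsilon> > 0"
    then obtain \<phi>' where \<phi>': "\<phi>' \<in> level_set S U r" "\<forall>t\<in>{-T..0}. dist (\<phi>' t) (\<phi> t) < \<epsilon>"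
      using approx[of "{-T..0}" \<epsilon>] by auto
    have "rate S U T (\<lambda>t. \<phi>' (t - T)) \<le> rate_past S U \<phi>'"
      unfolding rate_past_def using T by (intro SUP_upper) auto
    also have "\<dots> \<le> ennreal r" using \<phi>'(1) by (simp add: level_set_def)
    finally show "\<exists>\<phi>'. (\<forall>t\<in>{0..T}. norm (\<phi>' t - \<phi> (t - T)) < \<epsilon>) \<and> rate S U T \<phi>' \<le> ennreal r"
      using \<phi>'(2) by (intro exI[of _ "\<lambda>t. \<phi>' (t - T)"]) (auto simp: dist_norm)
  qed
  then have rate: "rate_past S U \<phi> \<le> ennreal r"
    unfolding rate_past_def by (intro SUP_least) auto
  obtain B where B: "B > 0" "\<And>\<phi> t. \<phi> \<in> level_set S U r \<Longrightarrow> t \<le> 0 \<Longrightarrow> norm (\<phi> t) \<le> B"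
    using level_set_bounded[OF r] by blast
  have "norm (\<phi> t) \<le> B + 1" if t: "t \<le> 0" for t
  proof -
    obtain \<phi>' where \<phi>': "\<phi>' \<in> level_set S U r" "dist (\<phi>' t) (\<phi> t) < 1"
      using approx[of "{t}" 1] t by auto
    then show ?thesis
      using B(2)[OF \<phi>'(1) t] norm_triangle_sub[of "\<phi> t" "\<phi>' t"] by (simp add: dist_norm norm_minus_commute)
  qed
  from rate_past_decay[OF rate r this] show ?thesis using \<phi> rate by (simp add: level_set_def)
qed

theorem level_set_compactin:
  assumes r: "r \<ge> 0"
  shows "compactin (ucc_topology {..0}) (level_set S U r)"
proof -
  obtain C where C: "compact C" "\<And>\<phi> t. \<phi> \<in> level_set S U r \<Longrightarrow> t \<le> 0 \<Longrightarrow> \<phi> t \<in> C"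
    using level_set_values_compact[OF r] by blast
  have "\<exists>\<delta>>0. \<forall>\<phi>\<in>level_set S U r. \<forall>s\<le>0. \<forall>t\<le>0. dist s t < \<delta> \<longrightarrow> dist (\<phi> s) (\<phi> t) \<le> \<epsilon>"
    if "\<epsilon> > 0" for \<epsilon>
    using level_set_equicontinuous[OF r that] by metis
  then obtain \<delta> where \<delta>: "\<And>\<epsilon>. \<epsilon> > 0 \<Longrightarrow> \<delta> \<epsilon> > 0" "\<And>\<epsilon> \<phi> s t. \<epsilon> > 0 \<Longrightarrow> \<phi> \<in> level_set S U r \<Longrightarrow>
      s \<le> 0 \<Longrightarrow> t \<le> 0 \<Longrightarrow> dist s t < \<delta> \<epsilon> \<Longrightarrow> dist (\<phi> s) (\<phi> t) \<le> \<epsilon>" by metis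
  show ?thesis
  proof (rule closed_compactin[OF compactin_ucc_equicontinuous[where D = "{..0}" and \<delta> = \<delta>, OF C(1)]])
    show "level_set S U r \<subseteq> {\<phi> \<in> {..0} \<rightarrow>\<^sub>E C. \<forall>\<epsilon>>0. \<forall>s\<in>{..0}. \<forall>t\<in>{..0}.
        dist s t < \<delta> \<epsilon> \<longrightarrow> dist (\<phi> s) (\<phi> t) \<le> \<epsilon>}"
      using C(2) \<delta>(2) by (auto simp: PiE_def level_set_def cont_funs_def)
    have "open_ucc {..0} (cont_funs {..0} - level_set S U r)"
      unfolding open_ucc_def
    proof (intro conjI ballI)
      fix \<phi> assume \<phi>: "\<phi> \<in> cont_funs {..0} - level_set S U r"
      show "\<exists>J \<epsilon>. compact J \<and> J \<subseteq> {..0} \<and> 0 < \<epsilon> \<and>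
          (\<forall>\<phi>'\<in>cont_funs {..0}. (\<forall>t\<in>J. dist (\<phi>' t) (\<phi> t) < \<epsilon>) \<longrightarrow> \<phi>' \<in> cont_funs {..0} - level_set S U r)"
      proof (rule ccontr)
        \<comment> \<open>This says that every neighbourhood of \<phi> meets the level set, which is
          the approximation hypothesis of \<open>level_set_limit\<close>.\<close>
        assume not: "\<not> ?thesis"
        have "\<phi> \<in> level_set S U r"
          by (rule level_set_limit[OF r]) (use \<phi> not in blast)+
        with \<phi> show False by simp
      qed
    qed auto
    then show "closedin (ucc_topology {..0}) (level_set S U r)"
      by (auto simp: closedin_def topspace_ucc_topology openin_ucc_topology level_set_def)
  qed (rule \<delta>(1))
qed

end

section \<open>Gaussian random variables and Wiener integrals\<close>


text \<open>Ulam's argument: for each n, finitely many balls of radius 1/(n+1) around points of C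
  capture almost all of the mass; the intersection over n of these finite unions is closed and
  totally bounded.\<close>

lemma (in prob_space) tight_random_variable:
  fixes X :: "'a \<Rightarrow> 'e::complete_space"
  assumes [measurable]: "X \<in> borel_measurable M"
    and C: "countable C" "AE \<omega> in M. X \<omega> \<in> closure C" and p: "p > 0"
  obtains A where "compact A" "prob {\<omega> \<in> space M. X \<omega> \<in> A} \<ge> 1 - p"
proof -
  have "C \<noteq> {}" using C(2) AE_const[of False] by auto
  define c where "c = from_nat_into C"
  have c: "range c = C" using C(1) \<open>C \<noteq> {}\<close> by (simp add: c_def range_from_nat_into)
  define G where "G n N = (\<Union>i\<le>N. cball (c i) (inverse (real (Suc n))))" for n N :: nat
  have [measurable]: "G n N \<in> sets borel" for n N unfolding G_def by auto
  define A where "A n N = {\<omega> \<in> space M. X \<omega> \<in> G n N}" for n N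
  have A[measurable]: "A n N \<in> sets M" for n N unfolding A_def by measurable
  \<comment> \<open>The admissible losses p/2, p/4, p/8, ... add up to p.\<close>
  have "\<exists>N. prob (A n N) > 1 - p / 2 * (1/2) ^ n" for n
  proof -
    have "(\<lambda>N. prob (A n N)) \<longlonglongrightarrow> prob (\<Union>N. A n N)"
    proof (rule finite_Lim_measure_incseq)
      show "range (A n) \<subseteq> events" using A by auto
      show "incseq (A n)" unfolding A_def G_def by (rule incseq_SucI) auto
    qed
    also have "prob (\<Union>N. A n N) = 1"
    proof (rule prob_eq_1[THEN iffD2])
      show "AE \<omega> in M. \<omega> \<in> (\<Union>N. A n N)"
        using C(2) AE_space
      proof eventually_elim
        case (elim \<omega>)
        have "inverse (real (Suc n)) > 0" by simp
        then obtain y where "y \<in> C" "dist y (X \<omega>) < inverse (real (Suc n))"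
          using elim(1) unfolding closure_approachable by blast
        then obtain i where "dist (c i) (X \<omega>) < inverse (real (Suc n))" using c by (metis imageE)
        then have "\<omega> \<in> A n i" using elim(2) by (auto simp: A_def G_def intro!: bexI[of _ i])
        then show ?case by blast
      qed
    qed measurable
    finally have "eventually (\<lambda>N. prob (A n N) > 1 - p / 2 * (1/2) ^ n) sequentially"
      using p by (intro order_tendstoD) auto
    then show ?thesis by (auto simp: eventually_sequentially)
  qed
  then obtain N where N: "\<And>n. prob (A n (N n)) > 1 - p / 2 * (1/2) ^ n" by metis
  define K where "K = (\<Inter>n. G n (N n))"
  have "closed (G n k)" for n k unfolding G_def by (intro closed_UN) auto
  then have "closure K = K" unfolding K_def by (intro closure_closed closed_INT) auto
  moreover have "compact (closure K)"
  proof (rule compact_closure_totally_bounded)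
    fix \<epsilon> :: real assume "\<epsilon> > 0"
    then obtain n where n: "inverse (real (Suc n)) < \<epsilon>" using reals_Archimedean by blast
    have "K \<subseteq> G n (N n)" by (auto simp: K_def)
    also have "\<dots> \<subseteq> (\<Union>x\<in>c ` {..N n}. ball x \<epsilon>)" using n by (force simp: G_def)
    finally show "\<exists>F. finite F \<and> K \<subseteq> (\<Union>x\<in>F. ball x \<epsilon>)" by blast
  qed
  ultimately have "compact K" by simp
  moreover have "prob {\<omega> \<in> space M. X \<omega> \<in> K} \<ge> 1 - p"
  proof -
    have sm: "summable (\<lambda>n. p / 2 * (1/2) ^ n)" by (intro summable_mult summable_geometric) simp
    have le: "prob (space M - A n (N n)) \<le> p / 2 * (1/2) ^ n" for n
      using N[of n] prob_compl[of "A n (N n)"] by simp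
    have sm': "summable (\<lambda>n. prob (space M - A n (N n)))"
      by (rule summable_comparison_test'[OF sm, of 0]) (use le in auto)
    have "prob (\<Union>n. space M - A n (N n)) \<le> (\<Sum>n. prob (space M - A n (N n)))"
      by (intro finite_measure_subadditive_countably sm') auto
    also have "\<dots> \<le> (\<Sum>n. p / 2 * (1/2) ^ n)" by (intro suminf_le le sm sm')
    also have "\<dots> = p / 2 * (\<Sum>n. (1/2) ^ n)"
      by (intro suminf_mult summable_geometric) simp
    also have "\<dots> = p" by (simp add: suminf_geometric)
    finally have "prob (\<Union>n. space M - A n (N n)) \<le> p" .
    moreover have "space M - {\<omega> \<in> space M. X \<omega> \<in> K} = (\<Union>n. space M - A n (N n))"
      by (auto simp: K_def A_def)
    moreover have "{\<omega> \<in> space M. X \<omega> \<in> K} \<in> sets M"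
    proof -
      have [measurable]: "K \<in> sets borel" unfolding K_def by measurable
      show ?thesis by measurable
    qed
    ultimately show ?thesis using prob_compl[of "{\<omega> \<in> space M. X \<omega> \<in> K}"] by simp
  qed
  ultimately show thesis by (rule that)
qed

lemma (in prob_space) normal_second_moment:
  assumes \<sigma>: "\<sigma> > 0" and Y: "distributed M lborel Y (normal_density m \<sigma>)"
  shows "(\<integral>\<^sup>+\<omega>. ennreal ((Y \<omega>)\<^sup>2) \<partial>M) = ennreal (\<sigma>\<^sup>2 + m\<^sup>2)" and "integrable M Y" "integrable M (\<lambda>\<omega>. (Y \<omega>)\<^sup>2)"
    and "expectation (\<lambda>\<omega>. (Y \<omega>)\<^sup>2) = \<sigma>\<^sup>2 + m\<^sup>2"
proof -
  have nn: "0 \<le> normal_density m \<sigma> x" for x by (simp add: normal_density_nonneg)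
  show int: "integrable M Y"
    using distributed_integrable_var[OF Y nn] integrable_normal_moment_nz_1[OF \<sigma>] by simp
  have int2: "integrable M (\<lambda>\<omega>. (Y \<omega> - m)\<^sup>2)"
    using distributed_integrable[OF Y, of "\<lambda>x. (x - m)\<^sup>2"] nn integrable_normal_moment[OF \<sigma>, of m 2] by simp
  have "integrable M (\<lambda>\<omega>. (Y \<omega> - m)\<^sup>2 + 2 * m * Y \<omega> - m\<^sup>2)"
    using int int2 by (intro Bochner_Integration.integrable_diff Bochner_Integration.integrable_add) auto
  also have "(\<lambda>\<omega>. (Y \<omega> - m)\<^sup>2 + 2 * m * Y \<omega> - m\<^sup>2) = (\<lambda>\<omega>. (Y \<omega>)\<^sup>2)"
    by (auto simp: power2_eq_square algebra_simps)
  finally show sq: "integrable M (\<lambda>\<omega>. (Y \<omega>)\<^sup>2)" .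
  show E: "expectation (\<lambda>\<omega>. (Y \<omega>)\<^sup>2) = \<sigma>\<^sup>2 + m\<^sup>2"
    using variance_eq[OF int sq] normal_distributed_variance[OF \<sigma> Y] normal_distributed_expectation[OF \<sigma> Y]
    by simp
  show "(\<integral>\<^sup>+\<omega>. ennreal ((Y \<omega>)\<^sup>2) \<partial>M) = ennreal (\<sigma>\<^sup>2 + m\<^sup>2)"
    using nn_integral_eq_integral[OF sq] E by simp
qed

lemma (in prob_space) real_gaussian_second_moment_finite:
  assumes "real_gaussian M Y"
  shows "(\<integral>\<^sup>+\<omega>. ennreal ((Y \<omega>)\<^sup>2) \<partial>M) < \<infinity>"
proof -
  obtain m where "(AE \<omega> in M. Y \<omega> = m) \<or> (\<exists>\<sigma>>0. distributed M lborel Y (normal_density m \<sigma>))"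
    using assms by (auto simp: real_gaussian_def)
  then show ?thesis
  proof
    assume "AE \<omega> in M. Y \<omega> = m"
    then have "(\<integral>\<^sup>+\<omega>. ennreal ((Y \<omega>)\<^sup>2) \<partial>M) = (\<integral>\<^sup>+\<omega>. ennreal (m\<^sup>2) \<partial>M)"
      by (intro nn_integral_cong_AE) auto
    then show ?thesis by (simp add: emeasure_space_1)
  qed (auto simp: normal_second_moment(1))
qed

text \<open>
  The density is at most 1 / (\<sigma> sqrt (2 \<pi>)), so \<sigma> cannot be large; then Chebyshev's inequality
  bounds the mean.
\<close>

lemma (in prob_space) real_gaussian_second_moment_le:
  assumes Y: "real_gaussian M Y" and p: "prob {\<omega> \<in> space M. \<bar>Y \<omega>\<bar> \<le> 1} \<ge> 3/4"
  shows "(\<integral>\<^sup>+\<omega>. ennreal ((Y \<omega>)\<^sup>2) \<partial>M) \<le> ennreal 29"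
proof -
  have [measurable]: "Y \<in> borel_measurable M" using Y by (simp add: real_gaussian_def)
  obtain m where "(AE \<omega> in M. Y \<omega> = m) \<or> (\<exists>\<sigma>>0. distributed M lborel Y (normal_density m \<sigma>))"
    using Y by (auto simp: real_gaussian_def)
  then show ?thesis
  proof
    assume m: "AE \<omega> in M. Y \<omega> = m"
    have "\<bar>m\<bar> \<le> 1"
    proof (rule ccontr)
      assume "\<not> \<bar>m\<bar> \<le> 1"
      with m have "AE \<omega> in M. \<not> \<bar>Y \<omega>\<bar> \<le> 1" by auto
      then have "prob {\<omega> \<in> space M. \<bar>Y \<omega>\<bar> \<le> 1} = 0" by (subst prob_Collect_eq_0) auto
      with p show False by simp
    qed
    then have "m\<^sup>2 \<le> 1" by (simp add: abs_square_le_1)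
    from m have "(\<integral>\<^sup>+\<omega>. ennreal ((Y \<omega>)\<^sup>2) \<partial>M) = (\<integral>\<^sup>+\<omega>. ennreal (m\<^sup>2) \<partial>M)"
      by (intro nn_integral_cong_AE) auto
    also have "\<dots> = ennreal (m\<^sup>2)" by (simp add: emeasure_space_1)
    also have "\<dots> \<le> ennreal 29" using \<open>m\<^sup>2 \<le> 1\<close> by (intro ennreal_leI) simp
    finally show ?thesis .
  next
    assume "\<exists>\<sigma>>0. distributed M lborel Y (normal_density m \<sigma>)"
    then obtain \<sigma> where \<sigma>: "\<sigma> > 0" and D: "distributed M lborel Y (normal_density m \<sigma>)" by auto
    have "emeasure M (Y -` {-1..1} \<inter> space M) = (\<integral>\<^sup>+x. ennreal (normal_density m \<sigma> x) * indicator {-1..1} x \<partial>lborel)"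
      by (rule distributed_emeasure[OF D]) simp
    also have "\<dots> \<le> (\<integral>\<^sup>+x. ennreal (1 / sqrt (2 * pi * \<sigma>\<^sup>2)) * indicator {-1..1::real} x \<partial>lborel)"
      by (intro nn_integral_mono mult_right_mono ennreal_leI) (auto simp: normal_density_def divide_right_mono)
    also have "\<dots> = ennreal (1 / sqrt (2 * pi * \<sigma>\<^sup>2)) * ennreal 2"
      by (simp add: nn_integral_cmult)
    also have "\<dots> = ennreal (2 / sqrt (2 * pi * \<sigma>\<^sup>2))"
      by (subst ennreal_mult'[symmetric]) auto
    also have "Y -` {-1..1} \<inter> space M = {\<omega> \<in> space M. \<bar>Y \<omega>\<bar> \<le> 1}"
      by (auto simp: abs_le_iff)
    finally have "prob {\<omega> \<in> space M. \<bar>Y \<omega>\<bar> \<le> 1} \<le> 2 / sqrt (2 * pi * \<sigma>\<^sup>2)"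
      by (simp add: emeasure_eq_measure ennreal_le_iff)
    with p have "3/4 \<le> 2 / sqrt (2 * pi * \<sigma>\<^sup>2)" by linarith
    \<comment> \<open>As \<pi> > 3, squaring gives 6 \<sigma>^2 \<le> 64/9, which is more than
      enough for \<sigma> \<le> 2.\<close>
    then have "sqrt (2 * pi * \<sigma>\<^sup>2) \<le> 8/3"
      using \<sigma> by (simp add: field_simps)
    then have "2 * pi * \<sigma>\<^sup>2 \<le> (8/3)\<^sup>2" by (rule sqrt_le_D)
    then have "\<sigma>\<^sup>2 \<le> 2\<^sup>2"
    proof -
      have "2 * 3 * \<sigma>\<^sup>2 \<le> 2 * pi * \<sigma>\<^sup>2" using pi_gt3 by (intro mult_right_mono) auto
      with \<open>2 * pi * \<sigma>\<^sup>2 \<le> (8/3)\<^sup>2\<close> have "2 * 3 * \<sigma>\<^sup>2 \<le> (8/3)\<^sup>2" by (rule order_trans[rotated])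
      then show ?thesis by (simp add: power2_eq_square)
    qed
    then have \<sigma>2: "\<sigma> \<le> 2" by (rule power2_le_imp_le) simp
    \<comment> \<open>Otherwise |Y| \<le> 1 would force Y to be at least 2 \<sigma> away from its
      mean, an event of probability at most 1/4.\<close>
    have "\<bar>m\<bar> \<le> 1 + 2 * \<sigma>"
    proof (rule ccontr)
      assume *: "\<not> ?thesis"
      have "prob {\<omega> \<in> space M. \<bar>Y \<omega>\<bar> \<le> 1} \<le> prob {\<omega> \<in> space M. 2 * \<sigma> \<le> \<bar>Y \<omega> - m\<bar>}"
        using * by (intro finite_measure_mono) auto
      also have "\<dots> \<le> variance Y / (2 * \<sigma>)\<^sup>2"
        using Chebyshev_inequality[of Y "2 * \<sigma>"] normal_second_moment(3)[OF \<sigma> D] \<sigma>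
          normal_distributed_expectation[OF \<sigma> D] by simp
      also have "\<dots> = 1/4"
        using normal_distributed_variance[OF \<sigma> D] \<sigma> by (simp add: power2_eq_square)
      finally show False using p by simp
    qed
    then have "\<bar>m\<bar> \<le> 5" using \<sigma>2 by linarith
    then have "m\<^sup>2 \<le> 5\<^sup>2" by (rule abs_le_square_iff[THEN iffD1, of m 5, simplified abs_numeral])
    \<comment> \<open>29 = 2^2 + 5^2, from \<sigma> \<le> 2 and |m| \<le> 1 + 2 \<sigma> \<le>
      5.\<close>
    then have "\<sigma>\<^sup>2 + m\<^sup>2 \<le> 29" using \<open>\<sigma>\<^sup>2 \<le> 2\<^sup>2\<close> by simp
    then show ?thesis unfolding normal_second_moment(1)[OF \<sigma> D] by (rule ennreal_leI)
  qed
qed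

text \<open>Cauchy--Schwarz in coordinates on the span of the system, then passage to the closure by
  continuity of l. It identifies the series of squared coordinates as a bound for the squared norm
  of l.\<close>

lemma complete_orthonormal_functional_bound:
  fixes e :: "nat \<Rightarrow> 'h::real_inner" and l :: "'h \<Rightarrow> real"
  assumes e: "complete_orthonormal K e" and l: "bounded_linear l"
  shows "ennreal ((l h)\<^sup>2) \<le> (\<Sum>k. ennreal ((l (e k))\<^sup>2) * indicator K k) * ennreal ((norm h)\<^sup>2)"
proof (cases "\<Sum>k. ennreal ((l (e k))\<^sup>2) * indicator K k")
  case (real c)
  have on: "e k \<bullet> e l = (if k = l then 1 else 0)" if "k \<in> K" "l \<in> K" for k l
    using e that by (simp add: complete_orthonormal_def)
  define V where "V = {h. (l h)\<^sup>2 \<le> c * (norm h)\<^sup>2}"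
  have "span (e ` K) \<subseteq> V"
  proof
    fix h assume "h \<in> span (e ` K)"
    then obtain t r where t: "finite t" "t \<subseteq> e ` K" "h = (\<Sum>v\<in>t. r v *\<^sub>R v)"
      unfolding span_explicit by blast
    obtain F where F: "F \<subseteq> K" "inj_on e F" "t = e ` F"
      using t(2) by (auto simp: subset_image_inj)
    have fF: "finite F" using t(1) F by (simp add: finite_image_iff)
    define a where "a k = r (e k)" for k
    have h: "h = (\<Sum>k\<in>F. a k *\<^sub>R e k)"
      unfolding t(3) F(3) by (subst sum.reindex[OF F(2)]) (simp add: a_def)
    have "(norm h)\<^sup>2 = (\<Sum>k\<in>F. \<Sum>j\<in>F. a k * a j * (e k \<bullet> e j))"
      unfolding power2_norm_eq_inner h
      by (simp add: inner_sum_left inner_sum_right sum_distrib_left mult.assoc mult.left_commute inner_commute)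
    also have "\<dots> = (\<Sum>k\<in>F. \<Sum>j\<in>F. if k = j then (a k)\<^sup>2 else 0)"
      using F(1) by (intro sum.cong) (auto simp: on power2_eq_square subset_iff)
    also have "\<dots> = (\<Sum>k\<in>F. (a k)\<^sup>2)" using fF by simp
    finally have nh: "(norm h)\<^sup>2 = (\<Sum>k\<in>F. (a k)\<^sup>2)" .
    have "l h = (\<Sum>k\<in>F. a k * l (e k))"
      unfolding h using l by (simp add: linear_sum linear_scale bounded_linear.linear)
    then have "(l h)\<^sup>2 \<le> (norm h)\<^sup>2 * (\<Sum>k\<in>F. (l (e k))\<^sup>2)"
      unfolding nh using Cauchy_Schwarz_ineq_sum[of a "\<lambda>k. l (e k)" F] by simp
    also have "\<dots> \<le> (norm h)\<^sup>2 * c"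
    proof (rule mult_left_mono)
      show "(\<Sum>k\<in>F. (l (e k))\<^sup>2) \<le> c"
    proof -
      have "ennreal (\<Sum>k\<in>F. (l (e k))\<^sup>2) = (\<Sum>k\<in>F. ennreal ((l (e k))\<^sup>2) * indicator K k)"
      proof -
        have "(\<Sum>k\<in>F. ennreal ((l (e k))\<^sup>2) * indicator K k) = (\<Sum>k\<in>F. ennreal ((l (e k))\<^sup>2))"
          using F(1) by (intro sum.cong) auto
        then show ?thesis by simp
      qed
      also have "\<dots> \<le> ennreal c"
        unfolding real(2)[symmetric] using fF by (intro sum_le_suminf) auto
      finally show ?thesis using real(1) by (simp add: ennreal_le_iff)
    qed
    qed simp
    finally have "(l h)\<^sup>2 \<le> (norm h)\<^sup>2 * c" .
    then show "h \<in> V" by (simp add: V_def mult.commute)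
  qed
  moreover have "closed V"
    unfolding V_def using l
    by (intro closed_Collect_le continuous_intros linear_continuous_on)
  ultimately have "closure (span (e ` K)) \<subseteq> V" by (rule closure_minimal)
  then have "h \<in> V" using e by (auto simp: complete_orthonormal_def)
  then show ?thesis using real by (simp add: V_def ennreal_leI flip: ennreal_mult)
next
  case top
  show ?thesis
  \<comment> \<open>The product of \<infinity> and 0 is 0 here, so h = 0 rests on l(0) = 0; for
    other h the right-hand side is infinite.\<close>
  proof (cases "h = 0")
    case True
    then show ?thesis using linear_0[OF bounded_linear.linear[OF l]] by simp
  qed (simp add: top ennreal_top_mult)
qed

section \<open>Covariances of Brownian increments and the isometry for step functions\<close>

lemma (in prob_space) brownian_increment:
  assumes \<beta>: "brownian_motion M \<beta>" and st: "0 \<le> s" "s \<le> t"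
  shows "has_bochner_integral M (\<lambda>\<omega>. \<beta> t \<omega> - \<beta> s \<omega>) 0"
    and "has_bochner_integral M (\<lambda>\<omega>. (\<beta> t \<omega> - \<beta> s \<omega>) * (\<beta> t \<omega> - \<beta> s \<omega>)) (t - s)"
proof -
  consider "s = t" | "s < t" using st by linarith
  then have "has_bochner_integral M (\<lambda>\<omega>. \<beta> t \<omega> - \<beta> s \<omega>) 0 \<and>
      has_bochner_integral M (\<lambda>\<omega>. (\<beta> t \<omega> - \<beta> s \<omega>)\<^sup>2) (t - s)"
  proof cases
    case 2
    then have D: "distributed M lborel (\<lambda>\<omega>. \<beta> t \<omega> - \<beta> s \<omega>) (normal_density 0 (sqrt (t - s)))"
      and \<sigma>: "sqrt (t - s) > 0" using \<beta> st by (auto simp: brownian_motion_def)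
    show ?thesis
      using normal_second_moment(2-4)[OF \<sigma> D] normal_distributed_expectation[OF \<sigma> D] 2
      by (simp add: has_bochner_integral_iff)
  qed (simp add: has_bochner_integral_zero)
  then show "has_bochner_integral M (\<lambda>\<omega>. \<beta> t \<omega> - \<beta> s \<omega>) 0"
    "has_bochner_integral M (\<lambda>\<omega>. (\<beta> t \<omega> - \<beta> s \<omega>) * (\<beta> t \<omega> - \<beta> s \<omega>)) (t - s)"
    by (auto simp: power2_eq_square)
qed

lemma (in prob_space) indep_vars_mult_has_integral:
  fixes X :: "'i \<Rightarrow> 'a \<Rightarrow> real"
  assumes "indep_vars (\<lambda>_. borel) X I" "finite I" "\<And>i. i \<in> I \<Longrightarrow> has_bochner_integral M (X i) 0"
    and ij: "i \<in> I" "j \<in> I" "i \<noteq> j"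
  shows "has_bochner_integral M (\<lambda>\<omega>. X i \<omega> * X j \<omega>) 0"
proof -
  have ind: "indep_vars (\<lambda>_. borel) X {i, j}"
    using indep_vars_subset[OF assms(1)] ij by simp
  have int: "integrable M (X k)" "expectation (X k) = 0" if "k \<in> {i, j}" for k
    using assms(3)[of k] ij that by (auto simp: has_bochner_integral_iff)
  show ?thesis
    using indep_vars_lebesgue_integral[OF _ ind] indep_vars_integrable[OF _ ind] int ij(3)
    by (simp add: has_bochner_integral_iff)
qed

text \<open>For s \<le> t the later value is the earlier one plus an independent increment. Values
  are taken relative to \<beta>(0), since \<beta>(0) = 0 holds only almost surely.\<close>

lemma (in prob_space) brownian_covariance:
  assumes \<beta>: "brownian_motion M \<beta>" and st: "0 \<le> s" "0 \<le> t"
  shows "has_bochner_integral M (\<lambda>\<omega>. (\<beta> s \<omega> - \<beta> 0 \<omega>) * (\<beta> t \<omega> - \<beta> 0 \<omega>)) (min s t)"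
proof -
  have *: "has_bochner_integral M (\<lambda>\<omega>. (\<beta> s \<omega> - \<beta> 0 \<omega>) * (\<beta> t \<omega> - \<beta> 0 \<omega>)) s" if st: "0 \<le> s" "s \<le> t" for s t
  proof -
    have "has_bochner_integral M (\<lambda>\<omega>. (\<beta> s \<omega> - \<beta> 0 \<omega>) * (\<beta> t \<omega> - \<beta> s \<omega>)) 0"
    \<comment> \<open>Independence is provided along strictly increasing times only; in the
      degenerate cases one factor is identically 0.\<close>
    proof (cases "0 < s \<and> s < t")
      case True
      define \<tau> where "\<tau> i = (if i = 0 then 0 else if i = 1 then s else t)" for i :: nat
      have "strict_mono_on {..2} \<tau>"
        using True by (auto simp: strict_mono_on_def \<tau>_def)
      then have ind: "indep_vars (\<lambda>_. borel) (\<lambda>i \<omega>. \<beta> (\<tau> (Suc i)) \<omega> - \<beta> (\<tau> i) \<omega>) {..<2}"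
      proof -
        have "0 \<le> \<tau> 0" by (simp add: \<tau>_def)
        with \<beta> \<open>strict_mono_on {..2} \<tau>\<close> show ?thesis unfolding brownian_motion_def by blast
      qed
      have "has_bochner_integral M (\<lambda>\<omega>. (\<beta> (\<tau> (Suc 0)) \<omega> - \<beta> (\<tau> 0) \<omega>) * (\<beta> (\<tau> (Suc 1)) \<omega> - \<beta> (\<tau> 1) \<omega>)) 0"
      proof (rule indep_vars_mult_has_integral[OF ind])
        fix i :: nat assume "i \<in> {..<2}"
        then show "has_bochner_integral M (\<lambda>\<omega>. \<beta> (\<tau> (Suc i)) \<omega> - \<beta> (\<tau> i) \<omega>) 0"
          using True by (intro brownian_increment(1)[OF \<beta>]) (auto simp: \<tau>_def)
      qed auto
      then show ?thesis by (simp add: \<tau>_def)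
    qed (use st in \<open>auto simp: has_bochner_integral_zero\<close>)
    from has_bochner_integral_add[OF brownian_increment(2)[OF \<beta> _ st(1)] this]
    show ?thesis by (simp add: algebra_simps)
  qed
  show ?thesis
  proof (cases "s \<le> t")
    case True
    with *[of s t] st show ?thesis by (simp add: min_def)
  next
    case False
    with *[of t s] st show ?thesis by (simp add: min_def mult.commute)
  qed
qed

text \<open>Expanding into four covariances avoids case distinctions on how the two intervals lie.
  For a \<le> b and c \<le> d the value is the length of their overlap.\<close>

lemma (in prob_space) brownian_increments_covariance:
  assumes \<beta>: "brownian_motion M \<beta>" and nn: "0 \<le> a" "0 \<le> b" "0 \<le> c" "0 \<le> d"
  shows "has_bochner_integral M (\<lambda>\<omega>. (\<beta> b \<omega> - \<beta> a \<omega>) * (\<beta> d \<omega> - \<beta> c \<omega>))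
    (min b d - min b c - min a d + min a c)"
proof -
  have "has_bochner_integral M (\<lambda>\<omega>.
      (\<beta> b \<omega> - \<beta> 0 \<omega>) * (\<beta> d \<omega> - \<beta> 0 \<omega>) - (\<beta> b \<omega> - \<beta> 0 \<omega>) * (\<beta> c \<omega> - \<beta> 0 \<omega>) -
      (\<beta> a \<omega> - \<beta> 0 \<omega>) * (\<beta> d \<omega> - \<beta> 0 \<omega>) + (\<beta> a \<omega> - \<beta> 0 \<omega>) * (\<beta> c \<omega> - \<beta> 0 \<omega>))
    (min b d - min b c - min a d + min a c)"
    using nn by (intro has_bochner_integral_add has_bochner_integral_diff brownian_covariance[OF \<beta>])
  then show ?thesis by (simp add: algebra_simps)
qed

text \<open>The value is written exactly like the covariance of Brownian increments over the same
  intervals; this agreement is the isometry for step functions.\<close>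

lemma has_integral_indicator_mult:
  assumes "a \<le> b" "c \<le> (d::real)"
  shows "has_bochner_integral lborel (\<lambda>s. indicator {a<..b} s * indicator {c<..d} s :: real)
    (min b d - min b c - min a d + min a c)"
proof -
  let ?A = "{max a c<..min b d}"
  have "emeasure lborel ?A = ennreal (min b d - min b c - min a d + min a c)"
  proof (cases "max a c \<le> min b d")
    case True
    then have "min b d - max a c = min b d - min b c - min a d + min a c"
      using assms by (auto simp: min_def max_def split: if_splits)
    with emeasure_lborel_Ioc[OF True] show ?thesis by simp
  next
    case False
    then have "?A = {}" "min b d - min b c - min a d + min a c = 0"
      using assms by (auto simp: min_def max_def split: if_splits)
    then show ?thesis by simp
  qed
  moreover have "min b d - min b c - min a d + min a c \<ge> 0" using assms by (auto simp: min_def)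
  ultimately have "has_bochner_integral lborel (indicator ?A :: real \<Rightarrow> real)
      (min b d - min b c - min a d + min a c)"
    using has_bochner_integral_real_indicator[of ?A lborel] by (simp add: measure_def)
  also have "(indicator {max a c<..min b d} :: real \<Rightarrow> real) = (\<lambda>s. indicator {a<..b} s * indicator {c<..d} s)"
    by (auto simp: indicator_def fun_eq_iff)
  finally show ?thesis .
qed

lemma has_bochner_integral_sum_list_mult:
  fixes f g :: "'x \<Rightarrow> 'a \<Rightarrow> real"
  assumes "\<And>x y. x \<in> set xs \<Longrightarrow> y \<in> set ys \<Longrightarrow> has_bochner_integral M (\<lambda>\<omega>. f x \<omega> * g y \<omega>) (G x y)"
  shows "has_bochner_integral M (\<lambda>\<omega>. (\<Sum>x\<leftarrow>xs. f x \<omega>) * (\<Sum>y\<leftarrow>ys. g y \<omega>)) (\<Sum>x\<leftarrow>xs. \<Sum>y\<leftarrow>ys. G x y)"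
proof -
  have *: "has_bochner_integral M (\<lambda>\<omega>. f x \<omega> * (\<Sum>y\<leftarrow>zs. g y \<omega>)) (\<Sum>y\<leftarrow>zs. G x y)"
    if "x \<in> set xs" "set zs \<subseteq> set ys" for x zs
    using that(2)
  proof (induction zs)
    case (Cons z zs)
    then have "has_bochner_integral M (\<lambda>\<omega>. f x \<omega> * g z \<omega> + f x \<omega> * (\<Sum>y\<leftarrow>zs. g y \<omega>)) (G x z + (\<Sum>y\<leftarrow>zs. G x y))"
      using assms that(1) by (intro has_bochner_integral_add) auto
    then show ?case by (simp add: distrib_left)
  qed (simp add: has_bochner_integral_zero)
  have "has_bochner_integral M (\<lambda>\<omega>. (\<Sum>x\<leftarrow>zs. f x \<omega>) * (\<Sum>y\<leftarrow>ys. g y \<omega>)) (\<Sum>x\<leftarrow>zs. \<Sum>y\<leftarrow>ys. G x y)"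
    if "set zs \<subseteq> set xs" for zs
    using that
  proof (induction zs)
    case (Cons z zs)
    then have "has_bochner_integral M (\<lambda>\<omega>. f z \<omega> * (\<Sum>y\<leftarrow>ys. g y \<omega>) + (\<Sum>x\<leftarrow>zs. f x \<omega>) * (\<Sum>y\<leftarrow>ys. g y \<omega>))
        ((\<Sum>y\<leftarrow>ys. G z y) + (\<Sum>x\<leftarrow>zs. \<Sum>y\<leftarrow>ys. G x y))"
      by (intro has_bochner_integral_add *) auto
    then show ?case by (simp add: distrib_right)
  qed (simp add: has_bochner_integral_zero)
  then show ?thesis by simp
qed

lemma (in prob_space) cylindrical_wiener_increments_uncorrelated:
  assumes W: "cylindrical_wiener M K e \<beta>" and kl: "k \<in> K" "l \<in> K" "k \<noteq> l"
    and ab: "0 \<le> a" "a \<le> b" and cd: "0 \<le> c" "c \<le> d"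
  shows "has_bochner_integral M (\<lambda>\<omega>. (\<beta> k b \<omega> - \<beta> k a \<omega>) * (\<beta> l d \<omega> - \<beta> l c \<omega>)) 0"
proof -
  have \<beta>: "brownian_motion M (\<beta> k)" "brownian_motion M (\<beta> l)"
    and ind: "indep_vars (\<lambda>_. PiM {0..} (\<lambda>_. borel)) (\<lambda>k \<omega>. \<lambda>t\<in>{0..}. \<beta> k t \<omega>) K"
    using W kl by (auto simp: cylindrical_wiener_def)
  \<comment> \<open>Y extracts from a whole path the increment needed from it, over [a,b] for index
    k and over [c,d] otherwise, so independence of the paths passes to the increments.\<close>
  define Y where "Y i f = (if i = k then f b - f a else f d - f c)" for i and f :: "real \<Rightarrow> real"
  have "indep_vars (\<lambda>_. borel) (\<lambda>i \<omega>. Y i (\<lambda>t\<in>{0..}. \<beta> i t \<omega>)) {k, l}"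
  proof (rule indep_vars_compose2[OF indep_vars_subset[OF ind]])
    have comp: "(\<lambda>f. f t) \<in> borel_measurable (PiM {0..} (\<lambda>_. borel :: real measure))" if "t \<ge> 0" for t :: real
      using that by (intro measurable_component_singleton) auto
    show "Y i \<in> borel_measurable (PiM {0..} (\<lambda>_. borel))" for i
      unfolding Y_def using ab cd comp[of a] comp[of b] comp[of c] comp[of d]
      by (cases "i = k") (auto intro!: borel_measurable_diff)
  qed (use kl in auto)
  then have "has_bochner_integral M (\<lambda>\<omega>. Y k (\<lambda>t\<in>{0..}. \<beta> k t \<omega>) * Y l (\<lambda>t\<in>{0..}. \<beta> l t \<omega>)) 0"
    by (rule indep_vars_mult_has_integral)
       (use kl ab cd brownian_increment(1)[OF \<beta>(1) ab] brownian_increment(1)[OF \<beta>(2) cd] in \<open>auto simp: Y_def\<close>)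
  then show ?thesis using kl(3) ab cd by (simp add: Y_def)
qed

lemma nn_integral_eq_has_bochner_integral:
  "has_bochner_integral M f x \<Longrightarrow> (\<And>y. f y \<ge> 0) \<Longrightarrow> (\<integral>\<^sup>+y. ennreal (f y) \<partial>M) = ennreal x"
  by (simp add: has_bochner_integral_iff nn_integral_eq_integral)

text \<open>The Ito isometry for finitely many independent Brownian motions: the diagonal terms are
  the integrals of the squared step functions over the line, and the cross terms vanish. Restricting
  the line to [0,t] leaves an inequality.\<close>

lemma (in prob_space) step_integrals_second_moment:
  assumes W: "cylindrical_wiener M K e \<beta>" and F: "finite F" "F \<subseteq> K"
    and xs: "\<And>k. k \<in> F \<Longrightarrow> step_valid t (xs k)"
  shows "(\<Sum>k\<in>F. L2norm_sq t (step_fun (xs k))) \<le>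
    (\<integral>\<^sup>+\<omega>. ennreal ((\<Sum>k\<in>F. step_integral (\<beta> k) (xs k) \<omega>)\<^sup>2) \<partial>M)"
proof -
  \<comment> \<open>The common Gram kernel: the covariance of two weighted increments and also the
    integral of the product of two weighted indicators.\<close>
  define G where "G = (\<lambda>(a, b, c) (a', b', c').
    c * c' * (min b b' - min b a' - min a b' + min a a' :: real))"
  define J where "J k = (\<Sum>x\<leftarrow>xs k. \<Sum>y\<leftarrow>xs k. G x y)" for k
  have valid: "0 \<le> a \<and> a \<le> b" if "(a, b, c) \<in> set (xs k)" "k \<in> F" for a b c k
    using xs[OF that(2)] that(1) by (auto simp: step_valid_def)
  have bm: "brownian_motion M (\<beta> k)" if "k \<in> F" for k
    using W F(2) that by (auto simp: cylindrical_wiener_def)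
  have diag: "has_bochner_integral M (\<lambda>\<omega>. step_integral (\<beta> k) (xs k) \<omega> * step_integral (\<beta> k) (xs k) \<omega>) (J k)"
    if k: "k \<in> F" for k
    unfolding step_integral_def J_def
  proof (rule has_bochner_integral_sum_list_mult)
    fix x y assume xy: "x \<in> set (xs k)" "y \<in> set (xs k)"
    obtain a b c a' b' c' where eq: "x = (a, b, c)" "y = (a', b', c')" by (cases x, cases y)
    have "has_bochner_integral M (\<lambda>\<omega>. c * c' * ((\<beta> k b \<omega> - \<beta> k a \<omega>) * (\<beta> k b' \<omega> - \<beta> k a' \<omega>)))
        (c * c' * (min b b' - min b a' - min a b' + min a a'))"
      using valid[of a b c k] valid[of a' b' c' k] xy k
      by (intro has_bochner_integral_mult_right brownian_increments_covariance[OF bm]) (auto simp: eq)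
    then show "has_bochner_integral M (\<lambda>\<omega>. (case x of (a, b, c) \<Rightarrow> c * (\<beta> k b \<omega> - \<beta> k a \<omega>)) *
        (case y of (a, b, c) \<Rightarrow> c * (\<beta> k b \<omega> - \<beta> k a \<omega>))) (G x y)"
      by (simp add: eq G_def mult_ac)
  qed
  have step: "has_bochner_integral lborel (\<lambda>s. step_fun (xs k) s * step_fun (xs k) s) (J k)"
    if k: "k \<in> F" for k
    unfolding step_fun_def J_def
  proof (rule has_bochner_integral_sum_list_mult)
    fix x y assume xy: "x \<in> set (xs k)" "y \<in> set (xs k)"
    obtain a b c a' b' c' where eq: "x = (a, b, c)" "y = (a', b', c')" by (cases x, cases y)
    have "has_bochner_integral lborel (\<lambda>s. c * c' * (indicator {a<..b} s * indicator {a'<..b'} s))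
        (c * c' * (min b b' - min b a' - min a b' + min a a'))"
      using valid[of a b c k] valid[of a' b' c' k] xy k
      by (intro has_bochner_integral_mult_right has_integral_indicator_mult) (auto simp: eq)
    then show "has_bochner_integral lborel (\<lambda>s. (case x of (a, b, c) \<Rightarrow> c * indicator {a<..b} s) *
        (case y of (a, b, c) \<Rightarrow> c * indicator {a<..b} s)) (G x y)"
      by (simp add: eq G_def mult_ac)
  qed
  have cross: "has_bochner_integral M (\<lambda>\<omega>. step_integral (\<beta> k) (xs k) \<omega> * step_integral (\<beta> l) (xs l) \<omega>) 0"
    if kl: "k \<in> F" "l \<in> F" "k \<noteq> l" for k l
  proof -
    have "has_bochner_integral M (\<lambda>\<omega>. step_integral (\<beta> k) (xs k) \<omega> * step_integral (\<beta> l) (xs l) \<omega>)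
        (\<Sum>x\<leftarrow>xs k. \<Sum>y\<leftarrow>xs l. 0)"
      unfolding step_integral_def
    proof (rule has_bochner_integral_sum_list_mult)
      fix x y assume xy: "x \<in> set (xs k)" "y \<in> set (xs l)"
      obtain a b c a' b' c' where eq: "x = (a, b, c)" "y = (a', b', c')" by (cases x, cases y)
      have "has_bochner_integral M (\<lambda>\<omega>. c * c' * ((\<beta> k b \<omega> - \<beta> k a \<omega>) * (\<beta> l b' \<omega> - \<beta> l a' \<omega>)))
          (c * c' * 0)"
        using valid[of a b c k] valid[of a' b' c' l] xy kl F(2)
        by (intro has_bochner_integral_mult_right cylindrical_wiener_increments_uncorrelated[OF W])
           (auto simp: eq)
      then show "has_bochner_integral M (\<lambda>\<omega>. (case x of (a, b, c) \<Rightarrow> c * (\<beta> k b \<omega> - \<beta> k a \<omega>)) *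
          (case y of (a, b, c) \<Rightarrow> c * (\<beta> l b \<omega> - \<beta> l a \<omega>))) 0"
        by (simp add: eq mult_ac)
    qed
    then show ?thesis by (simp add: sum_list_triv)
  qed
  have "has_bochner_integral M (\<lambda>\<omega>. \<Sum>k\<in>F. \<Sum>l\<in>F. step_integral (\<beta> k) (xs k) \<omega> * step_integral (\<beta> l) (xs l) \<omega>)
      (\<Sum>k\<in>F. \<Sum>l\<in>F. if k = l then J k else 0)"
    using diag cross by (intro has_bochner_integral_sum) auto
  also have "(\<Sum>k\<in>F. \<Sum>l\<in>F. if k = l then J k else 0) = (\<Sum>k\<in>F. J k)"
    using F(1) by simp
  also have "(\<lambda>\<omega>. \<Sum>k\<in>F. \<Sum>l\<in>F. step_integral (\<beta> k) (xs k) \<omega> * step_integral (\<beta> l) (xs l) \<omega>) =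
      (\<lambda>\<omega>. (\<Sum>k\<in>F. step_integral (\<beta> k) (xs k) \<omega>)\<^sup>2)"
    by (simp add: power2_eq_square sum_product)
  finally have "(\<integral>\<^sup>+\<omega>. ennreal ((\<Sum>k\<in>F. step_integral (\<beta> k) (xs k) \<omega>)\<^sup>2) \<partial>M) = ennreal (\<Sum>k\<in>F. J k)"
    by (intro nn_integral_eq_has_bochner_integral) auto
  moreover have J: "(\<integral>\<^sup>+s. ennreal (step_fun (xs k) s * step_fun (xs k) s) \<partial>lborel) = ennreal (J k)"
    if "k \<in> F" for k
    using step[OF that] by (intro nn_integral_eq_has_bochner_integral) auto
  moreover have "J k \<ge> 0" if "k \<in> F" for k
  proof -
    have "0 \<le> (LBINT s. step_fun (xs k) s * step_fun (xs k) s)"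
      by (rule Bochner_Integration.integral_nonneg) simp
    also have "\<dots> = J k" using step[OF that] by (rule has_bochner_integral_integral_eq)
    finally show ?thesis .
  qed
  moreover have "L2norm_sq t (step_fun (xs k)) \<le> ennreal (J k)" if "k \<in> F" for k
    unfolding J[OF that, symmetric] L2norm_sq_def
    by (intro nn_integral_mono) (auto simp: indicator_def power2_eq_square)
  ultimately show ?thesis by (simp add: sum_mono flip: sum_ennreal)
qed

section \<open>The stochastic convolution\<close>


lemma nn_integral_sum_sq_le:
  fixes f :: "'k \<Rightarrow> 'a \<Rightarrow> real"
  assumes [measurable]: "\<And>k. k \<in> F \<Longrightarrow> f k \<in> borel_measurable M"
  shows "(\<integral>\<^sup>+\<omega>. ennreal ((\<Sum>k\<in>F. f k \<omega>)\<^sup>2) \<partial>M) \<le>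
    ennreal (real (card F)) * (\<Sum>k\<in>F. \<integral>\<^sup>+\<omega>. ennreal ((f k \<omega>)\<^sup>2) \<partial>M)"
proof -
  have "(\<integral>\<^sup>+\<omega>. ennreal ((\<Sum>k\<in>F. f k \<omega>)\<^sup>2) \<partial>M) \<le>
      (\<integral>\<^sup>+\<omega>. ennreal (real (card F)) * (\<Sum>k\<in>F. ennreal ((f k \<omega>)\<^sup>2)) \<partial>M)"
  proof (intro nn_integral_mono)
    fix \<omega>
    have "(\<Sum>k\<in>F. f k \<omega>)\<^sup>2 \<le> real (card F) * (\<Sum>k\<in>F. (f k \<omega>)\<^sup>2)"
      using sum_squared_le_sum_of_squares[of "\<lambda>k. f k \<omega>" F] by (simp add: mult.commute)
    then have "ennreal ((\<Sum>k\<in>F. f k \<omega>)\<^sup>2) \<le> ennreal (real (card F) * (\<Sum>k\<in>F. (f k \<omega>)\<^sup>2))"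
      by (rule ennreal_leI)
    also have "\<dots> = ennreal (real (card F)) * (\<Sum>k\<in>F. ennreal ((f k \<omega>)\<^sup>2))"
      by (subst sum_ennreal) (auto simp: ennreal_mult sum_nonneg)
    finally show "ennreal ((\<Sum>k\<in>F. f k \<omega>)\<^sup>2) \<le> ennreal (real (card F)) * (\<Sum>k\<in>F. ennreal ((f k \<omega>)\<^sup>2))" .
  qed
  also have "\<dots> = ennreal (real (card F)) * (\<Sum>k\<in>F. \<integral>\<^sup>+\<omega>. ennreal ((f k \<omega>)\<^sup>2) \<partial>M)"
    by (simp add: nn_integral_cmult nn_integral_sum del: sum_ennreal)
  finally show ?thesis .
qed

lemma nn_integral_sq_le:
  fixes f g :: "'a \<Rightarrow> real"
  assumes "f \<in> borel_measurable M" "g \<in> borel_measurable M"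
  shows "(\<integral>\<^sup>+\<omega>. ennreal ((f \<omega>)\<^sup>2) \<partial>M) \<le>
    2 * (\<integral>\<^sup>+\<omega>. ennreal ((g \<omega>)\<^sup>2) \<partial>M) + 2 * (\<integral>\<^sup>+\<omega>. ennreal ((f \<omega> - g \<omega>)\<^sup>2) \<partial>M)"
  using nn_integral_norm_add_sq_le[of g M "\<lambda>\<omega>. f \<omega> - g \<omega>" 1] assms by simp

text \<open>The isometry is transferred from step functions by repeated use of (a+b)^2 \<le> 2 a^2 +
  2 b^2, which produces the factors 4 and 8. The factor \<open>card F\<close> affects only terms
  that vanish with the step approximations.\<close>

lemma (in prob_space) wiener_integrals_second_moment:
  assumes W: "cylindrical_wiener M K e \<beta>" and F: "finite F" "F \<subseteq> K"
    and I: "\<And>k. k \<in> F \<Longrightarrow> has_wiener_integral M (\<beta> k) t (f k) (I k)"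
    and [measurable]: "X \<in> borel_measurable M"
  shows "(\<Sum>k\<in>F. L2norm_sq t (f k)) \<le> 4 * (\<integral>\<^sup>+\<omega>. ennreal ((X \<omega>)\<^sup>2) \<partial>M) +
    8 * (\<integral>\<^sup>+\<omega>. ennreal (((\<Sum>k\<in>F. I k \<omega>) - X \<omega>)\<^sup>2) \<partial>M)"
proof -
  have "\<forall>k\<in>F. \<exists>xs. (\<forall>n::nat. step_valid t (xs n)) \<and>
      (\<lambda>n. L2norm_sq t (\<lambda>s. step_fun (xs n) s - f k s)) \<longlonglongrightarrow> 0 \<and>
      (\<lambda>n. \<integral>\<^sup>+\<omega>. ennreal ((step_integral (\<beta> k) (xs n) \<omega> - I k \<omega>)\<^sup>2) \<partial>M) \<longlonglongrightarrow> 0"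
    using I unfolding has_wiener_integral_def by blast
  then obtain xs where xs: "\<And>k n. k \<in> F \<Longrightarrow> step_valid t (xs k n)"
    and lim1: "\<And>k. k \<in> F \<Longrightarrow> (\<lambda>n. L2norm_sq t (\<lambda>s. step_fun (xs k n) s - f k s)) \<longlonglongrightarrow> 0"
    and lim2: "\<And>k. k \<in> F \<Longrightarrow>
      (\<lambda>n. \<integral>\<^sup>+\<omega>. ennreal ((step_integral (\<beta> k) (xs k n) \<omega> - I k \<omega>)\<^sup>2) \<partial>M) \<longlonglongrightarrow> 0"
    unfolding bchoice_iff by blast
  have fm[measurable]: "(\<lambda>s. indicator {0..t} s *\<^sub>R f k s) \<in> borel_measurable lborel" if "k \<in> F" for k
    using I[OF that] by (intro L2_measurable) (simp add: has_wiener_integral_def)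
  have Im[measurable]: "I k \<in> borel_measurable M" if "k \<in> F" for k
    using I[OF that] by (simp add: has_wiener_integral_def)
  have sfm[measurable]: "step_fun ys \<in> borel_measurable lborel" for ys
    unfolding step_fun_def[abs_def]
  proof (induction ys)
    case (Cons y ys)
    obtain a b c where "y = (a, b, c)" by (cases y)
    with Cons show ?case by simp
  qed simp
  have sim: "step_integral (\<beta> k) ys \<in> borel_measurable M" if "k \<in> F" "step_valid t ys" for k ys
  proof -
    have \<beta>: "\<beta> k a \<in> borel_measurable M" if "a \<ge> 0" for a
      using W F(2) \<open>k \<in> F\<close> that by (auto simp: cylindrical_wiener_def brownian_motion_def)
    show ?thesis
      using that(2) unfolding step_integral_def[abs_def]
    proof (induction ys)
      case (Cons y ys)
      obtain a b c where y: "y = (a, b, c)" by (cases y)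
      with Cons have "0 \<le> a" "0 \<le> b" "step_valid t ys" by (auto simp: step_valid_def)
      with Cons \<beta>[of a] \<beta>[of b] show ?case by (simp add: y)
    qed simp
  qed
  define D where "D n = (\<Sum>k\<in>F. L2norm_sq t (\<lambda>s. step_fun (xs k n) s - f k s))" for n
  define R where "R n = (\<Sum>k\<in>F. \<integral>\<^sup>+\<omega>. ennreal ((step_integral (\<beta> k) (xs k n) \<omega> - I k \<omega>)\<^sup>2) \<partial>M)" for n
  define V where "V = (\<integral>\<^sup>+\<omega>. ennreal ((X \<omega>)\<^sup>2) \<partial>M)"
  define \<delta> where "\<delta> = (\<integral>\<^sup>+\<omega>. ennreal (((\<Sum>k\<in>F. I k \<omega>) - X \<omega>)\<^sup>2) \<partial>M)"
  let ?c = "ennreal (real (card F))"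
  have bound: "(\<Sum>k\<in>F. L2norm_sq t (f k)) \<le> 4 * V + 8 * \<delta> + (8 * ?c * R n + 2 * D n)" for n
  proof -
    define Y where "Y \<omega> = (\<Sum>k\<in>F. step_integral (\<beta> k) (xs k n) \<omega>)" for \<omega>
    have Ym[measurable]: "Y \<in> borel_measurable M"
      unfolding Y_def using sim xs by (intro borel_measurable_sum) auto
    have "L2norm_sq t (f k) \<le> 2 * L2norm_sq t (step_fun (xs k n)) +
        2 * L2norm_sq t (\<lambda>s. step_fun (xs k n) s - f k s)" if "k \<in> F" for k
    proof -
      have [measurable]: "(\<lambda>s. indicator {0..t} s *\<^sub>R step_fun (xs k n) s) \<in> borel_measurable lborel"
        by measurable
      have "((norm (indicator {0..t} s *\<^sub>R f k s - indicator {0..t} s *\<^sub>R step_fun (xs k n) s))\<^sup>2) =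
          ((norm (indicator {0..t} s *\<^sub>R (step_fun (xs k n) s - f k s)))\<^sup>2)" for s
        by (simp add: indicator_def power2_commute)
      then show ?thesis
        using nn_integral_sq_le[OF fm[OF that], of "\<lambda>s. indicator {0..t} s *\<^sub>R step_fun (xs k n) s"]
        by (simp add: L2norm_sq_eq)
    qed
    then have "(\<Sum>k\<in>F. L2norm_sq t (f k)) \<le> (\<Sum>k\<in>F. 2 * L2norm_sq t (step_fun (xs k n)) +
        2 * L2norm_sq t (\<lambda>s. step_fun (xs k n) s - f k s))"
      by (rule sum_mono)
    also have "\<dots> = 2 * (\<Sum>k\<in>F. L2norm_sq t (step_fun (xs k n))) + 2 * D n"
      by (simp add: D_def sum.distrib sum_distrib_left)
    also have "\<dots> \<le> 2 * (\<integral>\<^sup>+\<omega>. ennreal ((Y \<omega>)\<^sup>2) \<partial>M) + 2 * D n"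
      unfolding Y_def using xs
      by (intro add_right_mono mult_left_mono step_integrals_second_moment[OF W F]) auto
    also have "(\<integral>\<^sup>+\<omega>. ennreal ((Y \<omega>)\<^sup>2) \<partial>M) \<le> 2 * V + 2 * (\<integral>\<^sup>+\<omega>. ennreal ((Y \<omega> - X \<omega>)\<^sup>2) \<partial>M)"
      unfolding V_def by (rule nn_integral_sq_le) measurable
    also have "(\<integral>\<^sup>+\<omega>. ennreal ((Y \<omega> - X \<omega>)\<^sup>2) \<partial>M) \<le>
        2 * (\<integral>\<^sup>+\<omega>. ennreal (((\<Sum>k\<in>F. I k \<omega>) - X \<omega>)\<^sup>2) \<partial>M) +
        2 * (\<integral>\<^sup>+\<omega>. ennreal ((Y \<omega> - X \<omega> - ((\<Sum>k\<in>F. I k \<omega>) - X \<omega>))\<^sup>2) \<partial>M)"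
      by (rule nn_integral_sq_le) measurable
    also have "(\<integral>\<^sup>+\<omega>. ennreal ((Y \<omega> - X \<omega> - ((\<Sum>k\<in>F. I k \<omega>) - X \<omega>))\<^sup>2) \<partial>M) =
        (\<integral>\<^sup>+\<omega>. ennreal ((\<Sum>k\<in>F. step_integral (\<beta> k) (xs k n) \<omega> - I k \<omega>)\<^sup>2) \<partial>M)"
      by (simp add: Y_def sum_subtractf)
    also have "\<dots> \<le> ?c * R n"
      unfolding R_def using sim xs Im by (intro nn_integral_sum_sq_le borel_measurable_diff) auto
    finally have "(\<Sum>k\<in>F. L2norm_sq t (f k)) \<le> 2 * (2 * V + 2 * (2 * \<delta> + 2 * (?c * R n))) + 2 * D n"
      by (simp add: \<delta>_def add_mono mult_left_mono)
    also have "\<dots> = 4 * V + 8 * \<delta> + (8 * ?c * R n + 2 * D n)"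
    proof -
      have "2 * (2 * v + 2 * (2 * d + 2 * r)) + q = 4 * v + 8 * d + (8 * r + q)" for v d r q :: ennreal
        by (simp add: distrib_left add.assoc flip: mult.assoc)
      then show ?thesis by (simp add: mult.assoc)
    qed
    finally show ?thesis .
  qed
  have "R \<longlonglongrightarrow> (\<Sum>k\<in>F. 0)" unfolding R_def by (intro tendsto_sum lim2)
  then have R0: "(\<lambda>n. 8 * ?c * R n) \<longlonglongrightarrow> 8 * ?c * 0"
    by (intro ennreal_tendsto_cmult) (auto simp: ennreal_mult_less_top)
  have "D \<longlonglongrightarrow> (\<Sum>k\<in>F. 0)" unfolding D_def by (intro tendsto_sum lim1)
  then have D0: "(\<lambda>n. 2 * D n) \<longlonglongrightarrow> 2 * 0"
    by (intro ennreal_tendsto_cmult) auto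
  have "(\<lambda>n. 4 * V + 8 * \<delta> + (8 * ?c * R n + 2 * D n)) \<longlonglongrightarrow> 4 * V + 8 * \<delta> + (8 * ?c * 0 + 2 * 0)"
    by (intro tendsto_add tendsto_const R0 D0)
  then have "(\<Sum>k\<in>F. L2norm_sq t (f k)) \<le> 4 * V + 8 * \<delta> + (8 * ?c * 0 + 2 * 0)"
    by (rule LIMSEQ_le_const) (use bound in blast)
  then show ?thesis by (simp add: V_def \<delta>_def)
qed

text \<open>The finite-sum bound is used with the first n coordinates. As n grows its error term,
  the squared L2 distance of the partial sums from \<langle>Z(t), x'\<rangle>, disappears.\<close>

lemma (in prob_space) stochastic_convolution_energy:
  fixes U :: "real \<Rightarrow> 'h::real_inner \<Rightarrow> 'e::banach" and x' :: "'e \<Rightarrow>\<^sub>L real"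
  assumes W: "cylindrical_wiener M K e \<beta>"
    and X: "is_stochastic_convolution M K e \<beta> U t X"
    and [measurable]: "(\<lambda>\<omega>. x' (X \<omega>)) \<in> borel_measurable M"
  shows "(\<Sum>k. L2norm_sq t (\<lambda>s. x' (U (t - s) (e k))) * indicator K k) \<le>
    4 * (\<integral>\<^sup>+\<omega>. ennreal ((x' (X \<omega>))\<^sup>2) \<partial>M)"
proof -
  let ?f = "\<lambda>k s. x' (U (t - s) (e k))"
  obtain I where I: "\<And>k. k \<in> K \<Longrightarrow> has_wiener_integral M (\<beta> k) t (?f k) (I k)"
    and lim: "(\<lambda>n. \<integral>\<^sup>+\<omega>. ennreal (((\<Sum>k\<in>K \<inter> {..<n}. I k \<omega>) - x' (X \<omega>))\<^sup>2) \<partial>M) \<longlonglongrightarrow> 0"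
    using X unfolding is_stochastic_convolution_def by blast
  have upper: "(\<lambda>n. 4 * (\<integral>\<^sup>+\<omega>. ennreal ((x' (X \<omega>))\<^sup>2) \<partial>M) +
      8 * (\<integral>\<^sup>+\<omega>. ennreal (((\<Sum>k\<in>K \<inter> {..<n}. I k \<omega>) - x' (X \<omega>))\<^sup>2) \<partial>M)) \<longlonglongrightarrow>
      4 * (\<integral>\<^sup>+\<omega>. ennreal ((x' (X \<omega>))\<^sup>2) \<partial>M) + 8 * 0"
    by (intro tendsto_add tendsto_const ennreal_tendsto_cmult lim) simp
  have partial: "(\<lambda>n. \<Sum>k<n. L2norm_sq t (?f k) * indicator K k) \<longlonglongrightarrow> (\<Sum>k. L2norm_sq t (?f k) * indicator K k)"
    by (rule summable_LIMSEQ) simp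
  have le: "(\<Sum>k<n. L2norm_sq t (?f k) * indicator K k) \<le> 4 * (\<integral>\<^sup>+\<omega>. ennreal ((x' (X \<omega>))\<^sup>2) \<partial>M) +
      8 * (\<integral>\<^sup>+\<omega>. ennreal (((\<Sum>k\<in>K \<inter> {..<n}. I k \<omega>) - x' (X \<omega>))\<^sup>2) \<partial>M)" for n
  proof -
    have "(\<Sum>k<n. L2norm_sq t (?f k) * indicator K k) = (\<Sum>k\<in>K \<inter> {..<n}. L2norm_sq t (?f k))"
      by (rule sum.mono_neutral_cong_right) (auto simp: indicator_def)
    then show ?thesis
      using wiener_integrals_second_moment[OF W, of "K \<inter> {..<n}" t ?f I "\<lambda>\<omega>. x' (X \<omega>)"] I by simp
  qed
  have "(\<Sum>k. L2norm_sq t (?f k) * indicator K k) \<le>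
      4 * (\<integral>\<^sup>+\<omega>. ennreal ((x' (X \<omega>))\<^sup>2) \<partial>M) + 8 * 0"
    by (rule LIMSEQ_le[OF partial upper]) (use le in blast)
  then show ?thesis by simp
qed

theorem theorem3p13:
  fixes S :: "real \<Rightarrow> 'e::banach \<Rightarrow>\<^sub>L 'e"
    and A :: "'e \<Rightarrow> 'e" and D :: "'e set"
    and M \<omega> :: real
    and Q :: "'h::{real_inner, polish_space} \<Rightarrow> 'f::real_vector"
    and j :: "'e \<Rightarrow> 'f" and SF :: "real \<Rightarrow> 'f \<Rightarrow> 'e"
    and P :: "'p measure"
    and K :: "nat set" and e :: "nat \<Rightarrow> 'h" and \<beta> :: "nat \<Rightarrow> real \<Rightarrow> 'p \<Rightarrow> real"
    and Z :: "real \<Rightarrow> 'p \<Rightarrow> 'e"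
    and r :: real
  assumes "C0_semigroup S"
    and "is_generator S D A"
    and "M \<ge> 1" and "\<omega> > 0"
    and "\<And>t. t \<ge> 0 \<Longrightarrow> norm (S t) \<le> M * exp (- \<omega> * t)"
    and "semigroup_extension S j SF"
    and "linear Q"
    and "\<And>t. t > 0 \<Longrightarrow> bounded_linear (\<lambda>h. SF t (Q h))"
    and "prob_space P"
    and "cylindrical_wiener P K e \<beta>"
    and "\<And>t. t > 0 \<Longrightarrow> is_stochastic_convolution P K e \<beta> (\<lambda>t h. SF t (Q h)) t (Z t)"
    and "\<And>t. t > 0 \<Longrightarrow> gaussian_rv P (Z t)"
    and "r > 0"
  shows "compactin (ucc_topology {..0}) (level_set S (\<lambda>t h. SF t (Q h)) r)"
proof -
  interpret prob_space P by fact
  define U where "U t h = SF t (Q h)" for t h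
  have U_bl: "bounded_linear (U t)" if "t > 0" for t
    using assms(8)[OF that] by (simp add: U_def[abs_def])
  have S_U: "S s (U t h) = U (s + t) h" if "s \<ge> 0" "t > 0" for s t h
    using assms(6) that by (simp add: semigroup_extension_def U_def)
  interpret smoothing_semigroup S U M \<omega>
    by (rule smoothing_semigroup.intro[OF assms(1,3,4,5) U_bl S_U])
  have ce: "complete_orthonormal K e" using assms(10) by (simp add: cylindrical_wiener_def)
  \<comment> \<open>The indicator removes the arbitrary value \<open>U 0\<close>; on positive times
    continuity of U gives measurability.\<close>
  define v where "v x' k s = ennreal ((blinfun_apply x' (U s (e k)))\<^sup>2) * indicator {0<..} s"
    for x' :: "'e \<Rightarrow>\<^sub>L real" and k s
  \<comment> \<open>By Parseval this is the squared norm of the functional h \<mapsto>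
    \<langle>S(s)Q h, x'\<rangle>; it may be infinite for some s.\<close>
  define w where "w x' s = (\<Sum>k. v x' k s * indicator K k)" for x' :: "'e \<Rightarrow>\<^sub>L real" and s
  have v_meas[measurable]: "v x' k \<in> borel_measurable lborel" for x' k
  proof -
    have cont: "continuous_on {0<..} (\<lambda>s. x' (U s (e k)))" by (intro continuous_intros U_continuous)
    have [measurable]: "(\<lambda>s. indicator {0<..} s *\<^sub>R x' (U s (e k))) \<in> borel_measurable lborel"
      using borel_measurable_continuous_on_indicator[OF _ cont] by simp
    have "v x' k = (\<lambda>s. ennreal ((indicator {0<..} s *\<^sub>R x' (U s (e k)))\<^sup>2))"
      by (auto simp: v_def indicator_def fun_eq_iff)
    also have "\<dots> \<in> borel_measurable lborel" by measurable
    finally show ?thesis .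
  qed
  have reflect: "(\<integral>\<^sup>+s\<in>{0..t}. v x' k s \<partial>lborel) = L2norm_sq t (\<lambda>s. x' (U (t - s) (e k)))" for t x' k
  proof -
    have "(\<integral>\<^sup>+s\<in>{0..t}. v x' k s \<partial>lborel) = (\<integral>\<^sup>+s. v x' k (t + - 1 * s) * indicator {0..t} (t + - 1 * s) \<partial>lborel)"
      using nn_integral_real_affine[of "\<lambda>s. v x' k s * indicator {0..t} s" "- 1" t] v_meas[of x' k] by simp
    also have "\<dots> = L2norm_sq t (\<lambda>s. x' (U (t - s) (e k)))"
      unfolding L2norm_sq_def
    proof (rule nn_integral_cong_AE)
      show "AE s in lborel. v x' k (t + - 1 * s) * indicator {0..t} (t + - 1 * s) =
          ennreal ((norm (x' (U (t - s) (e k))))\<^sup>2) * indicator {0..t} s"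
        using AE_lborel_singleton[of t]
        by eventually_elim (auto simp: v_def indicator_def)
    qed
    finally show ?thesis .
  qed
  have energy: "(\<integral>\<^sup>+s\<in>{0..t}. w x' s \<partial>lborel) \<le> 4 * (\<integral>\<^sup>+\<omega>. ennreal ((x' (Z t \<omega>))\<^sup>2) \<partial>P)"
    if t: "t > 0" for t x'
  proof -
    have "(\<integral>\<^sup>+s\<in>{0..t}. w x' s \<partial>lborel) = (\<integral>\<^sup>+s. (\<Sum>k. v x' k s * indicator {0..t} s * indicator K k) \<partial>lborel)"
      unfolding w_def by (intro nn_integral_cong) (simp add: mult_ac flip: ennreal_suminf_cmult)
    also have "\<dots> = (\<Sum>k. (\<integral>\<^sup>+s\<in>{0..t}. v x' k s \<partial>lborel) * indicator K k)"
      by (subst nn_integral_suminf) (auto simp: nn_integral_multc)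
    also have "\<dots> = (\<Sum>k. L2norm_sq t (\<lambda>s. x' (U (t - s) (e k))) * indicator K k)"
      by (simp add: reflect)
    also have "\<dots> \<le> 4 * (\<integral>\<^sup>+\<omega>. ennreal ((x' (Z t \<omega>))\<^sup>2) \<partial>P)"
      using assms(11,12)[OF t] unfolding U_def[symmetric]
      by (intro stochastic_convolution_energy[OF assms(10)]) (auto simp: gaussian_rv_def real_gaussian_def)
    finally show ?thesis .
  qed
  interpret controlled_semigroup S U M \<omega> w
  proof unfold_locales
    fix x' show "w x' \<in> borel_measurable lborel" unfolding w_def by measurable
  next
    fix t :: real and x' :: "'e \<Rightarrow>\<^sub>L real" and h assume t: "t > 0"
    have "bounded_linear (\<lambda>h. blinfun_apply x' (U t h))"
      by (rule bounded_linear_compose[OF blinfun.bounded_linear_right U_bl[OF t]])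
    from complete_orthonormal_functional_bound[OF ce this, of h] t
    show "ennreal ((blinfun_apply x' (U t h))\<^sup>2) \<le> w x' t * ennreal ((norm h)\<^sup>2)"
      by (simp add: w_def v_def)
  next
    fix t :: real and x' :: "'e \<Rightarrow>\<^sub>L real" assume t: "t > 0"
    have "(\<integral>\<^sup>+\<omega>. ennreal ((blinfun_apply x' (Z t \<omega>))\<^sup>2) \<partial>P) < \<infinity>"
      using assms(12)[OF t] by (intro real_gaussian_second_moment_finite) (auto simp: gaussian_rv_def)
    then show "(\<integral>\<^sup>+s\<in>{0..t}. w x' s \<partial>lborel) < \<infinity>"
      by (intro le_less_trans[OF energy[OF t]]) (simp add: ennreal_mult_less_top)
  next
    fix t :: real assume t: "t > 0"
    have Z[measurable]: "Z t \<in> borel_measurable P"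
      and gauss: "real_gaussian P (\<lambda>\<omega>. blinfun_apply x' (Z t \<omega>))" for x'
      using assms(12)[OF t] by (auto simp: gaussian_rv_def)
    obtain C0 where C0: "countable C0" "AE \<omega> in P. Z t \<omega> \<in> closure C0"
      using assms(12)[OF t] by (auto simp: gaussian_rv_def)
    \<comment> \<open>The mass 3/4 is the threshold in the bound for scalar Gaussian second
      moments.\<close>
    obtain C where C: "compact C" "prob {\<omega> \<in> space P. Z t \<omega> \<in> C} \<ge> 1 - 1/4"
      using tight_random_variable[OF Z C0, of "1/4"] by auto
    \<comment> \<open>116 = 4 * 29: the factor of the energy estimate times the bound on the second
      moment.\<close>
    have "(\<integral>\<^sup>+s\<in>{0..t}. w x' s \<partial>lborel) \<le> ennreal 116" if x': "\<forall>c\<in>C. \<bar>blinfun_apply x' c\<bar> \<le> 1" for x'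
    proof -
      have [measurable]: "(\<lambda>\<omega>. x' (Z t \<omega>)) \<in> borel_measurable P"
        using gauss[of x'] by (simp add: real_gaussian_def)
      have "prob {\<omega> \<in> space P. Z t \<omega> \<in> C} \<le> prob {\<omega> \<in> space P. \<bar>x' (Z t \<omega>)\<bar> \<le> 1}"
        using x' by (intro finite_measure_mono) auto
      with C(2) have "(\<integral>\<^sup>+\<omega>. ennreal ((x' (Z t \<omega>))\<^sup>2) \<partial>P) \<le> ennreal 29"
        by (intro real_gaussian_second_moment_le gauss) simp
      then have "4 * (\<integral>\<^sup>+\<omega>. ennreal ((x' (Z t \<omega>))\<^sup>2) \<partial>P) \<le> 4 * ennreal 29"
        by (rule mult_left_mono) simp
      also have "4 * ennreal 29 = ennreal 116" by simp
      finally show ?thesis by (rule order_trans[OF energy[OF t]])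
    qed
    with C(1) show "\<exists>C \<kappa>. compact C \<and> (\<forall>x'. (\<forall>c\<in>C. \<bar>blinfun_apply x' c\<bar> \<le> 1) \<longrightarrow>
        (\<integral>\<^sup>+s\<in>{0..t}. w x' s \<partial>lborel) \<le> ennreal \<kappa>)" by blast
  qed
  have "(\<lambda>t h. SF t (Q h)) = U" by (simp add: U_def fun_eq_iff)
  then show ?thesis using level_set_compactin[of r] assms(13) by simp
qed

end
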